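(* Let $S\subset\mathbb{R}^3$ be a connected orientable $\mathcal{C}^2$ surface with unit normal $N$. There exists $r\in\mathbb{R}\setminus\{0\}$ such that the speed of the ball $B_r$ rolling on $S$ is constant if and only if $S$ is (a subset of) a plane, a circular cylinder, or a sphere. In particular, if $S$ is (a subset of) a circular cylinder of radius $R$ oriented inward (i.e. $N$ points toward the axis), then the value of $r$ for which the speed of $B_r$ is constant is $r=2R$.
   Context: Surfaces and curvature. $S$ is a connected orientable $\mathcal{C}^2$ surface in $\mathbb{R}^3$ with chosen unit normal field $N$. Curves are of class at least $\mathcal{C}^2$. The ball. For $p\in S$ and a real number $r\neq 0$ (possibly negative), $B_r$ is the ball of radius $|r|$ centered at $p+rN_p$. The object that actually rolls is its boundary sphere $\widetilde S=\partial B_r$, which is tangent to $S$ at $p$. Intersections between $B_r$ and $S$ are allowed. Rolling. Let $\gamma\colon[0,\ell]\to S$ be a unit-speed curve with $\gamma(0)=p$. A motion of $\widetilde S$ on $S$ along $\gamma$ is a smooth (it suffices: continuously differentiable in $t$) one-parameter family $f_t$, $t\in[0,\ell]$, of direct isometries $f_t(x)=A_tx+b_t$ of $\mathbb{R}^3$ with $f_0=\mathrm{id}$ such that $f_t(\widetilde S)$ is tangent to $S$ at $\gamma(t)$ for every $t$. Its instantaneous motion at $t$ is the vector field $X_t(x)=f_t'(f_t^{-1}(x))=Q_tx+v_t$, where the prime denotes the $t$-derivative, $Q_t=A_t'A_t^T$ is skew-symmetric and $v_t=b_t'-Q_tb_t$. The angular velocity $\omega_t$ is the vector with $Q_tx=\omega_t\times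 x$ for all $x$. The motion is rotational if for every $t$ one has $Q_t\neq 0$ and $X_t(\gamma(t))=0$. A rolling (without skidding or spinning) of $B_r$ on $S$ along $\gamma$ is a rotational motion such that $\omega_t$ is tangent to $S$ at $\gamma(t)$ for every $t$. For the purposes here it suffices that a rolling exists along an arbitrarily short initial subarc $\gamma|_{[0,\varepsilon]}$, $\varepsilon>0$. Speed. The speed of $B_r$ at time $t$ while rolling along $\gamma$ is the length $\left|\frac{d}{dt}f_t(p+rN_p)\right|$ of the velocity of its center. The speed of $B_r$ on $S$ is said to be constant if it depends neither on the point of $S$ nor on the direction of rolling: there is a constant $c$ such that for every $p\in S$ and every unit-speed curve $\gamma$ in $S$ with $\gamma(0)=p$, the ball $B_r$ (placed at $p$) rolls on $S$ along an initial subarc of $\gamma$, with speed equal to $c$ at all times. *)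

theory Defs
  imports "HOL-Analysis.Analysis"
begin

section \<open>Curves and surfaces of class \<open>C\<^sup>2\<close>\<close>

text \<open>Derivatives are taken within \<open>D\<close>: for open \<open>D\<close> this is ordinary differentiability, for a
  nondegenerate compact interval the derivatives at the end points are one-sided.\<close>

definition C1_on :: "'a::real_normed_vector set \<Rightarrow> ('a \<Rightarrow> 'b::real_normed_vector) \<Rightarrow> bool" where
  "C1_on D f \<longleftrightarrow> (\<exists>f' :: 'a \<Rightarrow> 'a \<Rightarrow>\<^sub>L 'b.
     (\<forall>x\<in>D. (f has_derivative blinfun_apply (f' x)) (at x within D)) \<and> continuous_on D f')"

definition C2_on :: "'a::real_normed_vector set \<Rightarrow> ('a \<Rightarrow> 'b::real_normed_vector) \<Rightarrow> bool" where
  "C2_on D f \<longleftrightarrow> (\<exists>f' :: 'a \<Rightarrow> 'a \<Rightarrow>\<^sub>L 'b.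
     (\<forall>x\<in>D. (f has_derivative blinfun_apply (f' x)) (at x within D)) \<and> C1_on D f')"

definition C2_surface :: "(real^3) set \<Rightarrow> bool" where
  "C2_surface S \<longleftrightarrow> (\<forall>p\<in>S. \<exists>(U :: (real^2) set) V \<phi> \<psi>.
     open U \<and> open V \<and> p \<in> V \<and> homeomorphism U (S \<inter> V) \<phi> \<psi> \<and> C2_on U \<phi> \<and>
     (\<forall>u\<in>U. inj (frechet_derivative \<phi> (at u))))"

definition tangent_plane :: "(real^3) set \<Rightarrow> real^3 \<Rightarrow> (real^3) set" where
  "tangent_plane S p = {v. \<exists>\<epsilon>>0. \<exists>\<alpha>. C2_on {-\<epsilon><..<\<epsilon>} \<alpha> \<and> \<alpha> ` {-\<epsilon><..<\<epsilon>} \<subseteq> S \<and> \<alpha> 0 = p \<and>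
     (\<alpha> has_vector_derivative v) (at 0)}"

definition unit_normal_field :: "(real^3) set \<Rightarrow> (real^3 \<Rightarrow> real^3) \<Rightarrow> bool" where
  "unit_normal_field S N \<longleftrightarrow> continuous_on S N \<and>
     (\<forall>p\<in>S. norm (N p) = 1 \<and> (\<forall>v\<in>tangent_plane S p. N p \<bullet> v = 0))"

definition unit_speed_curve :: "(real^3) set \<Rightarrow> real \<Rightarrow> (real \<Rightarrow> real^3) \<Rightarrow> bool" where
  "unit_speed_curve S l \<gamma> \<longleftrightarrow> C2_on {0..l} \<gamma> \<and> \<gamma> ` {0..l} \<subseteq> S \<and>
     (\<forall>t\<in>{0..l}. norm (vector_derivative \<gamma> (at t within {0..l})) = 1)"

definition tangent_at :: "(real^3) set \<Rightarrow> (real^3) set \<Rightarrow> real^3 \<Rightarrow> bool" where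
  "tangent_at M S q \<longleftrightarrow> q \<in> M \<and> q \<in> S \<and> tangent_plane M q = tangent_plane S q"


section \<open>Rolling\<close>

text \<open>A one-parameter family of affine maps \<open>f\<^sub>t(x) = A\<^sub>t x + b\<^sub>t\<close> is given by the pair \<open>A\<close>, \<open>b\<close>;
  \<open>l\<close> is always the length of the time interval \<open>[0,l]\<close>.\<close>

definition affine_family :: "(real \<Rightarrow> real^3^3) \<Rightarrow> (real \<Rightarrow> real^3) \<Rightarrow> real \<Rightarrow> real^3 \<Rightarrow> real^3" where
  "affine_family A b t x = A t *v x + b t"

definition motion_on ::
    "(real^3) set \<Rightarrow> (real^3) set \<Rightarrow> real \<Rightarrow> (real \<Rightarrow> real^3)
      \<Rightarrow> (real \<Rightarrow> real^3^3) \<Rightarrow> (real \<Rightarrow> real^3) \<Rightarrow> bool" where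
  "motion_on M S l \<gamma> A b \<longleftrightarrow>
     C1_on {0..l} A \<and> C1_on {0..l} b \<and> (\<forall>t\<in>{0..l}. rotation_matrix (A t)) \<and>
     affine_family A b 0 = id \<and>
     (\<forall>t\<in>{0..l}. tangent_at (affine_family A b t ` M) S (\<gamma> t))"

definition spin_matrix :: "real \<Rightarrow> (real \<Rightarrow> real^3^3) \<Rightarrow> real \<Rightarrow> real^3^3" where
  "spin_matrix l A t = vector_derivative A (at t within {0..l}) ** transpose (A t)"

definition instantaneous_motion ::
    "real \<Rightarrow> (real \<Rightarrow> real^3^3) \<Rightarrow> (real \<Rightarrow> real^3) \<Rightarrow> real \<Rightarrow> real^3 \<Rightarrow> real^3" where
  "instantaneous_motion l A b t x = spin_matrix l A t *v x +
     (vector_derivative b (at t within {0..l}) - spin_matrix l A t *v b t)"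

definition angular_velocity :: "real \<Rightarrow> (real \<Rightarrow> real^3^3) \<Rightarrow> real \<Rightarrow> real^3" where
  "angular_velocity l A t = (THE \<omega>. \<forall>x. spin_matrix l A t *v x = cross3 \<omega> x)"

definition rotational :: "real \<Rightarrow> (real \<Rightarrow> real^3) \<Rightarrow> (real \<Rightarrow> real^3^3) \<Rightarrow> (real \<Rightarrow> real^3) \<Rightarrow> bool" where
  "rotational l \<gamma> A b \<longleftrightarrow>
     (\<forall>t\<in>{0..l}. spin_matrix l A t \<noteq> 0 \<and> instantaneous_motion l A b t (\<gamma> t) = 0)"

text \<open>The rolling ball is placed at \<open>\<gamma> 0\<close>; what moves is its boundary sphere.\<close>

definition ball_center :: "(real^3 \<Rightarrow> real^3) \<Rightarrow> real \<Rightarrow> real^3 \<Rightarrow> real^3" where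
  "ball_center N r p = p + r *\<^sub>R N p"

definition rolling ::
    "(real^3) set \<Rightarrow> (real^3 \<Rightarrow> real^3) \<Rightarrow> real \<Rightarrow> real \<Rightarrow> (real \<Rightarrow> real^3)
      \<Rightarrow> (real \<Rightarrow> real^3^3) \<Rightarrow> (real \<Rightarrow> real^3) \<Rightarrow> bool" where
  "rolling S N r l \<gamma> A b \<longleftrightarrow>
     motion_on (sphere (ball_center N r (\<gamma> 0)) \<bar>r\<bar>) S l \<gamma> A b \<and> rotational l \<gamma> A b \<and>
     (\<forall>t\<in>{0..l}. angular_velocity l A t \<in> tangent_plane S (\<gamma> t))"

definition rolling_speed ::
    "real \<Rightarrow> (real \<Rightarrow> real^3^3) \<Rightarrow> (real \<Rightarrow> real^3) \<Rightarrow> real^3 \<Rightarrow> real \<Rightarrow> real" where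
  "rolling_speed l A b c t = norm (vector_derivative (\<lambda>s. affine_family A b s c) (at t within {0..l}))"

definition constant_speed :: "(real^3) set \<Rightarrow> (real^3 \<Rightarrow> real^3) \<Rightarrow> real \<Rightarrow> bool" where
  "constant_speed S N r \<longleftrightarrow>
     (\<exists>c. \<forall>p\<in>S. \<forall>l>0. \<forall>\<gamma>. unit_speed_curve S l \<gamma> \<and> \<gamma> 0 = p \<longrightarrow>
        (\<exists>\<epsilon>. 0 < \<epsilon> \<and> \<epsilon> \<le> l \<and> (\<exists>A b. rolling S N r \<epsilon> \<gamma> A b \<and>
           (\<forall>t\<in>{0..\<epsilon>}. rolling_speed \<epsilon> A b (ball_center N r p) t = c))))"


section \<open>The model surfaces\<close>

definition plane_through :: "real^3 \<Rightarrow> real^3 \<Rightarrow> (real^3) set" where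
  "plane_through a n = {x. n \<bullet> (x - a) = 0}"

definition axis_line :: "real^3 \<Rightarrow> real^3 \<Rightarrow> (real^3) set" where
  "axis_line a u = range (\<lambda>s. a + s *\<^sub>R u)"

definition circular_cylinder :: "real^3 \<Rightarrow> real^3 \<Rightarrow> real \<Rightarrow> (real^3) set" where
  "circular_cylinder a u R = {x. infdist x (axis_line a u) = R}"


section \<open>Consistency of the instantaneous motion and the angular velocity\<close>

lemma bounded_bilinear_matrix_vector_mult:
  "bounded_bilinear ((*v) :: real^'n^'m \<Rightarrow> real^'n \<Rightarrow> real^'m)"
  unfolding bilinear_conv_bounded_bilinear[symmetric] bilinear_def
  by (auto intro!: linearI simp: matrix_vector_mult_def vec_eq_iff algebra_simps sum.distrib
      sum_distrib_left)

lemma C1_on_has_vector_derivative: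
  fixes f :: "real \<Rightarrow> 'b::real_normed_vector"
  assumes "C1_on {0..l} f" "t \<in> {0..l}"
  shows "(f has_vector_derivative vector_derivative f (at t within {0..l})) (at t within {0..l})"
proof -
  obtain f' where "(f has_derivative blinfun_apply (f' t)) (at t within {0..l})"
    using assms unfolding C1_on_def by blast
  then have "f differentiable at t within {0..l}"
    by (rule differentiableI)
  then show ?thesis
    by (simp add: vector_derivative_works)
qed

text \<open>\<open>X\<^sub>t(x) = f\<^sub>t'(f\<^sub>t\<^sup>-\<^sup>1(x))\<close>:\<close>

lemma instantaneous_motion_affine_family:
  assumes "C1_on {0..l} A" "C1_on {0..l} b" "rotation_matrix (A t)" "t \<in> {0..l}"
  shows "((\<lambda>s. affine_family A b s x) has_vector_derivative
           instantaneous_motion l A b t (affine_family A b t x)) (at t within {0..l})"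
proof -
  let ?F = "at t within {0..l}"
  have "((\<lambda>s. A s *v x + b s) has_vector_derivative
          (A t *v 0 + vector_derivative A ?F *v x) + vector_derivative b ?F) ?F"
    using assms
    by (intro has_vector_derivative_add C1_on_has_vector_derivative
        bounded_bilinear.has_vector_derivative[OF bounded_bilinear_matrix_vector_mult]
        has_vector_derivative_const) auto
  moreover have "spin_matrix l A t *v (A t *v x) = vector_derivative A ?F *v x"
    using assms(3)
    by (simp add: spin_matrix_def matrix_vector_mul_assoc rotation_matrix_def orthogonal_matrix_def
        matrix_mul_assoc[symmetric])
  ultimately show ?thesis
    by (simp add: affine_family_def instantaneous_motion_def matrix_vector_right_distrib)
qed

text \<open>The description defining \<open>angular_velocity\<close> is proper whenever the spin matrix is
  skew-symmetric:\<close>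

lemma skew_cross3_unique:
  fixes Q :: "real^3^3"
  assumes "transpose Q = - Q"
  shows "\<exists>!\<omega>. \<forall>x. Q *v x = cross3 \<omega> x"
proof -
  have skew: "Q $ i $ j = - Q $ j $ i" for i j
  proof -
    have "transpose Q $ j $ i = - Q $ j $ i"
      unfolding assms by (simp only: vector_uminus_component)
    then show ?thesis by (simp add: transpose_def)
  qed
  show ?thesis
  proof (rule ex1I)
    have diag: "Q $ 1 $ 1 = 0" "Q $ 2 $ 2 = 0" "Q $ 3 $ 3 = 0"
      using skew[of 1 1] skew[of 2 2] skew[of 3 3] by auto
    show "\<forall>x. Q *v x = cross3 (vector [Q $ 3 $ 2, Q $ 1 $ 3, Q $ 2 $ 1]) x"
      unfolding vec_eq_iff forall_3 cross3_def matrix_vector_mult_def sum_3 vec_lambda_beta vector_3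
        diag skew[of 2 3] skew[of 3 1] skew[of 1 2]
      by (simp only: algebra_simps) simp
  next
    fix \<omega> assume eq: "\<forall>x. Q *v x = cross3 \<omega> x"
    have "Q *v axis 1 1 = cross3 \<omega> (axis 1 1)" "Q *v axis 2 1 = cross3 \<omega> (axis 2 1)"
      using eq by blast+
    then show "\<omega> = vector [Q $ 3 $ 2, Q $ 1 $ 3, Q $ 2 $ 1]"
      unfolding vec_eq_iff forall_3 cross3_def matrix_vector_mult_def sum_3 vec_lambda_beta vector_3
        axis_def using skew[of 1 3] by simp
  qed
qed

end

theory Submission
  imports Defs
begin

text \<open>The centre of the rolling ball is known without solving for the motion: at each instant the moving
  sphere is tangent to \<open>S\<close> at the contact point, so its centre lies on the normal line at distance
  \<open>|r|\<close>, and by continuity it stays on the side where it started. The centre therefore describes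
  \<open>X + r N\<close>, and rolling in the unit direction \<open>v\<close> has speed \<open>|v + r dN(v)|\<close>. Constant speed \<open>c\<close> says
  that the differential of \<open>X + r N\<close> multiplies every tangent vector's length by \<open>c\<close>
  (\<open>constant_speed_imp_conformal_offset\<close>).

  Put \<open>g = X + r N + c X\<close> and \<open>h = X + r N - c X\<close> with \<open>c > 0\<close>. Polarising the norm identity and using
  the symmetry of the second fundamental form gives \<open>dg(v) \<bullet> dh(w) = 0\<close> at every point. Both
  differentials are tangent and \<open>g - h = 2 c X\<close> is an immersion, so their ranks are \<open>(0,2)\<close>, \<open>(2,0)\<close> or
  \<open>(1,1)\<close>. If one of them vanishes, then some \<open>k X + r N\<close> is locally constant and the surface is planar
  or spherical there; for \<open>c = 0\<close> already \<open>X + r N\<close> is locally constant. In the case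
  \<open>(1,1)\<close> the classical argument differentiates the principal curvatures through the Codazzi equations, which needs more derivatives than a \<open>C\<^sup>2\<close> surface has.
  Instead, one component of \<open>g\<close> and one of \<open>h\<close> serve as coordinates: \<open>g\<close> depends on the first and
  \<open>h\<close> on the second only, so the gradient of \<open>g\<close> at one point is orthogonal to the gradient of
  \<open>h\<close> at \<^emph>\<open>another\<close> (\<open>global_orthogonality\<close>). In three dimensions this confines one of the two families of
  gradients to a line. It cannot be that of \<open>h\<close>: the normal would be orthogonal to a fixed vector
  \<open>h' w\<close>, and differentiating this in the direction \<open>w\<close> gives \<open>(c + 1) |h' w|\<^sup>2 = 0\<close>. So it is that of \<open>g\<close>, and
  the same differentiation now yields \<open>c = 1\<close>: the normal turns only about a fixed axis
  (\<open>conformal_offset_alternatives\<close>).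

  In every case \<open>L X + r N\<close> is locally constant for a linear map \<open>L\<close>, either a multiple of the identity
  or twice the projection along an axis direction. Such an \<open>L\<close> is determined by its values on the tangent plane, hence
  is the same along the connected surface, and the equation \<open>L X + r N = K\<close> describes a plane, a sphere or a
  circular cylinder (\<open>affine_normal_imp_model\<close>).

  Conversely, on each model surface \<open>N\<close> is an affine function of \<open>X\<close>, and for a suitable \<open>r\<close> one has
  \<open>X + r N = T X + K\<close> with a linear similarity \<open>T\<close>. The angular velocity of the rolling is then forced to be
  \<open>N \<times> T(\<gamma>') / r\<close>, and integrating it for a short time produces the motion
  (\<open>affine_normal_imp_constant_speed\<close>). On an inward oriented cylinder of radius \<open>R\<close> the axial direction has
  speed \<open>1\<close> and the circular direction has speed \<open>|1 - r/R|\<close>, which for \<open>r \<noteq> 0\<close> are equal precisely when \<open>r = 2 R\<close>.\<close>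

section \<open>Calculus of continuously differentiable maps\<close>

text \<open>On a Euclidean domain continuity of a derivative in operator norm is the same as continuity of each
  directional derivative, so no bounded linear functions have to be exhibited.\<close>

lemma C1_onI:
  fixes f :: "'a::euclidean_space \<Rightarrow> 'b::real_normed_vector"
  assumes der: "\<And>x. x \<in> D \<Longrightarrow> (f has_derivative F x) (at x within D)"
    and cont: "\<And>v. continuous_on D (\<lambda>x. F x v)"
  shows "C1_on D f"
  unfolding C1_on_def
proof (intro exI conjI ballI)
  have bl: "bounded_linear (F x)" if "x \<in> D" for x
    using der[OF that] by (rule has_derivative_bounded_linear)
  show "(f has_derivative blinfun_apply (Blinfun (F x))) (at x within D)" if "x \<in> D" for x
    using der[OF that] bl[OF that] by (simp add: bounded_linear_Blinfun_apply)
  show "continuous_on D (\<lambda>x. Blinfun (F x))"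
  proof (rule continuous_on_blinfun_componentwise)
    fix i :: 'a
    show "continuous_on D (\<lambda>x. blinfun_apply (Blinfun (F x)) i)"
      using cont[of i] by (rule continuous_on_eq) (simp add: bl bounded_linear_Blinfun_apply)
  qed
qed

lemma C1_on_imp_continuous_on:
  assumes "C1_on D f" shows "continuous_on D f"
  using assms unfolding C1_on_def
  by (meson continuous_on_eq_continuous_within has_derivative_continuous)

lemma C1_on_subset:
  assumes "C1_on D f" "E \<subseteq> D" shows "C1_on E f"
  using assms unfolding C1_on_def
  by (meson continuous_on_subset has_derivative_subset subsetD)

lemma C1_on_bilinear:
  fixes f :: "'a::euclidean_space \<Rightarrow> 'b::real_normed_vector"
  assumes B: "bounded_bilinear B" and f: "C1_on D f" and g: "C1_on D g"
  shows "C1_on D (\<lambda>x. B (f x) (g x))"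
proof -
  interpret bounded_bilinear B by (rule B)
  obtain f' where f': "\<And>x. x \<in> D \<Longrightarrow> (f has_derivative blinfun_apply (f' x)) (at x within D)"
    "continuous_on D f'" using f unfolding C1_on_def by blast
  obtain g' where g': "\<And>x. x \<in> D \<Longrightarrow> (g has_derivative blinfun_apply (g' x)) (at x within D)"
    "continuous_on D g'" using g unfolding C1_on_def by blast
  show ?thesis
  proof (rule C1_onI)
    show "((\<lambda>x. B (f x) (g x)) has_derivative (\<lambda>v. B (f x) (g' x v) + B (f' x v) (g x))) (at x within D)"
      if "x \<in> D" for x
      using FDERIV[OF f'(1)[OF that] g'(1)[OF that]] .
    show "continuous_on D (\<lambda>x. B (f x) (g' x v) + B (f' x v) (g x))" for v
      using C1_on_imp_continuous_on[OF f] C1_on_imp_continuous_on[OF g] f'(2) g'(2)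
      by (intro continuous_intros continuous_on) auto
  qed
qed

lemma C1_on_compose_real:
  fixes q :: "'a::euclidean_space \<Rightarrow> real"
  assumes q: "C1_on D q" and g: "\<And>x. x \<in> D \<Longrightarrow> (g has_real_derivative g' (q x)) (at (q x))"
    and cont: "continuous_on (q ` D) g'"
  shows "C1_on D (\<lambda>x. g (q x))"
proof -
  obtain f' where f': "\<And>x. x \<in> D \<Longrightarrow> (q has_derivative blinfun_apply (f' x)) (at x within D)"
    "continuous_on D f'" using q unfolding C1_on_def by blast
  show ?thesis
  proof (rule C1_onI)
    show "((\<lambda>x. g (q x)) has_derivative (\<lambda>v. g' (q x) * f' x v)) (at x within D)" if "x \<in> D" for x
      using has_derivative_compose[OF f'(1)[OF that] g[OF that, unfolded has_field_derivative_def]]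
      by simp
    show "continuous_on D (\<lambda>x. g' (q x) * f' x v)" for v
      using f'(2) C1_on_imp_continuous_on[OF q]
      by (intro continuous_intros continuous_on_compose2[OF cont]) auto
  qed
qed

lemma C1_on_normalize:
  fixes k :: "'a::euclidean_space \<Rightarrow> 'b::real_inner"
  assumes k: "C1_on D k" and k0: "\<And>x. x \<in> D \<Longrightarrow> k x \<noteq> 0"
  shows "C1_on D (\<lambda>x. inverse (norm (k x)) *\<^sub>R k x)"
proof -
  have q: "C1_on D (\<lambda>x. k x \<bullet> k x)" by (rule C1_on_bilinear[OF bounded_bilinear_inner k k])
  have "C1_on D (\<lambda>x. inverse (sqrt (k x \<bullet> k x)))"
  proof (rule C1_on_compose_real[OF q])
    show "((\<lambda>y. inverse (sqrt y)) has_real_derivative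
        - (inverse (sqrt (k x \<bullet> k x)) * (inverse (sqrt (k x \<bullet> k x)) / 2) * inverse (sqrt (k x \<bullet> k x)))) (at (k x \<bullet> k x))"
      if "x \<in> D" for x
    proof -
      have "0 < k x \<bullet> k x" using k0[OF that] by simp
      with k0[OF that] show ?thesis
        using DERIV_inverse'[OF DERIV_real_sqrt[of "k x \<bullet> k x"]] by (simp del: inner_gt_zero_iff)
    qed
    show "continuous_on ((\<lambda>x. k x \<bullet> k x) ` D) (\<lambda>y. - (inverse (sqrt y) * (inverse (sqrt y) / 2) * inverse (sqrt y)))"
      using k0 by (intro continuous_intros) auto
  qed
  then have "C1_on D (\<lambda>x. inverse (norm (k x)))" by (simp add: norm_eq_sqrt_inner)
  then show ?thesis by (rule C1_on_bilinear[OF bounded_bilinear_scaleR _ k])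
qed

lemma has_vector_derivative_blinfun:
  assumes "(f has_derivative blinfun_apply L) F"
  shows "(f has_vector_derivative L 1) F"
proof -
  have "L x = x *\<^sub>R L 1" for x
    using blinfun.scaleR_right[of L x 1] by simp
  then have "blinfun_apply L = (\<lambda>x. x *\<^sub>R L 1)" by (rule ext)
  then show ?thesis
    using assms unfolding has_vector_derivative_def by (simp only:)
qed

lemma C1_on_real_iff:
  fixes f :: "real \<Rightarrow> 'b::real_normed_vector"
  shows "C1_on D f \<longleftrightarrow> (\<exists>f'. (\<forall>t\<in>D. (f has_vector_derivative f' t) (at t within D)) \<and> continuous_on D f')"
    (is "?l \<longleftrightarrow> ?r")
proof
  assume ?l
  then obtain f' where f': "\<And>x. x \<in> D \<Longrightarrow> (f has_derivative blinfun_apply (f' x)) (at x within D)"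
    "continuous_on D f'" unfolding C1_on_def by blast
  have "(f has_vector_derivative f' t 1) (at t within D)" if "t \<in> D" for t
    using has_vector_derivative_blinfun[OF f'(1)[OF that]] .
  moreover have "continuous_on D (\<lambda>t. f' t 1)" using f'(2) by (intro continuous_intros) auto
  ultimately show ?r by (intro exI[of _ "\<lambda>t. f' t 1"]) auto
next
  assume ?r
  then obtain f' where "\<forall>t\<in>D. (f has_vector_derivative f' t) (at t within D)" "continuous_on D f'"
    by blast
  then show ?l
    by (intro C1_onI[where F="\<lambda>t v. v *\<^sub>R f' t"] continuous_intros)
      (simp_all add: has_vector_derivative_def)
qed

text \<open>For curves the operator-valued derivatives of \<open>C2_on\<close> carry no more information than ordinary velocity
  vectors.\<close>

lemma C2_on_real_iff:
  fixes f :: "real \<Rightarrow> 'b::real_normed_vector"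
  shows "C2_on D f \<longleftrightarrow> (\<exists>f'. (\<forall>t\<in>D. (f has_vector_derivative f' t) (at t within D)) \<and> C1_on D f')"
    (is "?l \<longleftrightarrow> ?r")
proof
  assume ?l
  then obtain f' where f': "\<And>x. x \<in> D \<Longrightarrow> (f has_derivative blinfun_apply (f' x)) (at x within D)"
    "C1_on D f'" unfolding C2_on_def by blast
  have "(f has_vector_derivative f' t 1) (at t within D)" if "t \<in> D" for t
    using has_vector_derivative_blinfun[OF f'(1)[OF that]] .
  moreover have "C1_on D (\<lambda>t. f' t 1)"
  proof -
    obtain f2 where "\<forall>t\<in>D. (f' has_vector_derivative f2 t) (at t within D)" "continuous_on D f2"
      using f'(2) unfolding C1_on_real_iff by blast
    then show ?thesis unfolding C1_on_real_iff
      by (intro exI[of _ "\<lambda>t. f2 t 1"])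
        (auto intro!: continuous_intros bounded_linear.has_vector_derivative[OF
            bounded_bilinear.bounded_linear_left[OF bounded_bilinear_blinfun_apply]])
  qed
  ultimately show ?r by (intro exI[of _ "\<lambda>t. f' t 1"]) auto
next
  assume ?r
  then obtain f1 f2 where 1: "\<And>t. t \<in> D \<Longrightarrow> (f has_vector_derivative f1 t) (at t within D)"
     and 2: "\<And>t. t \<in> D \<Longrightarrow> (f1 has_vector_derivative f2 t) (at t within D)" "continuous_on D f2"
    unfolding C1_on_real_iff by blast
  show ?l unfolding C2_on_def
  proof (intro exI conjI ballI)
    show "(f has_derivative blinfun_apply (blinfun_scaleR_left (f1 t))) (at t within D)" if "t \<in> D" for t
      using 1[OF that] by (simp add: has_vector_derivative_def)
    show "C1_on D (\<lambda>t. blinfun_scaleR_left (f1 t))"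
      unfolding C1_on_real_iff
      by (intro exI[of _ "\<lambda>t. blinfun_scaleR_left (f2 t)"] conjI ballI
          bounded_linear.has_vector_derivative[OF bounded_linear_blinfun_scaleR_left] 2
          bounded_linear.continuous_on[OF bounded_linear_blinfun_scaleR_left])
  qed
qed

text \<open>Applying the mean value theorem once in the direction \<open>v\<close> and once in the direction \<open>w\<close> turns the
  second difference into \<open>h\<^sup>2\<close> times a second derivative at a nearby point.\<close>

lemma second_difference_limit:
  fixes f :: "'a::real_normed_vector \<Rightarrow> real"
  assumes U: "open U" "x \<in> U"
    and f: "\<And>y. y \<in> U \<Longrightarrow> (f has_derivative blinfun_apply (D y)) (at y)"
    and D: "\<And>y. y \<in> U \<Longrightarrow> (D has_derivative blinfun_apply (D2 y)) (at y)"
    and cont: "continuous_on U D2"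
  shows "((\<lambda>h. (f (x + h *\<^sub>R v + h *\<^sub>R w) - f (x + h *\<^sub>R v) - f (x + h *\<^sub>R w) + f x) / h\<^sup>2)
            \<longlongrightarrow> D2 x w v) (at_right 0)"
proof (rule tendstoI)
  fix e :: real assume e: "e > 0"
  have "continuous_on U (\<lambda>y. D2 y w v)" using cont by (intro continuous_intros)
  then have "((\<lambda>y. D2 y w v) \<longlongrightarrow> D2 x w v) (at x)"
    using U by (simp add: continuous_on_eq_continuous_at continuous_at)
  then obtain d1 where d1: "d1 > 0" "\<And>y. dist y x < d1 \<Longrightarrow> dist (D2 y w v) (D2 x w v) < e"
    using e unfolding tendsto_iff eventually_at by (metis UNIV_I dist_self)
  obtain d2 where d2: "d2 > 0" "ball x d2 \<subseteq> U" using U by (rule openE)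
  \<comment> \<open>small enough for the parallelogram at \<open>x\<close> with sides \<open>d v\<close> and \<open>d w\<close> to stay in \<open>U\<close>\<close>
  define d where "d = min d1 d2 / (norm v + norm w + 1)"
  have "d > 0" using d1 d2 by (auto simp: d_def intro!: divide_pos_pos add_nonneg_pos)
  have near: "dist (x + a *\<^sub>R v + b *\<^sub>R w) x < min d1 d2" if "0 \<le> a" "a < d" "0 \<le> b" "b < d" for a b
  proof -
    have "dist (x + a *\<^sub>R v + b *\<^sub>R w) x \<le> a * norm v + b * norm w"
      using that norm_triangle_ineq[of "a *\<^sub>R v" "b *\<^sub>R w"] by (simp add: dist_norm)
    also have "\<dots> \<le> d * norm v + d * norm w"
      using that by (intro add_mono mult_right_mono) auto
    also have "\<dots> < d * (norm v + norm w + 1)" using \<open>d > 0\<close> by (simp add: algebra_simps)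
    also have "\<dots> = min d1 d2" by (simp add: d_def add_nonneg_eq_0_iff add_nonneg_pos less_imp_neq[symmetric])
    finally show ?thesis .
  qed
  have inU: "x + a *\<^sub>R v + b *\<^sub>R w \<in> U" if "0 \<le> a" "a < d" "0 \<le> b" "b < d" for a b
    using near[OF that] d2 by (auto simp: dist_commute)
  have main: "dist ((f (x + h *\<^sub>R v + h *\<^sub>R w) - f (x + h *\<^sub>R v) - f (x + h *\<^sub>R w) + f x) / h\<^sup>2) (D2 x w v) < e"
    if h: "0 < h" "h < d" for h
  proof -
    let ?g = "\<lambda>s. f (x + s *\<^sub>R v + h *\<^sub>R w) - f (x + s *\<^sub>R v + 0 *\<^sub>R w)"
    have "(?g has_real_derivative D (x + s *\<^sub>R v + h *\<^sub>R w) v - D (x + s *\<^sub>R v + 0 *\<^sub>R w) v) (at s)"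
      if s: "0 \<le> s" "s \<le> h" for s
    proof -
      have 1: "((\<lambda>s. f (x + s *\<^sub>R v + b *\<^sub>R w)) has_derivative (\<lambda>a. D (x + s *\<^sub>R v + b *\<^sub>R w) (a *\<^sub>R v))) (at s)"
        if "0 \<le> b" "b \<le> h" for b
        by (rule has_derivative_compose[where g=f and f="\<lambda>s. x + s *\<^sub>R v + b *\<^sub>R w", OF _ f[OF inU]], (rule derivative_eq_intros refl)+)
          (use s h that in auto)
      show ?thesis unfolding has_field_derivative_def
        by (rule has_derivative_eq_rhs[OF has_derivative_diff[OF 1 1]])
          (use h in \<open>auto simp: blinfun.scaleR_right fun_eq_iff algebra_simps\<close>)
    qed
    then obtain s where s: "0 < s" "s < h"
      "?g h - ?g 0 = h * (D (x + s *\<^sub>R v + h *\<^sub>R w) v - D (x + s *\<^sub>R v + 0 *\<^sub>R w) v)"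
      using MVT2[of 0 h ?g "\<lambda>s. D (x + s *\<^sub>R v + h *\<^sub>R w) v - D (x + s *\<^sub>R v + 0 *\<^sub>R w) v"] h
      by auto
    let ?k = "\<lambda>t. D (x + s *\<^sub>R v + t *\<^sub>R w) v"
    have "(?k has_real_derivative D2 (x + s *\<^sub>R v + t *\<^sub>R w) w v) (at t)" if t: "0 \<le> t" "t \<le> h" for t
    proof -
      have "((\<lambda>t. D (x + s *\<^sub>R v + t *\<^sub>R w)) has_derivative (\<lambda>a. D2 (x + s *\<^sub>R v + t *\<^sub>R w) (a *\<^sub>R w))) (at t)"
        by (rule has_derivative_compose[where g=D and f="\<lambda>t. x + s *\<^sub>R v + t *\<^sub>R w", OF _ D[OF inU]], (rule derivative_eq_intros refl)+)
          (use s h t in auto)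
      from bounded_linear.has_derivative[OF bounded_bilinear.bounded_linear_left[OF bounded_bilinear_blinfun_apply] this]
      show ?thesis unfolding has_field_derivative_def
        by (rule has_derivative_eq_rhs) (simp add: fun_eq_iff blinfun.scaleR_right blinfun.scaleR_left mult.commute)
    qed
    then obtain t where t: "0 < t" "t < h" "?k h - ?k 0 = h * D2 (x + s *\<^sub>R v + t *\<^sub>R w) w v"
      using MVT2[of 0 h ?k "\<lambda>t. D2 (x + s *\<^sub>R v + t *\<^sub>R w) w v"] h by auto
    have "f (x + h *\<^sub>R v + h *\<^sub>R w) - f (x + h *\<^sub>R v) - f (x + h *\<^sub>R w) + f x = ?g h - ?g 0" by simp
    also have "\<dots> = h\<^sup>2 * D2 (x + s *\<^sub>R v + t *\<^sub>R w) w v"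
      using s(3) t(3) by (simp add: power2_eq_square)
    finally have "(f (x + h *\<^sub>R v + h *\<^sub>R w) - f (x + h *\<^sub>R v) - f (x + h *\<^sub>R w) + f x) / h\<^sup>2
        = D2 (x + s *\<^sub>R v + t *\<^sub>R w) w v" using h by simp
    moreover have "dist (D2 (x + s *\<^sub>R v + t *\<^sub>R w) w v) (D2 x w v) < e"
      using near[of s t] s t h by (intro d1(2)) auto
    ultimately show ?thesis by simp
  qed
  show "\<forall>\<^sub>F h in at_right 0. dist ((f (x + h *\<^sub>R v + h *\<^sub>R w) - f (x + h *\<^sub>R v) - f (x + h *\<^sub>R w) + f x) / h\<^sup>2) (D2 x w v) < e"
    unfolding eventually_at using main \<open>d > 0\<close>
    by (intro exI[of _ d]) (auto simp: dist_norm)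
qed

text \<open>The second difference is symmetric in the two directions, so its limit is too.\<close>

lemma second_derivative_symmetric:
  fixes f :: "'a::real_normed_vector \<Rightarrow> 'b::euclidean_space"
  assumes U: "open U" "x \<in> U"
    and f: "\<And>y. y \<in> U \<Longrightarrow> (f has_derivative blinfun_apply (D y)) (at y)"
    and D: "\<And>y. y \<in> U \<Longrightarrow> (D has_derivative blinfun_apply (D2 y)) (at y)"
    and cont: "continuous_on U D2"
  shows "D2 x v w = D2 x w v"
proof (rule euclidean_eqI)
  fix i :: 'b assume "i \<in> Basis"
  have bl: "bounded_linear (\<lambda>L::'a \<Rightarrow>\<^sub>L 'b. blinfun_inner_left i o\<^sub>L L)"
    by (rule bounded_bilinear.bounded_linear_right[OF bounded_bilinear_blinfun_compose])
  let ?D2 = "\<lambda>y. Blinfun (\<lambda>L. blinfun_inner_left i o\<^sub>L L) o\<^sub>L D2 y"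
  have *: "((\<lambda>h. (f (x + h *\<^sub>R v + h *\<^sub>R w) \<bullet> i - f (x + h *\<^sub>R v) \<bullet> i - f (x + h *\<^sub>R w) \<bullet> i + f x \<bullet> i) / h\<^sup>2)
            \<longlongrightarrow> ?D2 x w v) (at_right 0)" for v w
  proof (rule second_difference_limit[OF U])
    show "((\<lambda>y. f y \<bullet> i) has_derivative blinfun_apply (blinfun_inner_left i o\<^sub>L D y)) (at y)" if "y \<in> U" for y
      using has_derivative_inner_left[OF f[OF that], of i] by (rule has_derivative_eq_rhs) (auto simp: inner_commute)
    show "((\<lambda>y. blinfun_inner_left i o\<^sub>L D y) has_derivative blinfun_apply (?D2 y)) (at y)" if "y \<in> U" for y
      using bounded_linear.has_derivative[OF bl D[OF that]]
      by (rule has_derivative_eq_rhs) (auto simp: bounded_linear_Blinfun_apply[OF bl])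
    show "continuous_on U ?D2" using cont by (intro continuous_intros)
  qed
  have "?D2 x w v = ?D2 x v w"
  proof (rule tendsto_unique[OF _ *[of v w]])
    show "((\<lambda>h. (f (x + h *\<^sub>R v + h *\<^sub>R w) \<bullet> i - f (x + h *\<^sub>R v) \<bullet> i - f (x + h *\<^sub>R w) \<bullet> i + f x \<bullet> i) / h\<^sup>2)
            \<longlongrightarrow> ?D2 x v w) (at_right 0)"
      using *[of w v] by (rule Lim_transform_eventually) (auto simp: algebra_simps intro!: always_eventually)
  qed simp
  then show "D2 x v w \<bullet> i = D2 x w v \<bullet> i" by (simp add: bounded_linear_Blinfun_apply[OF bl] inner_commute)
qed

text \<open>Picard iteration: for small \<open>e\<close> the integral operator is a contraction of the bounded continuous
  functions. Only short rollings are needed, so the solution is not continued to the whole interval.\<close>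

lemma linear_ode_local_solution:
  fixes L :: "real \<Rightarrow> 'a::euclidean_space \<Rightarrow>\<^sub>L 'a"
  assumes cont: "continuous_on {0..l} L" and l: "l > 0"
  obtains e x where "0 < e" "e \<le> l" "x 0 = x0"
    "\<And>t. t \<in> {0..e} \<Longrightarrow> (x has_vector_derivative L t (x t)) (at t within {0..e})"
proof -
  have "bounded (L ` {0..l})" by (intro compact_imp_bounded compact_continuous_image cont) auto
  then obtain K where K: "K > 0" "\<And>t. t \<in> {0..l} \<Longrightarrow> norm (L t) \<le> K"
    unfolding bounded_pos by auto
  \<comment> \<open>this length makes the contraction factor \<open>e * K\<close> at most one half\<close>
  define e where "e = min l (1 / (2 * K))"
  have e: "0 < e" "e \<le> l" "e * K \<le> 1/2"
  proof -
    have "e \<le> 1 / (2*K)" by (simp add: e_def)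
    then show "e * K \<le> 1/2" using K(1) by (simp add: field_simps)
  qed (use K l in \<open>auto simp: e_def\<close>)
  \<comment> \<open>clamping the time to \<open>[0,e]\<close> lets the iteration act on functions on the whole real line\<close>
  define c where "c = (\<lambda>t::real. max 0 (min e t))"
  have c: "c t \<in> {0..e}" "t \<in> {0..e} \<Longrightarrow> c t = t" for t using e by (auto simp: c_def)
  have contL: "continuous_on {0..e} (\<lambda>s. L s (apply_bcontfun y s))" for y
    using e by (intro continuous_intros continuous_on_subset[OF cont]) auto
  define F where "F = (\<lambda>y t. x0 + integral {0..c t} (\<lambda>s. L s (apply_bcontfun y s)))"
  have int: "(\<lambda>s. L s (apply_bcontfun y s)) integrable_on {0..c t}" for y t
    using c[of t] by (intro integrable_continuous_interval continuous_on_subset[OF contL]) auto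
  have Fder: "((\<lambda>t. x0 + integral {0..t} (\<lambda>s. L s (apply_bcontfun y s))) has_vector_derivative L t (apply_bcontfun y t)) (at t within {0..e})"
    if "t \<in> {0..e}" for y t
    using has_vector_derivative_add[OF has_vector_derivative_const integral_has_vector_derivative[OF contL that], of x0] by simp
  have Fcont: "continuous_on UNIV (F y)" for y
  proof -
    have "continuous_on {0..e} (\<lambda>t. x0 + integral {0..t} (\<lambda>s. L s (apply_bcontfun y s)))"
      using Fder by (meson continuous_on_eq_continuous_within has_vector_derivative_continuous)
    moreover have "continuous_on UNIV c" unfolding c_def by (intro continuous_intros)
    ultimately show ?thesis unfolding F_def
      by (intro continuous_on_compose2[of "{0..e}" "\<lambda>t. x0 + integral {0..t} (\<lambda>s. L s (apply_bcontfun y s))" UNIV c])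
        (use c in auto)
  qed
  have Fb: "F y \<in> bcontfun" for y
  proof -
    have "bounded (F y ` {0..e})"
      by (intro compact_imp_bounded compact_continuous_image continuous_on_subset[OF Fcont]) auto
    then obtain b where b: "\<And>t. t \<in> {0..e} \<Longrightarrow> norm (F y t) \<le> b" unfolding bounded_iff by blast
    have "F y t = F y (c t)" for t unfolding F_def using c(2)[OF c(1)[of t]] by simp
    then have "norm (F y t) \<le> b" for t using b[OF c(1)[of t]] by simp
    then show ?thesis by (rule bcontfun_normI[OF Fcont])
  qed
  define T where "T = (\<lambda>y. Bcontfun (F y))"
  have T: "apply_bcontfun (T y) = F y" for y by (simp add: T_def Bcontfun_inverse Fb)
  have contr: "dist (T y) (T z) \<le> 1/2 * dist y z" for y z
  proof (rule dist_bound)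
    fix t
    have "F y t - F z t = integral {0..c t} (\<lambda>s. L s (apply_bcontfun y s - apply_bcontfun z s))"
      by (simp add: F_def integral_diff[OF int int] blinfun.diff_right)
    also have "norm \<dots> \<le> (K * dist y z) * (c t - 0)"
    proof (rule integral_bound)
      show "0 \<le> c t" using c[of t] by simp
      show "continuous_on {0..c t} (\<lambda>s. L s (apply_bcontfun y s - apply_bcontfun z s))"
        using e c[of t] by (intro continuous_intros continuous_on_subset[OF cont]) auto
      fix s assume "s \<in> {0..c t}"
      then have "norm (L s) \<le> K" using c[of t] e by (intro K) auto
      then have "norm (L s) * norm (apply_bcontfun y s - apply_bcontfun z s) \<le> K * dist y z"
        using K(1) dist_bounded[of y s z] by (intro mult_mono) (auto simp: dist_norm)
      then show "norm (L s (apply_bcontfun y s - apply_bcontfun z s)) \<le> K * dist y z"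
        using norm_blinfun[of "L s"] order_trans by blast
    qed
    also have "\<dots> \<le> (K * dist y z) * e" using c[of t] K(1) by (intro mult_left_mono) auto
    also have "\<dots> = (e * K) * dist y z" by simp
    also have "\<dots> \<le> 1/2 * dist y z" using e(3) by (intro mult_right_mono) auto
    finally show "dist (apply_bcontfun (T y) t) (apply_bcontfun (T z) t) \<le> 1/2 * dist y z"
      by (simp add: T dist_norm)
  qed
  obtain y where "T y = y"
    using banach_fix_type[of "1/2" T] contr by auto
  then have y: "apply_bcontfun y t = F y t" for t by (metis T)
  show ?thesis
  proof
    show "apply_bcontfun y 0 = x0" using e by (simp add: y) (simp add: F_def c_def)
    show "(apply_bcontfun y has_vector_derivative L t (apply_bcontfun y t)) (at t within {0..e})" if "t \<in> {0..e}" for t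
    proof (rule has_vector_derivative_transform[OF that _ Fder[OF that]])
      show "apply_bcontfun y s = x0 + integral {0..s} (\<lambda>s. L s (apply_bcontfun y s))" if "s \<in> {0..e}" for s
        unfolding y[of s] F_def using c(2)[OF that] by simp
    qed
  qed (use e in auto)
qed

section \<open>Surface patches and tangent planes\<close>

text \<open>The orthogonal complement of two independent vectors of three-space is a line; this follows from
  Lagrange's identity for the double cross product.\<close>

lemma orthogonal_pair_imp_parallel_cross3:
  fixes a b x :: "real^3"
  assumes "x \<bullet> a = 0" "x \<bullet> b = 0" "cross3 a b \<noteq> 0"
  obtains c where "x = c *\<^sub>R cross3 a b"
proof -
  have "cross3 (cross3 a b) x = 0"
    using assms Lagrange[of x a b] cross_skew[of x "cross3 a b"] by simp
  then have "collinear {0, cross3 a b, x}" by (simp add: cross_eq_0)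
  then show ?thesis using assms(3) that unfolding collinear_lemma by force
qed

lemma cross3_axis_image_nonzero:
  fixes L :: "real^2 \<Rightarrow> real^3"
  assumes lin: "linear L" and inj: "\<And>v. L v = 0 \<Longrightarrow> v = 0"
  shows "cross3 (L (axis 1 1)) (L (axis 2 1)) \<noteq> 0"
proof
  assume "cross3 (L (axis 1 1)) (L (axis 2 1)) = 0"
  then have "collinear {0, L (axis 1 1), L (axis 2 1)}" by (simp add: cross_eq_0)
  then consider "L (axis 1 1) = 0" | "L (axis 2 1) = 0" | c where "L (axis 2 1) = c *\<^sub>R L (axis 1 1)"
    unfolding collinear_lemma by blast
  then show False
  proof cases
    case 3
    then have "L (axis 2 1 - c *\<^sub>R axis 1 1) = 0"
      by (simp add: linear_diff[OF lin] linear_scale[OF lin])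
    then have "(axis 2 1 - c *\<^sub>R axis 1 1 :: real^2) $ 2 = 0" using inj by fastforce
    then show False by (simp add: axis_def)
  qed (use inj axis_eq_0_iff[of _ "1::real"] in force)+
qed

text \<open>A convex chart \<open>X\<close> of the surface with its first and second derivatives \<open>D\<close> and \<open>D2\<close>, together with the
  derivative \<open>n'\<close> of the normal in the chart. All local differential geometry below takes place in such a
  chart.\<close>

locale surface_patch =
  fixes S :: "(real^3) set" and N :: "real^3 \<Rightarrow> real^3"
    and B :: "(real^2) set" and X :: "real^2 \<Rightarrow> real^3"
    and D :: "real^2 \<Rightarrow> (real^2) \<Rightarrow>\<^sub>L (real^3)" and D2 :: "real^2 \<Rightarrow> (real^2) \<Rightarrow>\<^sub>L ((real^2) \<Rightarrow>\<^sub>L (real^3))"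
    and n' :: "real^2 \<Rightarrow> (real^2) \<Rightarrow>\<^sub>L (real^3)"
  assumes open_B: "open B" and convex_B: "convex B"
    and open_image: "\<And>W. W \<subseteq> B \<Longrightarrow> open W \<Longrightarrow> openin (top_of_set S) (X ` W)"
    and X: "\<And>u. u \<in> B \<Longrightarrow> (X has_derivative blinfun_apply (D u)) (at u)"
    and D: "\<And>u. u \<in> B \<Longrightarrow> (D has_derivative blinfun_apply (D2 u)) (at u)"
    and D2: "continuous_on B D2"
    and D_inj: "\<And>u v. u \<in> B \<Longrightarrow> D u v = 0 \<Longrightarrow> v = 0"
    and normal_unit: "\<And>u. u \<in> B \<Longrightarrow> norm (N (X u)) = 1"
    and normal_D: "\<And>u v. u \<in> B \<Longrightarrow> N (X u) \<bullet> D u v = 0"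
    and n': "\<And>u. u \<in> B \<Longrightarrow> ((\<lambda>u. N (X u)) has_derivative blinfun_apply (n' u)) (at u)"
    and cont_n': "continuous_on B n'"
begin

lemma X_in: "u \<in> B \<Longrightarrow> X u \<in> S"
  using open_image[OF order_refl open_B] openin_subset by fastforce

end

lemma restriction_to_line:
  fixes X :: "'a::real_normed_vector \<Rightarrow> 'b::real_normed_vector"
  assumes X: "\<And>y. y \<in> B \<Longrightarrow> (X has_derivative blinfun_apply (D y)) (at y)"
    and D: "\<And>y. y \<in> B \<Longrightarrow> (D has_derivative blinfun_apply (D2 y)) (at y)"
    and cont: "continuous_on B D2"
    and T: "\<And>t. t \<in> T \<Longrightarrow> u + t *\<^sub>R v \<in> B"
  shows "t \<in> T \<Longrightarrow> ((\<lambda>t. X (u + t *\<^sub>R v)) has_vector_derivative D (u + t *\<^sub>R v) v) (at t)"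
    and "t \<in> T \<Longrightarrow> ((\<lambda>t. D (u + t *\<^sub>R v) v) has_vector_derivative D2 (u + t *\<^sub>R v) v v) (at t)"
    and "continuous_on T (\<lambda>t. D2 (u + t *\<^sub>R v) v v)"
    and "C2_on T (\<lambda>t. X (u + t *\<^sub>R v))"
proof -
  show 1: "((\<lambda>t. X (u + t *\<^sub>R v)) has_vector_derivative D (u + t *\<^sub>R v) v) (at t)" if "t \<in> T" for t
  proof -
    have "((\<lambda>t. X (u + t *\<^sub>R v)) has_derivative (\<lambda>a. D (u + t *\<^sub>R v) (a *\<^sub>R v))) (at t)"
      by (rule has_derivative_compose[where g=X and f="\<lambda>t. u + t *\<^sub>R v", OF _ X[OF T[OF that]]],
          (rule derivative_eq_intros refl)+) simp
    then show ?thesis unfolding has_vector_derivative_def by (simp add: blinfun.scaleR_right)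
  qed
  show 2: "((\<lambda>t. D (u + t *\<^sub>R v) v) has_vector_derivative D2 (u + t *\<^sub>R v) v v) (at t)" if "t \<in> T" for t
  proof -
    have "((\<lambda>t. D (u + t *\<^sub>R v)) has_derivative (\<lambda>a. D2 (u + t *\<^sub>R v) (a *\<^sub>R v))) (at t)"
      by (rule has_derivative_compose[where g=D and f="\<lambda>t. u + t *\<^sub>R v", OF _ D[OF T[OF that]]],
          (rule derivative_eq_intros refl)+) simp
    from bounded_linear.has_derivative[OF bounded_bilinear.bounded_linear_left[OF bounded_bilinear_blinfun_apply] this]
    show ?thesis unfolding has_vector_derivative_def
      by (simp add: blinfun.scaleR_right blinfun.scaleR_left)
  qed
  show 3: "continuous_on T (\<lambda>t. D2 (u + t *\<^sub>R v) v v)"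
  proof -
    have "continuous_on T (\<lambda>t. D2 (u + t *\<^sub>R v))"
      by (rule continuous_on_compose2[OF cont, of T "\<lambda>t. u + t *\<^sub>R v"])
        (use T in \<open>auto intro!: continuous_intros\<close>)
    then show ?thesis by (intro continuous_intros)
  qed
  show "C2_on T (\<lambda>t. X (u + t *\<^sub>R v))"
    unfolding C2_on_real_iff C1_on_real_iff
    using 1[THEN has_vector_derivative_at_within] 2[THEN has_vector_derivative_at_within] 3
    by (intro exI[of _ "\<lambda>t. D (u + t *\<^sub>R v) v"] exI[of _ "\<lambda>t. D2 (u + t *\<^sub>R v) v v"] conjI ballI)
qed

lemma line_in_open:
  fixes u v :: "'a::real_normed_vector"
  assumes "open B" "u \<in> B"
  obtains d :: real where "d > 0" "\<And>t. t \<in> {-d<..<d} \<Longrightarrow> u + t *\<^sub>R v \<in> B"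
proof -
  have "open ((\<lambda>t. u + t *\<^sub>R v) -` B)"
    by (rule open_vimage[OF \<open>open B\<close>]) (intro continuous_intros)
  then obtain d where "d > 0" "ball 0 d \<subseteq> (\<lambda>t. u + t *\<^sub>R v) -` B"
    using assms(2) by (metis (mono_tags, lifting) add.right_neutral openE scaleR_zero_left vimageI)
  then show ?thesis by (intro that[of d]) (auto simp: subset_eq dist_norm)
qed

lemma derivative_in_tangent_plane:
  fixes X :: "real^2 \<Rightarrow> real^3"
  assumes "open B" "X ` B \<subseteq> S"
    and X: "\<And>y. y \<in> B \<Longrightarrow> (X has_derivative blinfun_apply (D y)) (at y)"
    and D: "\<And>y. y \<in> B \<Longrightarrow> (D has_derivative blinfun_apply (D2 y)) (at y)"
    and cont: "continuous_on B D2" and u: "u \<in> B"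
  shows "D u v \<in> tangent_plane S (X u)"
proof -
  obtain d where d: "d > 0" "\<And>t. t \<in> {-d<..<d} \<Longrightarrow> u + t *\<^sub>R v \<in> B"
    using line_in_open[OF assms(1) u, where v=v] by blast
  note l = restriction_to_line[where T="{-d<..<d}", OF X D cont d(2)]
  show ?thesis unfolding tangent_plane_def
  proof (intro CollectI exI[of _ d] exI[of _ "\<lambda>t. X (u + t *\<^sub>R v)"] conjI)
    show "C2_on {-d<..<d} (\<lambda>t. X (u + t *\<^sub>R v))" by (rule l(4))
    show "((\<lambda>t. X (u + t *\<^sub>R v)) has_vector_derivative D u v) (at 0)" using l(1)[of 0] d(1) by simp
    show "(\<lambda>t. X (u + t *\<^sub>R v)) ` {-d<..<d} \<subseteq> S" using d(2) assms(2) by blast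
  qed (use d in auto)
qed

text \<open>The point to be shown is that \<open>N\<close>, which is only assumed to be continuous, is continuously differentiable
  in a chart: it is the normalised cross product of the coordinate fields up to a sign, and the sign is
  constant on a ball because it is a continuous function with two values.\<close>

lemma surface_patch_exists:
  assumes S: "C2_surface S" and N: "unit_normal_field S N" and p: "p \<in> S"
  obtains B X D D2 n' u where "surface_patch S N B X D D2 n'" "u \<in> B" "X u = p"
proof -
  obtain U V X \<psi> where U: "open (U :: (real^2) set)" "open V" "p \<in> V"
    and hom: "homeomorphism U (S \<inter> V) X \<psi>" and "C2_on U X"
    and inj: "\<And>u. u \<in> U \<Longrightarrow> inj (frechet_derivative X (at u))"
    using bspec[OF S[unfolded C2_surface_def] p] by (elim exE conjE) simp
  from \<open>C2_on U X\<close> obtain D where XU: "\<And>x. x \<in> U \<Longrightarrow> (X has_derivative blinfun_apply (D x)) (at x within U)"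
    and C1D: "C1_on U D" unfolding C2_on_def by blast
  then obtain D2 where DU: "\<And>x. x \<in> U \<Longrightarrow> (D has_derivative blinfun_apply (D2 x)) (at x within U)"
    and D2: "continuous_on U D2" unfolding C1_on_def by blast
  define u0 where "u0 = \<psi> p"
  have u0: "u0 \<in> U" "X u0 = p"
    using hom p U unfolding u0_def homeomorphism_def by auto
  obtain e where e: "e > 0" "ball u0 e \<subseteq> U" using U(1) u0(1) by (rule openE)
  define B where "B = ball u0 e"
  have B: "open B" "convex B" "u0 \<in> B" "B \<subseteq> U" using e by (auto simp: B_def)
  have X: "(X has_derivative blinfun_apply (D u)) (at u)" if "u \<in> B" for u
    using XU[of u] B that U(1) by (metis at_within_open subsetD)
  have D: "(D has_derivative blinfun_apply (D2 u)) (at u)" if "u \<in> B" for u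
    using DU[of u] B that U(1) by (metis at_within_open subsetD)
  have D2: "continuous_on B D2" using D2 B(4) by (rule continuous_on_subset)
  have XS: "X ` B \<subseteq> S"
    using homeomorphism_image1[OF hom] image_mono[OF B(4), of X] by simp
  have D_inj: "v = 0" if "u \<in> B" "D u v = 0" for u v
  proof -
    have "inj (blinfun_apply (D u))"
      using inj[of u] B that frechet_derivative_at[OF X[OF that(1)]] by auto
    then show ?thesis using that(2) by (metis blinfun.zero_right injD)
  qed
  have openi: "openin (top_of_set S) (X ` W)" if W: "W \<subseteq> B" "open W" for W
  proof -
    have "openin (top_of_set U) W" using W B by (meson open_subset order_trans)
    then have "openin (top_of_set (S \<inter> V)) (X ` W)"
      by (rule homeomorphism_imp_open_map[OF hom])
    moreover have "openin (top_of_set S) (S \<inter> V)" using U(2) by (rule openin_open_Int)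
    ultimately show ?thesis by (rule openin_trans)
  qed
  have unit: "norm (N (X u)) = 1" if "u \<in> B" for u
    using N XS that unfolding unit_normal_field_def by blast
  have ND: "N (X u) \<bullet> D u v = 0" if "u \<in> B" for u v
    using N XS that derivative_in_tangent_plane[OF B(1) XS X D D2 that, of v]
    unfolding unit_normal_field_def by blast
  \<comment> \<open>the normalised cross product of the coordinate fields is \<open>N\<close> up to a locally constant sign\<close>
  define k where "k = (\<lambda>u. cross3 (D u (axis 1 1)) (D u (axis 2 1)))"
  have k0: "k u \<noteq> 0" if "u \<in> B" for u
    unfolding k_def using D_inj[OF that]
    by (intro cross3_axis_image_nonzero) (auto intro: bounded_linear.linear blinfun.bounded_linear_right)
  have bcross: "bounded_bilinear (cross3)"
    using bilinear_cross by (simp add: bilinear_conv_bounded_bilinear)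
  have C1c: "C1_on B (\<lambda>u. D u c)" for c
  proof (rule C1_on_bilinear[OF bounded_bilinear_blinfun_apply C1_on_subset[OF C1D B(4)]])
    show "C1_on B (\<lambda>u. c)" by (rule C1_onI[where F="\<lambda>_ _. 0"]) auto
  qed
  have C1k: "C1_on B k" unfolding k_def by (rule C1_on_bilinear[OF bcross C1c C1c])
  define m where "m = (\<lambda>u. inverse (norm (k u)) *\<^sub>R k u)"
  note m = m_def[THEN fun_cong]
  have C1m: "C1_on B m" unfolding m_def by (rule C1_on_normalize[OF C1k k0])
  have m1: "norm (m u) = 1" if "u \<in> B" for u
    using k0[OF that] by (simp add: m)
  have Nm: "N (X u) = (N (X u) \<bullet> m u) *\<^sub>R m u" "N (X u) \<bullet> m u \<in> {-1, 1}" if u: "u \<in> B" for u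
  proof -
    obtain c where c: "N (X u) = c *\<^sub>R k u"
      using orthogonal_pair_imp_parallel_cross3[OF ND[OF u] ND[OF u] k0[OF u, unfolded k_def]]
      unfolding k_def by blast
    have k: "k u = norm (k u) *\<^sub>R m u" using k0[OF u] by (simp add: m)
    have c': "N (X u) = (c * norm (k u)) *\<^sub>R m u" by (subst c, subst k) simp
    have mm: "m u \<bullet> m u = 1" using m1[OF u] by (simp add: norm_eq_1)
    have dot: "N (X u) \<bullet> m u = c * norm (k u)" by (subst c') (simp add: mm)
    then show "N (X u) = (N (X u) \<bullet> m u) *\<^sub>R m u" using c' by simp
    have "\<bar>c * norm (k u)\<bar> = 1" using unit[OF u] unfolding c' by (simp add: m1[OF u] abs_mult)
    then have "c * norm (k u) = -1 \<or> c * norm (k u) = 1" by linarith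
    then show "N (X u) \<bullet> m u \<in> {-1, 1}" unfolding dot by blast
  qed
  have "(\<lambda>u. N (X u) \<bullet> m u) constant_on B"
  proof (rule continuous_finite_range_constant)
    show "connected B" using B(2) by (rule convex_connected)
    have "continuous_on S N" using N unfolding unit_normal_field_def by blast
    moreover have "continuous_on B X" using X by (meson continuous_at_imp_continuous_on has_derivative_continuous)
    ultimately show "continuous_on B (\<lambda>u. N (X u) \<bullet> m u)"
      using XS C1_on_imp_continuous_on[OF C1m] by (intro continuous_intros continuous_on_compose2[of S N B X]) auto
    show "finite ((\<lambda>u. N (X u) \<bullet> m u) ` B)"
      by (rule finite_subset[of _ "{-1,1}"]) (use Nm(2) in auto)
  qed
  then obtain \<sigma> where "\<And>u. u \<in> B \<Longrightarrow> N (X u) \<bullet> m u = \<sigma>" unfolding constant_on_def by blast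
  then have N\<sigma>: "\<And>u. u \<in> B \<Longrightarrow> N (X u) = \<sigma> *\<^sub>R m u" using Nm(1) by metis
  obtain m' where m': "\<And>u. u \<in> B \<Longrightarrow> (m has_derivative blinfun_apply (m' u)) (at u within B)" "continuous_on B m'"
    using C1m unfolding C1_on_def by blast
  show ?thesis
  proof
    show "surface_patch S N B X D D2 (\<lambda>u. \<sigma> *\<^sub>R m' u)"
    proof
      show "((\<lambda>u. N (X u)) has_derivative blinfun_apply (\<sigma> *\<^sub>R m' u)) (at u)" if "u \<in> B" for u
      proof (rule has_derivative_transform_within_open[OF _ B(1) that])
        have "(m has_derivative blinfun_apply (m' u)) (at u)"
          using m'(1)[OF that] B(1) that by (metis at_within_open)
        then show "((\<lambda>u. \<sigma> *\<^sub>R m u) has_derivative blinfun_apply (\<sigma> *\<^sub>R m' u)) (at u)"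
          by (rule has_derivative_eq_rhs[OF has_derivative_scaleR_right]) (simp add: fun_eq_iff blinfun.scaleR_left)
        show "\<sigma> *\<^sub>R m u = N (X u)" if "u \<in> B" for u using N\<sigma>[OF that] by simp
      qed
      show "continuous_on B (\<lambda>u. \<sigma> *\<^sub>R m' u)" using m'(2) by (intro continuous_intros)
    qed (use B X D D2 D_inj openi unit ND in auto)
  qed (use u0 B in auto)
qed

context surface_patch begin

text \<open>Both sides are planes and one inclusion is the orthogonality of \<open>N\<close> to the coordinate fields.\<close>

lemma range_D:
  assumes u: "u \<in> B"
  shows "range (D u) = {v. N (X u) \<bullet> v = 0}"
proof (rule subspace_dim_equal)
  have lin: "linear (D u)" by (rule bounded_linear.linear[OF blinfun.bounded_linear_right])
  show "subspace (range (D u))" by (rule linear_subspace_image[OF lin subspace_UNIV])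
  show "subspace {v. N (X u) \<bullet> v = 0}" by (rule subspace_hyperplane)
  show "range (D u) \<subseteq> {v. N (X u) \<bullet> v = 0}" using normal_D[OF u] by auto
  have "N (X u) \<noteq> 0" using normal_unit[OF u] by auto
  then have "dim {v. N (X u) \<bullet> v = 0} = 2" by (simp add: dim_hyperplane)
  moreover have "inj (D u)" using D_inj[OF u] lin linear_injective_0 by blast
  then have "dim (range (D u)) = 2" using dim_image_eq[OF lin, of UNIV] by simp
  ultimately show "dim {v. N (X u) \<bullet> v = 0} \<le> dim (range (D u))" by simp
qed

lemma D_in_tangent_plane: "u \<in> B \<Longrightarrow> D u v \<in> tangent_plane S (X u)"
  using X_in by (intro derivative_in_tangent_plane[OF open_B _ X D D2]) auto

text \<open>The second fundamental form is symmetric: differentiating \<open>N \<bullet> D w = 0\<close> expresses it through the second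
  derivative of the chart.\<close>

lemma shape_symmetric:
  assumes u: "u \<in> B"
  shows "n' u v \<bullet> D u w = n' u w \<bullet> D u v"
proof -
  have *: "n' u v \<bullet> D u w + N (X u) \<bullet> D2 u v w = 0" for v w
  proof -
    have "((\<lambda>u. D u w) has_derivative (\<lambda>v. D2 u v w)) (at u)"
      by (rule bounded_linear.has_derivative[OF bounded_bilinear.bounded_linear_left[OF bounded_bilinear_blinfun_apply] D[OF u]])
    from has_derivative_inner[OF n'[OF u] this]
    have "((\<lambda>u. N (X u) \<bullet> D u w) has_derivative (\<lambda>v. N (X u) \<bullet> D2 u v w + n' u v \<bullet> D u w)) (at u)" .
    moreover have "((\<lambda>u. N (X u) \<bullet> D u w) has_derivative (\<lambda>v. 0)) (at u)"
      by (rule has_derivative_transform_within_open[OF has_derivative_const open_B u]) (simp add: normal_D)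
    ultimately have "(\<lambda>v. N (X u) \<bullet> D2 u v w + n' u v \<bullet> D u w) = (\<lambda>v. 0)" by (rule has_derivative_unique)
    from fun_cong[OF this, of v] show ?thesis by simp
  qed
  have "D2 u v w = D2 u w v" by (rule second_derivative_symmetric[OF open_B u X D D2])
  then show ?thesis using *[of v w] *[of w v] by simp
qed

lemma n'_orthogonal:
  assumes u: "u \<in> B" shows "N (X u) \<bullet> n' u v = 0"
proof -
  have "((\<lambda>u. N (X u) \<bullet> N (X u)) has_derivative (\<lambda>v. N (X u) \<bullet> n' u v + n' u v \<bullet> N (X u))) (at u)"
    by (rule has_derivative_inner[OF n'[OF u] n'[OF u]])
  moreover have "((\<lambda>u. N (X u) \<bullet> N (X u)) has_derivative (\<lambda>v. 0)) (at u)"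
    by (rule has_derivative_transform_within_open[OF has_derivative_const open_B u, of 1])
      (simp add: normal_unit[unfolded norm_eq_1])
  ultimately have "(\<lambda>v. N (X u) \<bullet> n' u v + n' u v \<bullet> N (X u)) = (\<lambda>v. 0)" by (rule has_derivative_unique)
  from fun_cong[OF this, of v] show ?thesis by (simp add: inner_commute)
qed

end

text \<open>A tangent vector is the velocity of some \<open>C\<^sup>2\<close> curve; such velocities are orthogonal to the normal by
  assumption, and charts realise every vector of the orthogonal plane.\<close>

lemma tangent_plane_eq_normal_hyperplane:
  assumes S: "C2_surface S" and N: "unit_normal_field S N" and p: "p \<in> S"
  shows "tangent_plane S p = {v. N p \<bullet> v = 0}"
proof -
  obtain B X D D2 n' u where "surface_patch S N B X D D2 n'" and u: "u \<in> B" "X u = p"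
    using surface_patch_exists[OF S N p] .
  then interpret surface_patch S N B X D D2 n' by simp
  show ?thesis
  proof
    show "tangent_plane S p \<subseteq> {v. N p \<bullet> v = 0}" using N p unfolding unit_normal_field_def by auto
    show "{v. N p \<bullet> v = 0} \<subseteq> tangent_plane S p"
    proof
      fix v assume "v \<in> {v. N p \<bullet> v = 0}"
      then obtain w where "v = D u w" using range_D[OF u(1)] u(2) by (metis rangeE)
      then show "v \<in> tangent_plane S p" using D_in_tangent_plane[OF u(1), of w] u(2) by simp
    qed
  qed
qed

section \<open>Unit-speed curves with prescribed direction\<close>

lemma has_vector_derivative_compose_real:
  fixes h :: "real \<Rightarrow> real"
  assumes "(h has_vector_derivative h') (at t)" "(f has_vector_derivative f') (at (h t))"
  shows "((\<lambda>t. f (h t)) has_vector_derivative h' *\<^sub>R f') (at t)"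
  using vector_diff_chain_at[OF assms] by (simp add: o_def)

text \<open>The new parameter is the inverse of the arc length. Working on an open interval around the starting time
  makes that inverse differentiable at the starting time as well; the velocity of the new curve is the unit
  tangent, a continuously differentiable function of the old parameter.\<close>

lemma arc_length_reparametrization:
  fixes \<alpha> \<alpha>1 \<alpha>2 :: "real \<Rightarrow> 'a::euclidean_space"
  assumes d: "d > 0"
    and 1: "\<And>t. t \<in> {-d<..<d} \<Longrightarrow> (\<alpha> has_vector_derivative \<alpha>1 t) (at t)"
    and 2: "\<And>t. t \<in> {-d<..<d} \<Longrightarrow> (\<alpha>1 has_vector_derivative \<alpha>2 t) (at t)"
    and cont: "continuous_on {-d<..<d} \<alpha>2"
    and nz: "\<And>t. t \<in> {-d<..<d} \<Longrightarrow> \<alpha>1 t \<noteq> 0"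
  obtains l h where "l > 0" "h 0 = 0" "h ` {0..l} \<subseteq> {-d<..<d}"
    "\<And>t. t \<in> {0..l} \<Longrightarrow> (h has_vector_derivative inverse (norm (\<alpha>1 (h t)))) (at t)"
    "C2_on {0..l} (\<lambda>t. \<alpha> (h t))"
proof -
  let ?I = "{-d<..<d}" and ?e = "d / 2"
  let ?J = "{-?e<..<?e}"
  define G where "G = (\<lambda>t. norm (\<alpha>1 t))"
  have Gpos: "G t > 0" if "t \<in> ?I" for t using nz[OF that] by (simp add: G_def)
  have contG: "continuous_on ?I G"
    unfolding G_def using 2
    by (intro continuous_intros) (meson continuous_at_imp_continuous_on has_vector_derivative_continuous)
  have IJ: "{-?e..?e} \<subseteq> ?I" using d by auto
  define s where "s = (\<lambda>t. integral {-?e..t} G - integral {-?e..0} G)"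
  have s': "(s has_real_derivative G t) (at t)" if "t \<in> ?J" for t
  proof -
    have "((\<lambda>x. integral {-?e..x} G) has_real_derivative G t) (at t within {-?e..?e})"
      using that by (intro integral_has_real_derivative continuous_on_subset[OF contG IJ]) auto
    then have "((\<lambda>x. integral {-?e..x} G) has_real_derivative G t) (at t)"
      using that by (simp add: at_within_Icc_at)
    then show ?thesis unfolding s_def by (auto intro!: derivative_eq_intros)
  qed
  have mono: "s x < s y" if "x < y" "x \<in> ?J" "y \<in> ?J" for x y
  proof (rule DERIV_pos_imp_increasing[OF that(1)])
    fix z assume "x \<le> z" "z \<le> y"
    then have "z \<in> ?J" using that by auto
    then show "\<exists>y. (s has_real_derivative y) (at z) \<and> 0 < y" using s' Gpos[of z] IJ by fastforce
  qed
  have inj: "inj_on s ?J"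
    by (rule inj_onI) (metis less_irrefl linorder_neqE_linordered_idom mono)
  define h where "h = the_inv_into ?J s"
  have hs: "h (s x) = x" if "x \<in> ?J" for x unfolding h_def by (rule the_inv_into_f_f[OF inj that])
  have conts: "continuous_on ?J s"
    using s' by (meson DERIV_isCont continuous_at_imp_continuous_on)
  have h': "(h has_vector_derivative inverse (G x)) (at (s x))" if x: "x \<in> ?J" for x
  proof -
    have "(h has_derivative (\<lambda>y. y * inverse (G x))) (at (s x))"
    proof (rule has_derivative_inverse_strong[OF _ x conts hs])
      show "(s has_derivative (*) (G x)) (at x)" using s'[OF x] by (simp add: has_field_derivative_def)
      show "(*) (G x) \<circ> (\<lambda>y. y * inverse (G x)) = id"
        using Gpos[of x] x IJ by (auto simp: fun_eq_iff field_simps)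
    qed auto
    then show ?thesis by (simp add: has_vector_derivative_def)
  qed
  define l where "l = s (?e / 2)"
  have s0: "s 0 = 0" by (simp add: s_def)
  have l: "l > 0" unfolding l_def using mono[of 0 "?e/2"] d s0 by auto
  have hit: "\<exists>x\<in>?J. s x = t" if "t \<in> {0..l}" for t
  proof -
    have "continuous_on {0..?e/2} s" using d by (intro continuous_on_subset[OF conts]) auto
    then obtain x where "0 \<le> x" "x \<le> ?e/2" "s x = t"
      using IVT'[of s 0 t "?e/2"] \<open>t \<in> {0..l}\<close> d s0 unfolding l_def by force
    then show ?thesis using d by (intro bexI[of _ x]) auto
  qed
  have hJ: "h t \<in> ?J" and ht: "(h has_vector_derivative inverse (G (h t))) (at t)" if "t \<in> {0..l}" for t
    using hit[OF that] hs h' by auto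
  have hI: "h t \<in> ?I" if "t \<in> {0..l}" for t using hJ[OF that] IJ by auto
  have conth: "continuous_on {0..l} h"
    using ht by (meson continuous_at_imp_continuous_on has_vector_derivative_continuous)
  let ?W = "\<lambda>x. inverse (norm (\<alpha>1 x)) *\<^sub>R \<alpha>1 x"
  have "C1_on ?I \<alpha>1"
    unfolding C1_on_real_iff using 2[THEN has_vector_derivative_at_within] cont
    by (intro exI[of _ \<alpha>2] conjI ballI)
  then have "C1_on ?I ?W" using nz by (rule C1_on_normalize)
  then obtain W' where W': "\<And>x. x \<in> ?I \<Longrightarrow> (?W has_vector_derivative W' x) (at x within ?I)" "continuous_on ?I W'"
    unfolding C1_on_real_iff by blast
  have W'at: "(?W has_vector_derivative W' x) (at x)" if "x \<in> ?I" for x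
    using W'(1)[OF that] that at_within_open[of x ?I] by simp
  have "C2_on {0..l} (\<lambda>t. \<alpha> (h t))"
    unfolding C2_on_real_iff C1_on_real_iff
  proof (intro exI conjI ballI)
    fix t assume t: "t \<in> {0..l}"
    show "((\<lambda>t. \<alpha> (h t)) has_vector_derivative ?W (h t)) (at t within {0..l})"
      using has_vector_derivative_compose_real[OF ht[OF t] 1[OF hI[OF t]]]
      by (simp add: G_def has_vector_derivative_at_within)
    show "((\<lambda>t. ?W (h t)) has_vector_derivative inverse (G (h t)) *\<^sub>R W' (h t)) (at t within {0..l})"
      by (rule has_vector_derivative_at_within[OF has_vector_derivative_compose_real[OF ht[OF t] W'at[OF hI[OF t]]]])
  next
    have "continuous_on {0..l} (\<lambda>t. G (h t))" "continuous_on {0..l} (\<lambda>t. W' (h t))"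
      by (rule continuous_on_compose2[OF contG conth] continuous_on_compose2[OF W'(2) conth]; use hI in blast)+
    then show "continuous_on {0..l} (\<lambda>t. inverse (G (h t)) *\<^sub>R W' (h t))"
      using Gpos hI by (intro continuous_intros) (auto simp: less_imp_neq[symmetric])
  qed
  moreover have "h 0 = 0" using hs[of 0] s0 d by simp
  ultimately show ?thesis using that[of l h] l hI ht unfolding G_def by blast
qed

text \<open>Every tangent direction can be tested by a ball rolling along a unit-speed curve, namely the
  image of a straight line of the chart, parametrised by arc length.\<close>

lemma (in surface_patch) unit_speed_curve_exists:
  assumes u: "u \<in> B" and v: "v \<noteq> 0"
  obtains l \<gamma> where "l > 0" "unit_speed_curve S l \<gamma>" "\<gamma> 0 = X u"
    "(\<gamma> has_vector_derivative inverse (norm (D u v)) *\<^sub>R D u v) (at 0)"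
    "((\<lambda>t. N (\<gamma> t)) has_vector_derivative inverse (norm (D u v)) *\<^sub>R n' u v) (at 0)"
proof -
  obtain d where d: "d > 0" "\<And>t. t \<in> {-d<..<d} \<Longrightarrow> u + t *\<^sub>R v \<in> B"
    using line_in_open[OF open_B u, where v=v] by blast
  have line: "((\<lambda>t. X (u + t *\<^sub>R v)) has_vector_derivative D (u + t *\<^sub>R v) v) (at t)"
      "((\<lambda>t. D (u + t *\<^sub>R v) v) has_vector_derivative D2 (u + t *\<^sub>R v) v v) (at t)" if "t \<in> {-d<..<d}" for t
    by (rule restriction_to_line(1,2)[where T="{-d<..<d}", OF X D D2 d(2) that]; assumption)+
  have line3: "continuous_on {-d<..<d} (\<lambda>t. D2 (u + t *\<^sub>R v) v v)"
    by (rule restriction_to_line(3)[OF X D D2 d(2)])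
  have nz: "D (u + t *\<^sub>R v) v \<noteq> 0" if "t \<in> {-d<..<d}" for t
    using D_inj[OF d(2)[OF that]] v by blast
  obtain l h where l: "l > 0" and h0: "h 0 = 0" and h: "h ` {0..l} \<subseteq> {-d<..<d}"
    "\<And>t. t \<in> {0..l} \<Longrightarrow> (h has_vector_derivative inverse (norm (D (u + h t *\<^sub>R v) v))) (at t)"
    and C2: "C2_on {0..l} (\<lambda>t. X (u + h t *\<^sub>R v))"
    using arc_length_reparametrization[OF d(1) line line3 nz] by blast
  let ?\<gamma> = "\<lambda>t. X (u + h t *\<^sub>R v)"
  have hd: "h t \<in> {-d<..<d}" if "t \<in> {0..l}" for t using h(1) that by blast
  have \<gamma>': "(?\<gamma> has_vector_derivative inverse (norm (D (u + h t *\<^sub>R v) v)) *\<^sub>R D (u + h t *\<^sub>R v) v) (at t)"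
    if "t \<in> {0..l}" for t
    by (rule has_vector_derivative_compose_real[OF h(2)[OF that] line(1)[OF hd[OF that]]])
  show ?thesis
  proof
    show "unit_speed_curve S l ?\<gamma>" unfolding unit_speed_curve_def
    proof (intro conjI ballI)
      show "?\<gamma> ` {0..l} \<subseteq> S" using X_in d(2) hd by blast
      fix t assume t: "t \<in> {0..l}"
      show "norm (vector_derivative ?\<gamma> (at t within {0..l})) = 1"
        unfolding vector_derivative_within_closed_interval[OF l t has_vector_derivative_at_within[OF \<gamma>'[OF t]]]
        using nz[OF hd[OF t]] by simp
    qed (rule C2)
    have 0: "0 \<in> {0..l}" using l by simp
    show "(?\<gamma> has_vector_derivative inverse (norm (D u v)) *\<^sub>R D u v) (at 0)"
      using \<gamma>'[OF 0] by (simp add: h0)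
    have "((\<lambda>x. N (X (u + x *\<^sub>R v))) has_derivative (\<lambda>a. n' u (a *\<^sub>R v))) (at 0)"
      by (rule has_derivative_compose[where g="\<lambda>u. N (X u)" and f="\<lambda>x. u + x *\<^sub>R v"], (rule derivative_eq_intros refl)+)
        (use n'[OF u] in auto)
    then have "((\<lambda>x. N (X (u + x *\<^sub>R v))) has_vector_derivative n' u v) (at (h 0))"
      by (simp add: has_vector_derivative_def blinfun.scaleR_right h0)
    from has_vector_derivative_compose_real[OF h(2)[OF 0] this]
    show "((\<lambda>t. N (?\<gamma> t)) has_vector_derivative inverse (norm (D u v)) *\<^sub>R n' u v) (at 0)"
      by (simp add: h0)
  qed (use l h0 in auto)
qed

section \<open>The centre of a rolling ball\<close>

lemma tangent_plane_derivative_zero: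
  assumes v: "v \<in> tangent_plane S p" and F: "(F has_derivative F') (at p)"
    and const: "\<And>x. x \<in> S \<Longrightarrow> F x = (c::real)"
  shows "F' v = 0"
proof -
  obtain e \<alpha> where e: "e > 0" and \<alpha>: "\<alpha> ` {-e<..<e} \<subseteq> S" "\<alpha> 0 = p" "(\<alpha> has_vector_derivative v) (at 0)"
    using v unfolding tangent_plane_def by blast
  have "((\<lambda>t. F (\<alpha> t)) has_derivative (\<lambda>t. F' (t *\<^sub>R v))) (at 0)"
    using has_derivative_compose[OF \<alpha>(3)[unfolded has_vector_derivative_def], of F F'] F \<alpha>(2) by simp
  moreover have "((\<lambda>t. F (\<alpha> t)) has_derivative (\<lambda>t. 0)) (at 0)"
    by (rule has_derivative_transform_within_open[OF has_derivative_const, of "{-e<..<e}" _ c])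
      (use e \<alpha>(1) const in \<open>auto simp: image_subset_iff\<close>)
  ultimately have "(\<lambda>t. F' (t *\<^sub>R v)) = (\<lambda>t. 0)" by (rule has_derivative_unique)
  from fun_cong[OF this, of 1] show ?thesis by simp
qed

text \<open>Great circles realise every direction orthogonal to the radius.\<close>

lemma tangent_plane_sphere:
  fixes c q :: "real^3"
  assumes q: "norm (q - c) = R" and R: "R > 0"
  shows "tangent_plane (sphere c R) q = {v. (q - c) \<bullet> v = 0}"
proof (intro set_eqI iffI)
  fix v assume v: "v \<in> tangent_plane (sphere c R) q"
  have "((\<lambda>x. (x - c) \<bullet> (x - c)) has_derivative (\<lambda>h. (q - c) \<bullet> h + h \<bullet> (q - c))) (at q)"
    by (auto intro!: derivative_eq_intros)
  moreover have "(x - c) \<bullet> (x - c) = R\<^sup>2" if "x \<in> sphere c R" for x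
    using that by (simp add: dist_norm norm_minus_commute[of c] flip: power2_norm_eq_inner)
  ultimately have "(q - c) \<bullet> v + v \<bullet> (q - c) = 0" by (rule tangent_plane_derivative_zero[OF v])
  then show "v \<in> {v. (q - c) \<bullet> v = 0}" by (simp add: inner_commute)
next
  fix v assume "v \<in> {v. (q - c) \<bullet> v = 0}"
  then have v: "(q - c) \<bullet> v = 0" by simp
  \<comment> \<open>the great circle through \<open>q\<close> with velocity \<open>v\<close>\<close>
  define k where "k = norm v / R"
  define w where "w = inverse k *\<^sub>R v"
  define \<alpha> where "\<alpha> = (\<lambda>t. c + cos (k * t) *\<^sub>R (q - c) + sin (k * t) *\<^sub>R w)"
  have kw: "k *\<^sub>R w = v" using R by (simp add: w_def k_def)
  have sphere: "\<alpha> t \<in> sphere c R" for t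
  proof (cases "k = 0")
    case True
    then show ?thesis using q R by (simp add: \<alpha>_def dist_norm norm_minus_commute)
  next
    case False
    have nw: "w \<bullet> w = R\<^sup>2" using False R
      by (simp add: w_def k_def dot_square_norm power_mult_distrib field_simps)
    define a where "a = q - c"
    have a: "a \<bullet> a = R\<^sup>2" "a \<bullet> w = 0" "w \<bullet> a = 0"
      using q v by (auto simp: a_def w_def inner_commute simp flip: power2_norm_eq_inner)
    have "(norm (\<alpha> t - c))\<^sup>2 = (cos (k * t))\<^sup>2 * R\<^sup>2 + (sin (k * t))\<^sup>2 * R\<^sup>2"
      unfolding \<alpha>_def a_def[symmetric] power2_norm_eq_inner
      by (simp add: inner_add_left inner_add_right a nw power2_eq_square)
    also have "\<dots> = R\<^sup>2" by (metis distrib_right mult_1 sin_cos_squared_add2)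
    finally show ?thesis using R by (simp add: dist_norm norm_minus_commute)
  qed
  have 1: "(\<alpha> has_vector_derivative (- sin (k * t) * k) *\<^sub>R (q - c) + (cos (k * t) * k) *\<^sub>R w) (at t within A)" for t A
    unfolding \<alpha>_def by (auto intro!: derivative_eq_intros simp: algebra_simps)
  have 2: "((\<lambda>t. (- sin (k * t) * k) *\<^sub>R (q - c) + (cos (k * t) * k) *\<^sub>R w) has_vector_derivative
      (- cos (k * t) * k * k) *\<^sub>R (q - c) + (- sin (k * t) * k * k) *\<^sub>R w) (at t within A)" for t A
    by (auto intro!: derivative_eq_intros simp: algebra_simps)
  have "C2_on {-1<..<1} \<alpha>"
    unfolding C2_on_real_iff C1_on_real_iff
    by (intro exI conjI ballI, rule 1, rule 2) (intro continuous_intros)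
  then show "v \<in> tangent_plane (sphere c R) q"
    unfolding tangent_plane_def using sphere 1[of 0 UNIV] kw
    by (intro CollectI exI[of _ "1::real"] exI[of _ \<alpha>]) (auto simp: \<alpha>_def)
qed

lemma image_sphere_affine_family:
  assumes A: "rotation_matrix (A t)"
  shows "affine_family A b t ` sphere c R = sphere (affine_family A b t c) R"
proof -
  have o: "orthogonal_matrix (A t)" using A by (simp add: rotation_matrix_def)
  have ot: "orthogonal_transformation ((*v) (A t))"
    using o by (simp add: orthogonal_transformation_matrix)
  then have n: "norm (A t *v x) = norm x" for x by (simp add: orthogonal_transformation)
  have d: "dist (affine_family A b t x) (affine_family A b t y) = dist x y" for x y
    by (simp add: affine_family_def dist_norm n flip: matrix_vector_mult_diff_distrib)
  have surj: "\<exists>x. affine_family A b t x = y" for y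
    using orthogonal_transformation_surj[OF ot] unfolding affine_family_def surj_def
    by (metis diff_add_cancel)
  show ?thesis
  proof (intro set_eqI iffI)
    fix y assume "y \<in> sphere (affine_family A b t c) R"
    moreover obtain x where "affine_family A b t x = y" using surj by blast
    ultimately show "y \<in> affine_family A b t ` sphere c R" using d by (intro image_eqI[of _ _ x]) auto
  qed (use d in auto)
qed

lemma parallel_of_equal_hyperplanes:
  fixes w N :: "'a::real_inner"
  assumes "norm N = 1" "\<And>v. N \<bullet> v = 0 \<Longrightarrow> w \<bullet> v = 0"
  shows "w = (w \<bullet> N) *\<^sub>R N"
proof -
  \<comment> \<open>the component of \<open>w\<close> orthogonal to \<open>N\<close> is orthogonal to itself\<close>
  let ?v = "w - (w \<bullet> N) *\<^sub>R N"
  have "N \<bullet> ?v = 0" using assms(1) by (simp add: inner_diff_right norm_eq_1 inner_commute)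
  then have "?v \<bullet> ?v = 0" using assms(2)[of ?v] by (simp add: inner_diff_left)
  then show ?thesis by simp
qed

text \<open>Tangency puts the centre at \<open>\<gamma> t \<plusminus> r N\<close>; the signed distance along the normal is continuous in time and
  takes two values only, so it keeps its initial value.\<close>

lemma rolling_center:
  assumes S: "C2_surface S" and N: "unit_normal_field S N" and r: "r \<noteq> 0" and e: "e > 0"
    and roll: "rolling S N r e \<gamma> A b" and \<gamma>: "continuous_on {0..e} \<gamma>" "\<gamma> ` {0..e} \<subseteq> S" and t: "t \<in> {0..e}"
  shows "affine_family A b t (ball_center N r (\<gamma> 0)) = \<gamma> t + r *\<^sub>R N (\<gamma> t)"
proof -
  let ?p = "ball_center N r (\<gamma> 0)"
  let ?c = "\<lambda>t. affine_family A b t ?p"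
  have motion: "motion_on (sphere ?p \<bar>r\<bar>) S e \<gamma> A b" using roll by (simp add: rolling_def)
  have NS: "norm (N (\<gamma> t)) = 1" if "t \<in> {0..e}" for t using N \<gamma>(2) that unfolding unit_normal_field_def by blast
  define k where "k = (\<lambda>t. (\<gamma> t - ?c t) \<bullet> N (\<gamma> t))"
  have par: "\<gamma> t - ?c t = k t *\<^sub>R N (\<gamma> t)" and k: "k t \<in> {-r, r}" if t: "t \<in> {0..e}" for t
  proof -
    have rot: "rotation_matrix (A t)" and tan: "tangent_at (affine_family A b t ` sphere ?p \<bar>r\<bar>) S (\<gamma> t)"
      using motion t unfolding motion_on_def by auto
    have tan: "norm (\<gamma> t - ?c t) = \<bar>r\<bar>" "tangent_plane (sphere (?c t) \<bar>r\<bar>) (\<gamma> t) = tangent_plane S (\<gamma> t)"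
      using tan unfolding image_sphere_affine_family[where A=A and t=t, OF rot] tangent_at_def
      by (auto simp: dist_norm norm_minus_commute)
    have "\<gamma> t \<in> S" using \<gamma>(2) t by blast
    then have "{v. (\<gamma> t - ?c t) \<bullet> v = 0} = {v. N (\<gamma> t) \<bullet> v = 0}"
      using tan(2) tangent_plane_eq_normal_hyperplane[OF S N] tangent_plane_sphere[OF tan(1)] r by simp
    then have "\<And>v. N (\<gamma> t) \<bullet> v = 0 \<Longrightarrow> (\<gamma> t - ?c t) \<bullet> v = 0" by blast
    then show par: "\<gamma> t - ?c t = k t *\<^sub>R N (\<gamma> t)"
      unfolding k_def by (rule parallel_of_equal_hyperplanes[OF NS[OF t]])
    have "\<bar>k t\<bar> = \<bar>r\<bar>" using tan(1) unfolding par by (simp add: NS[OF t])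
    then show "k t \<in> {-r, r}" by (auto simp: abs_eq_iff)
  qed
  have "k constant_on {0..e}"
  proof (rule continuous_finite_range_constant)
    have "continuous_on {0..e} A" "continuous_on {0..e} b"
      using motion C1_on_imp_continuous_on unfolding motion_on_def by blast+
    then have "continuous_on {0..e} ?c" unfolding affine_family_def
      by (intro continuous_intros bounded_bilinear.continuous_on[OF bounded_bilinear_matrix_vector_mult])
    moreover have "continuous_on {0..e} (\<lambda>t. N (\<gamma> t))"
      using N unfolding unit_normal_field_def by (intro continuous_on_compose2[OF _ \<gamma>]) blast
    ultimately show "continuous_on {0..e} k" unfolding k_def using \<gamma>(1) by (intro continuous_intros)
    have "k ` {0..e} \<subseteq> {-r, r}" by (rule image_subsetI) (rule k)
    then show "finite (k ` {0..e})" by (rule finite_subset) simp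
  qed auto
  moreover have "k 0 = - r"
  proof -
    have "?c 0 = ?p" using motion unfolding motion_on_def by simp
    then show ?thesis using NS[of 0] e by (simp add: k_def ball_center_def norm_eq_1)
  qed
  ultimately have "k t = - r" using t e unfolding constant_on_def by (metis atLeastAtMost_iff less_eq_real_def order_refl)
  then show ?thesis using par[OF t] by (simp add: algebra_simps)
qed

lemma constant_speed_curves:
  assumes S: "C2_surface S" and N: "unit_normal_field S N" and r: "r \<noteq> 0" and const: "constant_speed S N r"
  obtains c where "\<And>l \<gamma> v w. l > 0 \<Longrightarrow> unit_speed_curve S l \<gamma> \<Longrightarrow>
      (\<gamma> has_vector_derivative v) (at 0) \<Longrightarrow> ((\<lambda>t. N (\<gamma> t)) has_vector_derivative w) (at 0) \<Longrightarrow>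
      norm (v + r *\<^sub>R w) = c"
proof -
  obtain c where c: "\<And>p l \<gamma>. p \<in> S \<Longrightarrow> l > 0 \<Longrightarrow> unit_speed_curve S l \<gamma> \<and> \<gamma> 0 = p \<Longrightarrow>
        \<exists>\<epsilon>. 0 < \<epsilon> \<and> \<epsilon> \<le> l \<and> (\<exists>A b. rolling S N r \<epsilon> \<gamma> A b \<and>
           (\<forall>t\<in>{0..\<epsilon>}. rolling_speed \<epsilon> A b (ball_center N r p) t = c))"
    using const unfolding constant_speed_def by blast
  show ?thesis
  proof (rule that)
    fix l \<gamma> v w assume l: "l > 0" and \<gamma>: "unit_speed_curve S l \<gamma>"
      and v: "(\<gamma> has_vector_derivative v) (at 0)" and w: "((\<lambda>t. N (\<gamma> t)) has_vector_derivative w) (at 0)"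
    have \<gamma>S: "\<gamma> ` {0..l} \<subseteq> S" and C2: "C2_on {0..l} \<gamma>" using \<gamma> by (auto simp: unit_speed_curve_def)
    have "\<gamma> 0 \<in> S" using \<gamma>S l by auto
    then obtain e A b where e: "0 < e" "e \<le> l" and roll: "rolling S N r e \<gamma> A b"
      and speed: "rolling_speed e A b (ball_center N r (\<gamma> 0)) 0 = c"
      using c[of "\<gamma> 0" l \<gamma>] l \<gamma> by force
    have "continuous_on {0..l} \<gamma>"
      using C2 unfolding C2_on_def by (meson continuous_on_eq_continuous_within has_derivative_continuous)
    then have cont: "continuous_on {0..e} \<gamma>" using e by (auto intro: continuous_on_subset)
    have "\<gamma> ` {0..e} \<subseteq> S" using \<gamma>S e by auto
    note center = rolling_center[OF S N r e(1) roll cont this]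
    have "((\<lambda>t. \<gamma> t + r *\<^sub>R N (\<gamma> t)) has_vector_derivative v + r *\<^sub>R w) (at 0 within {0..e})"
      by (rule has_vector_derivative_at_within) (auto intro!: derivative_eq_intros v w)
    then have "((\<lambda>t. affine_family A b t (ball_center N r (\<gamma> 0))) has_vector_derivative v + r *\<^sub>R w) (at 0 within {0..e})"
      by (rule has_vector_derivative_transform[rotated 2]) (use e center in auto)
    then have "vector_derivative (\<lambda>t. affine_family A b t (ball_center N r (\<gamma> 0))) (at 0 within {0..e}) = v + r *\<^sub>R w"
      using e by (intro vector_derivative_within_closed_interval) auto
    then show "norm (v + r *\<^sub>R w) = c" using speed by (simp add: rolling_speed_def)
  qed
qed

lemma constant_speed_imp_conformal_offset:
  assumes S: "C2_surface S" and N: "unit_normal_field S N" and r: "r \<noteq> 0" and const: "constant_speed S N r"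
  obtains c where "\<And>B X D D2 n' u v. surface_patch S N B X D D2 n' \<Longrightarrow> u \<in> B \<Longrightarrow>
      norm (D u v + r *\<^sub>R n' u v) = c * norm (D u v)"
proof -
  obtain c where c: "\<And>l \<gamma> v w. l > 0 \<Longrightarrow> unit_speed_curve S l \<gamma> \<Longrightarrow>
      (\<gamma> has_vector_derivative v) (at 0) \<Longrightarrow> ((\<lambda>t. N (\<gamma> t)) has_vector_derivative w) (at 0) \<Longrightarrow>
      norm (v + r *\<^sub>R w) = c"
    using constant_speed_curves[OF S N r const] by blast
  show ?thesis
  proof (rule that)
    fix B X D D2 n' u v assume "surface_patch S N B X D D2 n'" and u: "u \<in> B"
    then interpret surface_patch S N B X D D2 n' by simp
    show "norm (D u v + r *\<^sub>R n' u v) = c * norm (D u v)"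
    proof (cases "v = 0")
      case False
      obtain l \<gamma> where "l > 0" "unit_speed_curve S l \<gamma>"
         "(\<gamma> has_vector_derivative inverse (norm (D u v)) *\<^sub>R D u v) (at 0)"
         "((\<lambda>t. N (\<gamma> t)) has_vector_derivative inverse (norm (D u v)) *\<^sub>R n' u v) (at 0)"
        using unit_speed_curve_exists[OF u False] by metis
      note c[OF this]
      also have "inverse (norm (D u v)) *\<^sub>R D u v + r *\<^sub>R inverse (norm (D u v)) *\<^sub>R n' u v
          = inverse (norm (D u v)) *\<^sub>R (D u v + r *\<^sub>R n' u v)"
        by (simp add: scaleR_right_distrib mult.commute)
      finally have "inverse (norm (D u v)) * norm (D u v + r *\<^sub>R n' u v) = c" by simp
      moreover have "norm (D u v) \<noteq> 0" using D_inj[OF u] False by auto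
      ultimately show ?thesis by (simp add: field_simps)
    qed simp
  qed
qed

section \<open>Pairs of maps with orthogonal gradients\<close>

text \<open>The multiple \<open>s\<close> in the hypothesis \<open>zero\<close> replaces linearity of \<open>f'\<close>.\<close>

lemma constant_along_direction:
  fixes f :: "'a::real_normed_vector \<Rightarrow> 'b::real_normed_vector"
  assumes Q: "convex Q" and f: "\<And>y. y \<in> Q \<Longrightarrow> (f has_derivative f' y) (at y)"
    and zero: "\<And>y s. y \<in> Q \<Longrightarrow> f' y (s *\<^sub>R e) = 0"
    and y: "y \<in> Q" "y + s *\<^sub>R e \<in> Q"
  shows "f (y + s *\<^sub>R e) = f y"
proof -
  have in_Q: "y + (t * s) *\<^sub>R e \<in> Q" if "t \<in> {0..1}" for t
  proof -
    have "(1 - t) *\<^sub>R y + t *\<^sub>R (y + s *\<^sub>R e) \<in> Q"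
      using that by (intro convexD[OF Q y]) auto
    then show ?thesis by (simp add: algebra_simps)
  qed
  have "((\<lambda>t. f (y + (t * s) *\<^sub>R e)) has_derivative (\<lambda>h. 0)) (at t within {0..1})" if "t \<in> {0..1}" for t
  proof -
    have "((\<lambda>t. f (y + (t * s) *\<^sub>R e)) has_derivative (\<lambda>h. f' (y + (t * s) *\<^sub>R e) ((h * s) *\<^sub>R e))) (at t within {0..1})"
      by (rule has_derivative_compose[where g=f and f="\<lambda>t. y + (t * s) *\<^sub>R e", OF _ f[OF in_Q[OF that]]],
          (rule derivative_eq_intros refl)+) simp
    then show ?thesis by (simp add: zero[OF in_Q[OF that]])
  qed
  from has_derivative_zero_unique[OF _ this, of 1 0] show ?thesis by simp
qed

lemma derivative_constant_along_direction:
  fixes f :: "'a::real_normed_vector \<Rightarrow> 'b::real_normed_vector"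
  assumes Q: "convex Q" "open Q" and f: "\<And>y. y \<in> Q \<Longrightarrow> (f has_derivative f' y) (at y)"
    and zero: "\<And>y s. y \<in> Q \<Longrightarrow> f' y (s *\<^sub>R e) = 0"
    and y: "y \<in> Q" "y + s *\<^sub>R e \<in> Q"
  shows "f' (y + s *\<^sub>R e) = f' y"
proof (rule has_derivative_unique[OF _ f[OF y(1)]])
  let ?T = "Q \<inter> (\<lambda>x. x + s *\<^sub>R e) -` Q"
  have T: "open ?T" using Q(2) by (intro open_Int open_vimage continuous_intros) auto
  have "((\<lambda>x. f (x + s *\<^sub>R e)) has_derivative f' (y + s *\<^sub>R e)) (at y)"
    by (rule has_derivative_compose[where g=f and f="\<lambda>x. x + s *\<^sub>R e" and f'="\<lambda>x. x", OF _ f[OF y(2)]])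
      (auto intro!: derivative_eq_intros)
  then show "(f has_derivative f' (y + s *\<^sub>R e)) (at y)"
    by (rule has_derivative_transform_within_open[OF _ T])
      (use y constant_along_direction[OF Q(1) f zero] in auto)
qed

text \<open>Two maps into three-space whose differentials have orthogonal images inside the plane orthogonal to
  \<open>n\<close>, without common kernel. Since that plane has dimension two, the two ranks at each point add up to two.\<close>

locale orthogonal_gradients =
  fixes B :: "(real^2) set" and n g h :: "real^2 \<Rightarrow> real^3"
    and g' h' :: "real^2 \<Rightarrow> (real^2) \<Rightarrow>\<^sub>L (real^3)"
  assumes open_B: "open B"
    and g: "\<And>u. u \<in> B \<Longrightarrow> (g has_derivative blinfun_apply (g' u)) (at u)"
    and h: "\<And>u. u \<in> B \<Longrightarrow> (h has_derivative blinfun_apply (h' u)) (at u)"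
    and cont_g': "continuous_on B g'" and cont_h': "continuous_on B h'"
    and n: "\<And>u. u \<in> B \<Longrightarrow> n u \<noteq> 0"
    and n_g': "\<And>u v. u \<in> B \<Longrightarrow> n u \<bullet> g' u v = 0" and n_h': "\<And>u v. u \<in> B \<Longrightarrow> n u \<bullet> h' u v = 0"
    and orth: "\<And>u v w. u \<in> B \<Longrightarrow> g' u v \<bullet> h' u w = 0"
    and kernel: "\<And>u v. u \<in> B \<Longrightarrow> g' u v = 0 \<Longrightarrow> h' u v = 0 \<Longrightarrow> v = 0"
begin

lemma swap: "orthogonal_gradients B n h g h' g'"
  using open_B g h cont_g' cont_h' n n_g' n_h' orth kernel
  by unfold_locales (auto simp: inner_commute)

lemma open_condition:
  fixes P :: "real^2 \<Rightarrow> 'b::t1_space"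
  assumes "continuous_on B P" "u \<in> B" "P u \<noteq> a"
  obtains W where "open W" "u \<in> W" "W \<subseteq> B" "\<And>x. x \<in> W \<Longrightarrow> P x \<noteq> a"
proof
  show "open (B \<inter> P -` (- {a}))"
    by (rule continuous_open_preimage[OF assms(1) open_B]) auto
qed (use assms in auto)

text \<open>Having rank two is an open condition on \<open>h'\<close>, and it leaves no room for \<open>g'\<close>.\<close>

lemma vanishes_near_injective:
  assumes u: "u \<in> B" and inj: "\<And>v. h' u v = 0 \<Longrightarrow> v = 0"
  obtains W where "open W" "u \<in> W" "W \<subseteq> B" "\<And>x v. x \<in> W \<Longrightarrow> g' x v = 0"
proof -
  let ?k = "\<lambda>u. cross3 (h' u (axis 1 1)) (h' u (axis 2 1))"
  have "continuous_on B ?k" using cont_h' by (intro continuous_on_cross continuous_intros)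
  moreover have "?k u \<noteq> 0"
    using inj by (intro cross3_axis_image_nonzero bounded_linear.linear[OF blinfun.bounded_linear_right])
  ultimately obtain W where W: "open W" "u \<in> W" "W \<subseteq> B" "\<And>x. x \<in> W \<Longrightarrow> ?k x \<noteq> 0"
    using open_condition[of ?k u 0] u by blast
  have "g' x v = 0" if x: "x \<in> W" for x v
  proof -
    have xB: "x \<in> B" using x W by blast
    define k where "k = ?k x"
    have k: "k \<noteq> 0" using W(4)[OF x] by (simp add: k_def)
    obtain a where a: "g' x v = a *\<^sub>R k"
      using orthogonal_pair_imp_parallel_cross3[OF orth[OF xB] orth[OF xB] W(4)[OF x]]
      unfolding k_def by blast
    obtain b where b: "n x = b *\<^sub>R k"
      using orthogonal_pair_imp_parallel_cross3[OF n_h'[OF xB] n_h'[OF xB] W(4)[OF x]]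
      unfolding k_def by blast
    have "b \<noteq> 0" using n[OF xB] b by auto
    then show ?thesis using n_g'[OF xB, of v] k unfolding a b by simp
  qed
  then show ?thesis using that W by blast
qed

text \<open>Where both differentials are nonzero the image of \<open>g'\<close> is a line, so a single component of \<open>g'\<close> that is
  not identically zero detects its kernel.\<close>

lemma g'_zero_of_component_zero:
  assumes u: "u \<in> B" and a: "g' u v0 \<bullet> m \<noteq> 0" and b: "h' u w0 \<noteq> 0" and z: "g' u v \<bullet> m = 0"
  shows "g' u v = 0"
proof -
  let ?k = "cross3 (n u) (h' u w0)"
  have k: "?k \<noteq> 0" using norm_and_cross_eq_0[of "n u" "h' u w0"] n[OF u] n_h'[OF u] b by auto
  have par: "\<exists>x. g' u v = x *\<^sub>R ?k" for v
    using orthogonal_pair_imp_parallel_cross3[of "g' u v" "n u" "h' u w0"] n_g'[OF u, of v] orth[OF u] k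
    by (metis inner_commute)
  obtain x y where x: "g' u v = x *\<^sub>R ?k" and y: "g' u v0 = y *\<^sub>R ?k" using par by blast
  show ?thesis using a z unfolding x y by auto
qed

text \<open>The crucial step, which replaces the Codazzi equations. A component of \<open>g\<close> and a component of \<open>h\<close> form a
  local diffeomorphism \<open>\<Psi>\<close>. In these coordinates \<open>g\<close> does not change when the second coordinate varies, nor
  does \<open>h\<close> when the first varies. Given \<open>p\<close> and \<open>q\<close>, the point with the first coordinate of \<open>p\<close> and the second
  coordinate of \<open>q\<close> has the gradient of \<open>g\<close> at \<open>p\<close> and the gradient of \<open>h\<close> at \<open>q\<close>; at that single point
  orthogonality is given.\<close>

lemma global_orthogonality:
  assumes u0: "u0 \<in> B" and gv: "g' u0 v0 \<noteq> 0" and hw: "h' u0 w0 \<noteq> 0"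
  obtains W where "open W" "u0 \<in> W" "W \<subseteq> B"
    "\<And>p q v w. p \<in> W \<Longrightarrow> q \<in> W \<Longrightarrow> g' p v \<bullet> h' q w = 0"
proof -
  interpret sw: orthogonal_gradients B n h g h' g' by (rule swap)
  define m where "m = g' u0 v0"
  define k where "k = h' u0 w0"
  have "continuous_on B (\<lambda>u. (g' u v0 \<bullet> m) * (h' u w0 \<bullet> k))"
    using cont_g' cont_h' by (intro continuous_intros)
  moreover have "(g' u0 v0 \<bullet> m) * (h' u0 w0 \<bullet> k) \<noteq> 0" using gv hw by (simp add: m_def k_def)
  ultimately obtain B1 where B1: "open B1" "u0 \<in> B1" "B1 \<subseteq> B"
      and "\<And>x. x \<in> B1 \<Longrightarrow> (g' x v0 \<bullet> m) * (h' x w0 \<bullet> k) \<noteq> 0"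
    using open_condition[of "\<lambda>u. (g' u v0 \<bullet> m) * (h' u w0 \<bullet> k)" u0 0] u0 by blast
  then have nz: "g' x v0 \<bullet> m \<noteq> 0" "h' x w0 \<bullet> k \<noteq> 0" if "x \<in> B1" for x using that by auto
  have gz: "g' x v = 0" if "x \<in> B1" "g' x v \<bullet> m = 0" for x v
    using g'_zero_of_component_zero[of x v0 m w0 v] nz[OF that(1)] that B1(3) by force
  have hz: "h' x v = 0" if "x \<in> B1" "h' x v \<bullet> k = 0" for x v
    using sw.g'_zero_of_component_zero[of x w0 k v0 v] nz[OF that(1)] that B1(3) by force
  let ?e1 = "axis 1 1 :: real^2" and ?e2 = "axis 2 1 :: real^2"
  define \<Psi> where "\<Psi> = (\<lambda>u. (g u \<bullet> m) *\<^sub>R ?e1 + (h u \<bullet> k) *\<^sub>R ?e2)"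
  define \<Psi>' where "\<Psi>' = (\<lambda>u. (blinfun_scaleR_left ?e1 o\<^sub>L (blinfun_inner_left m o\<^sub>L g' u))
      + (blinfun_scaleR_left ?e2 o\<^sub>L (blinfun_inner_left k o\<^sub>L h' u)))"
  have \<Psi>'_apply: "\<Psi>' u v = (g' u v \<bullet> m) *\<^sub>R ?e1 + (h' u v \<bullet> k) *\<^sub>R ?e2" for u v
    by (simp add: \<Psi>'_def blinfun.add_left inner_commute)
  have comp: "\<Psi> u $ 1 = g u \<bullet> m" "\<Psi> u $ 2 = h u \<bullet> k" "\<Psi>' u v $ 1 = g' u v \<bullet> m" "\<Psi>' u v $ 2 = h' u v \<bullet> k" for u v
    by (simp_all add: \<Psi>'_apply \<Psi>_def axis_def)
  have \<Psi>der: "(\<Psi> has_derivative blinfun_apply (\<Psi>' u)) (at u)" if "u \<in> B1" for u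
  proof -
    have "u \<in> B" using that B1 by blast
    then show ?thesis unfolding \<Psi>_def \<Psi>'_apply
      by (intro has_derivative_add has_derivative_scaleR_left has_derivative_inner_left g h)
  qed
  have \<Psi>cont: "continuous_on B1 \<Psi>'"
    unfolding \<Psi>'_def by (intro continuous_intros continuous_on_subset[OF cont_g' B1(3)] continuous_on_subset[OF cont_h' B1(3)])
  obtain J where J: "J o\<^sub>L \<Psi>' u0 = id_blinfun"
  proof -
    have lin: "linear (\<Psi>' u0)" by (rule bounded_linear.linear[OF blinfun.bounded_linear_right])
    have "v = 0" if "\<Psi>' u0 v = 0" for v
      using comp(3,4)[of u0 v] gz[OF B1(2)] hz[OF B1(2)] kernel[OF u0] that by (metis zero_index)
    then have "inj (\<Psi>' u0)" using lin linear_injective_0 by blast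
    then obtain j where "linear j" "j \<circ> \<Psi>' u0 = id" using linear_injective_left_inverse[OF lin] by blast
    then have "Blinfun j o\<^sub>L \<Psi>' u0 = id_blinfun"
      by (intro blinfun_eqI) (simp add: bounded_linear_Blinfun_apply linear_linear o_def fun_eq_iff)
    then show ?thesis by (rule that)
  qed
  obtain U' V \<Theta> \<Theta>' where U': "open U'" "U' \<subseteq> B1" "u0 \<in> U'" and V: "open V" "\<Psi> u0 \<in> V"
    and hom: "homeomorphism U' V \<Psi> \<Theta>"
    and \<Theta>: "\<And>y. y \<in> V \<Longrightarrow> (\<Theta> has_derivative (\<Theta>' y)) (at y)"
    and \<Theta>': "\<And>y. y \<in> V \<Longrightarrow> \<Theta>' y = inv (blinfun_apply (\<Psi>' (\<Theta> y)))"
    and bij: "\<And>y. y \<in> V \<Longrightarrow> bij (blinfun_apply (\<Psi>' (\<Theta> y)))"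
    using inverse_function_theorem[OF B1(1) \<Psi>der \<Psi>cont B1(2) J] by metis
  obtain d where d: "d > 0" "ball (\<Psi> u0) d \<subseteq> V" using V by (rule openE)
  \<comment> \<open>a box rather than a ball, so that coordinates of different points can be combined\<close>
  define Q where "Q = box (\<chi> i. \<Psi> u0 $ i - d/2) (\<chi> i. \<Psi> u0 $ i + d/2)"
  have Q_iff: "y \<in> Q \<longleftrightarrow> \<bar>y $ 1 - \<Psi> u0 $ 1\<bar> < d/2 \<and> \<bar>y $ 2 - \<Psi> u0 $ 2\<bar> < d/2" for y
    by (simp only: Q_def mem_box_cart forall_2 abs_less_iff vec_lambda_beta) (safe; linarith)
  have Q: "open Q" "convex Q" by (auto simp: Q_def)
  have QV: "Q \<subseteq> V"
  proof
    fix y assume "y \<in> Q"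
    moreover have "norm (y - \<Psi> u0) \<le> \<bar>y $ 1 - \<Psi> u0 $ 1\<bar> + \<bar>y $ 2 - \<Psi> u0 $ 2\<bar>"
      using norm_le_l1_cart[of "y - \<Psi> u0"] by (simp add: sum_2)
    ultimately have "y \<in> ball (\<Psi> u0) d" by (simp add: Q_iff dist_norm norm_minus_commute)
    then show "y \<in> V" using d by blast
  qed
  have \<Theta>B: "\<Theta> y \<in> B1" "\<Theta> y \<in> B" if "y \<in> Q" for y
    using homeomorphism_image2[OF hom] that QV U'(2) B1(3) by blast+
  have \<Psi>\<Theta>': "\<Psi>' (\<Theta> y) (\<Theta>' y v) = v" "\<Theta>' y (\<Psi>' (\<Theta> y) v) = v" if "y \<in> Q" for y v
    using that QV \<Theta>' bij by (auto simp: bij_is_surj surj_f_inv_f bij_is_inj inv_f_f subset_iff)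
  \<comment> \<open>in the coordinates \<open>\<Psi>\<close>, \<open>g\<close> depends on the first and \<open>h\<close> on the second variable only\<close>
  define gq where "gq = (\<lambda>y v. g' (\<Theta> y) (\<Theta>' y v))"
  define hq where "hq = (\<lambda>y v. h' (\<Theta> y) (\<Theta>' y v))"
  have gq: "((\<lambda>y. g (\<Theta> y)) has_derivative gq y) (at y)" and hq: "((\<lambda>y. h (\<Theta> y)) has_derivative hq y) (at y)"
    if "y \<in> Q" for y
    using has_derivative_compose[OF \<Theta> g] has_derivative_compose[OF \<Theta> h] that QV \<Theta>B
    by (auto simp: gq_def hq_def)
  have gq0: "gq y (s *\<^sub>R ?e2) = 0" if "y \<in> Q" for y s
    unfolding gq_def using comp(3)[of "\<Theta> y" "\<Theta>' y (s *\<^sub>R ?e2)"]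
    by (intro gz \<Theta>B that) (simp add: \<Psi>\<Theta>'[OF that] axis_def)
  have hq0: "hq y (s *\<^sub>R ?e1) = 0" if "y \<in> Q" for y s
    unfolding hq_def using comp(4)[of "\<Theta> y" "\<Theta>' y (s *\<^sub>R ?e1)"]
    by (intro hz \<Theta>B that) (simp add: \<Psi>\<Theta>'[OF that] axis_def)
  define W where "W = U' \<inter> \<Psi> -` Q"
  show ?thesis
  proof
    show "open W" unfolding W_def
      by (rule continuous_open_preimage[OF homeomorphism_cont1[OF hom] U'(1) Q(1)])
    show "u0 \<in> W" using U'(3) d(1) by (simp add: W_def Q_iff)
    show "W \<subseteq> B" using U' B1 by (auto simp: W_def)
    fix p q v w assume p: "p \<in> W" and q: "q \<in> W"
    let ?y = "\<Psi> p" and ?x = "\<Psi> q"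
    have y: "?y \<in> Q" "\<Theta> ?y = p" and x: "?x \<in> Q" "\<Theta> ?x = q"
      using p q homeomorphism_apply1[OF hom] by (auto simp: W_def)
    \<comment> \<open>\<open>z\<close> has the first coordinate of \<open>?y\<close> and the second coordinate of \<open>?x\<close>\<close>
    define z where "z = ?y + (?x $ 2 - ?y $ 2) *\<^sub>R ?e2"
    have z2: "z = ?x + (?y $ 1 - ?x $ 1) *\<^sub>R ?e1"
      by (simp add: z_def vec_eq_iff forall_2 axis_def)
    have zQ: "z \<in> Q" using x(1) y(1) by (simp add: Q_iff z_def axis_def)
    have "g' p v = gq ?y (\<Psi>' p v)" using \<Psi>\<Theta>'(2)[OF y(1), of v] y(2) by (simp add: gq_def)
    also have "gq ?y = gq z" unfolding z_def
      by (rule derivative_constant_along_direction[OF Q(2,1) gq gq0 y(1) zQ[unfolded z_def], symmetric])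
    finally have 1: "g' p v = g' (\<Theta> z) (\<Theta>' z (\<Psi>' p v))" by (simp add: gq_def)
    have "h' q w = hq ?x (\<Psi>' q w)" using \<Psi>\<Theta>'(2)[OF x(1), of w] x(2) by (simp add: hq_def)
    also have "hq ?x = hq z" unfolding z2
      by (rule derivative_constant_along_direction[OF Q(2,1) hq hq0 x(1) zQ[unfolded z2], symmetric])
    finally have 2: "h' q w = h' (\<Theta> z) (\<Theta>' z (\<Psi>' q w))" by (simp add: hq_def)
    show "g' p v \<bullet> h' q w = 0" unfolding 1 2 by (rule orth[OF \<Theta>B(2)[OF zQ]])
  qed
qed

end

section \<open>Surfaces whose offset is conformal\<close>

definition radial_part :: "'a::real_inner \<Rightarrow> 'a \<Rightarrow> 'a" where
  "radial_part w x = x - ((x \<bullet> w) / (w \<bullet> w)) *\<^sub>R w"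

lemma linear_radial_part: "linear (radial_part w)"
  by (rule linearI) (simp_all add: radial_part_def inner_add_left add_divide_distrib algebra_simps)

lemma bounded_linear_radial_part: "bounded_linear (radial_part (w :: 'a::euclidean_space))"
  by (rule linear_conv_bounded_linear[THEN iffD1, OF linear_radial_part])

lemma radial_part_inner: "w \<noteq> 0 \<Longrightarrow> radial_part w x \<bullet> w = 0"
  by (simp add: radial_part_def inner_diff_left)

lemma radial_part_self [simp]: "radial_part w w = 0"
  by (cases "w = 0") (simp_all add: radial_part_def)

lemma radial_part_orthogonal: "x \<bullet> w = 0 \<Longrightarrow> radial_part w x = x"
  by (simp add: radial_part_def)

lemma radial_part_scale: "c \<noteq> 0 \<Longrightarrow> radial_part (c *\<^sub>R w) = radial_part w"
  by (rule ext) (simp add: radial_part_def)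

text \<open>Polarisation.\<close>

lemma inner_eq_of_norm_eq:
  fixes P Q :: "'a::real_vector \<Rightarrow> 'b::real_inner"
  assumes "linear P" "linear Q" and norm: "\<And>v. norm (P v) = c * norm (Q v)"
  shows "P v \<bullet> P w = c\<^sup>2 * (Q v \<bullet> Q w)"
proof -
  have "P v \<bullet> P w = ((norm (P (v + w)))\<^sup>2 - (norm (P v))\<^sup>2 - (norm (P w))\<^sup>2) / 2"
    by (simp add: dot_norm linear_add[OF assms(1)])
  also have "\<dots> = c\<^sup>2 * (((norm (Q (v + w)))\<^sup>2 - (norm (Q v))\<^sup>2 - (norm (Q w))\<^sup>2) / 2)"
    by (simp add: norm power_mult_distrib right_diff_distrib diff_divide_distrib)
  also have "\<dots> = c\<^sup>2 * (Q v \<bullet> Q w)"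
    by (simp add: dot_norm linear_add[OF assms(2)])
  finally show ?thesis .
qed

text \<open>Near \<open>p\<close> the normal is an affine function of the position. For a multiple of the identity the surface is
  planar or spherical near \<open>p\<close>; for twice a radial part it is cylindrical with axis direction \<open>w\<close>. The condition
  \<open>N x \<bullet> w = 0\<close> records that \<open>w\<close> is a tangent vector, along which the normal is constant.\<close>

definition affine_normal_near ::
    "(real^3) set \<Rightarrow> (real^3 \<Rightarrow> real^3) \<Rightarrow> real \<Rightarrow> (real^3 \<Rightarrow> real^3) \<Rightarrow> real^3 \<Rightarrow> bool" where
  "affine_normal_near S N r L p \<longleftrightarrow>
     (\<exists>W K. openin (top_of_set S) W \<and> p \<in> W \<and> (\<forall>x\<in>W. L x + r *\<^sub>R N x = K) \<and>
        ((\<exists>k. L = (\<lambda>x. k *\<^sub>R x)) \<or>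
         (\<exists>w. w \<noteq> 0 \<and> (\<forall>x\<in>W. N x \<bullet> w = 0) \<and> L = (\<lambda>x. 2 *\<^sub>R radial_part w x))))"

context surface_patch begin

lemma has_derivative_offset:
  assumes "u \<in> B"
  shows "((\<lambda>u. a *\<^sub>R X u + r *\<^sub>R N (X u)) has_derivative blinfun_apply (a *\<^sub>R D u + r *\<^sub>R n' u)) (at u)"
  by (rule has_derivative_eq_rhs[OF has_derivative_add[OF has_derivative_scaleR_right[OF X[OF assms]]
          has_derivative_scaleR_right[OF n'[OF assms]]]])
    (simp add: fun_eq_iff blinfun.add_left blinfun.scaleR_left)

lemma affine_normal_nearI:
  assumes L: "bounded_linear L" and W: "open W" "u0 \<in> W" "W \<subseteq> B"
    and zero: "\<And>u v. u \<in> W \<Longrightarrow> L (D u v) + r *\<^sub>R n' u v = 0"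
    and alt: "(\<exists>k. L = (\<lambda>x. k *\<^sub>R x)) \<or>
       (\<exists>w. w \<noteq> 0 \<and> (\<forall>u\<in>W. N (X u) \<bullet> w = 0) \<and> L = (\<lambda>x. 2 *\<^sub>R radial_part w x))"
  shows "affine_normal_near S N r L (X u0)"
proof -
  obtain e where e: "e > 0" "ball u0 e \<subseteq> W" using W by (meson openE)
  let ?f = "\<lambda>u. L (X u) + r *\<^sub>R N (X u)"
  have "(?f has_derivative (\<lambda>v. 0)) (at u within ball u0 e)" if "u \<in> ball u0 e" for u
  proof -
    have "u \<in> B" "u \<in> W" using that e W by auto
    then have "(?f has_derivative (\<lambda>v. L (D u v) + r *\<^sub>R n' u v)) (at u)"
      by (intro has_derivative_add bounded_linear.has_derivative[OF L] has_derivative_scaleR_right X n')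
    then show ?thesis using zero[OF \<open>u \<in> W\<close>] by (simp add: has_derivative_at_withinI)
  qed
  then obtain K where K: "\<And>u. u \<in> ball u0 e \<Longrightarrow> ?f u = K"
    using has_derivative_zero_constant[of "ball u0 e" ?f] by auto
  show ?thesis unfolding affine_normal_near_def
  proof (intro exI[of _ "X ` ball u0 e"] exI[of _ K] conjI)
    show "openin (top_of_set S) (X ` ball u0 e)" using e W by (intro open_image) auto
    show "\<forall>x\<in>X ` ball u0 e. L x + r *\<^sub>R N x = K" using K by blast
    show "(\<exists>k. L = (\<lambda>x. k *\<^sub>R x)) \<or> (\<exists>w. w \<noteq> 0 \<and> (\<forall>x\<in>X ` ball u0 e. N x \<bullet> w = 0) \<and> L = (\<lambda>x. 2 *\<^sub>R radial_part w x))"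
      using alt e(2) by blast
  qed (use e in auto)
qed

text \<open>The three possible pairs of ranks for \<open>g = X + r N + c X\<close> and \<open>h = X + r N - c X\<close>. In classical terms the
  principal curvatures are among \<open>(1 - c) / r\<close> and \<open>(1 + c) / r\<close>; the rank pair says which of them occur.\<close>

lemma conformal_offset_alternatives:
  assumes r: "r \<noteq> 0" and c: "c > 0"
    and conf: "\<And>u v. u \<in> B \<Longrightarrow> norm (D u v + r *\<^sub>R n' u v) = c * norm (D u v)"
    and u0: "u0 \<in> B"
  obtains L where "affine_normal_near S N r L (X u0)"
proof -
  define g where "g = (\<lambda>u. (1 + c) *\<^sub>R X u + r *\<^sub>R N (X u))"
  define h where "h = (\<lambda>u. (1 - c) *\<^sub>R X u + r *\<^sub>R N (X u))"
  define g' where "g' = (\<lambda>u. (1 + c) *\<^sub>R D u + r *\<^sub>R n' u)"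
  define h' where "h' = (\<lambda>u. (1 - c) *\<^sub>R D u + r *\<^sub>R n' u)"
  have app: "g' u v = (1 + c) *\<^sub>R D u v + r *\<^sub>R n' u v" "h' u v = (1 - c) *\<^sub>R D u v + r *\<^sub>R n' u v" for u v
    by (simp_all add: g'_def h'_def blinfun.add_left blinfun.scaleR_left)
  have contD: "continuous_on B D"
    using D by (meson continuous_at_imp_continuous_on has_derivative_continuous)
  have orth: "g' u v \<bullet> h' u w = 0" if u: "u \<in> B" for u v w
  proof -
    let ?P = "\<lambda>v. D u v + r *\<^sub>R n' u v"
    have pol: "?P v \<bullet> ?P w = c\<^sup>2 * (D u v \<bullet> D u w)"
      using conf[OF u] by (intro inner_eq_of_norm_eq linearI)
        (simp_all add: blinfun.add_right blinfun.scaleR_right algebra_simps)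
    have sym: "?P v \<bullet> D u w = D u v \<bullet> ?P w"
      using shape_symmetric[OF u, of v w] by (simp add: inner_add_left inner_add_right inner_commute)
    have "g' u v \<bullet> h' u w = (?P v + c *\<^sub>R D u v) \<bullet> (?P w - c *\<^sub>R D u w)"
      unfolding app by (simp add: algebra_simps)
    also have "\<dots> = ?P v \<bullet> ?P w - c\<^sup>2 * (D u v \<bullet> D u w) + c * (D u v \<bullet> ?P w - ?P v \<bullet> D u w)"
      unfolding inner_add_left[of "?P v" "c *\<^sub>R D u v"] inner_diff_right[of _ "?P w" "c *\<^sub>R D u w"]
        inner_scaleR_left inner_scaleR_right by (simp only: power2_eq_square) algebra
    also have "\<dots> = 0" using pol sym by simp
    finally show ?thesis .
  qed
  interpret G: orthogonal_gradients B "\<lambda>u. N (X u)" g h g' h'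
  proof
    show "(g has_derivative blinfun_apply (g' u)) (at u)" "(h has_derivative blinfun_apply (h' u)) (at u)" if "u \<in> B" for u
      unfolding g_def g'_def h_def h'_def by (rule has_derivative_offset[OF that])+
    show "continuous_on B g'" "continuous_on B h'"
      unfolding g'_def h'_def by (intro continuous_intros contD cont_n')+
    show "N (X u) \<noteq> 0" if "u \<in> B" for u using normal_unit[OF that] by auto
    show "N (X u) \<bullet> g' u v = 0" "N (X u) \<bullet> h' u v = 0" if "u \<in> B" for u v
      unfolding app by (simp_all add: inner_add_right normal_D[OF that] n'_orthogonal[OF that])
    show "v = 0" if u: "u \<in> B" and "g' u v = 0" "h' u v = 0" for u v
    proof -
      have "(2 * c) *\<^sub>R D u v = ((1 + c) - (1 - c)) *\<^sub>R D u v" by simp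
      also have "\<dots> = g' u v - h' u v" unfolding app scaleR_diff_left by simp
      finally have "(2 * c) *\<^sub>R D u v = g' u v - h' u v" .
      then show ?thesis using that c D_inj[OF u] by simp
    qed
  qed (use open_B orth in auto)
  interpret H: orthogonal_gradients B "\<lambda>u. N (X u)" h g h' g' by (rule G.swap)
  show ?thesis
  proof (cases "(\<forall>v. g' u0 v = 0) \<or> (\<forall>v. h' u0 v = 0)")
    case True
    then show ?thesis
    proof
      assume "\<forall>v. g' u0 v = 0"
      then have inj: "h' u0 v = 0 \<Longrightarrow> v = 0" for v using G.kernel[OF u0] by blast
      obtain W where "open W" "u0 \<in> W" "W \<subseteq> B" "\<And>x v. x \<in> W \<Longrightarrow> g' x v = 0"
        using G.vanishes_near_injective[OF u0 inj] by blast
      then have "affine_normal_near S N r (\<lambda>x. (1 + c) *\<^sub>R x) (X u0)"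
        unfolding app by (intro affine_normal_nearI) (auto intro: bounded_linear_scaleR_right)
      then show ?thesis by (rule that)
    next
      assume "\<forall>v. h' u0 v = 0"
      then have inj: "g' u0 v = 0 \<Longrightarrow> v = 0" for v using G.kernel[OF u0] by blast
      obtain W where "open W" "u0 \<in> W" "W \<subseteq> B" "\<And>x v. x \<in> W \<Longrightarrow> h' x v = 0"
        using H.vanishes_near_injective[OF u0 inj] by blast
      then have "affine_normal_near S N r (\<lambda>x. (1 - c) *\<^sub>R x) (X u0)"
        unfolding app by (intro affine_normal_nearI) (auto intro: bounded_linear_scaleR_right)
      then show ?thesis by (rule that)
    qed
  next
    case False
    then obtain v0 w0 where v0: "g' u0 v0 \<noteq> 0" and w0: "h' u0 w0 \<noteq> 0" by blast
    obtain W where W: "open W" "u0 \<in> W" "W \<subseteq> B"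
      and glob: "\<And>p q v w. p \<in> W \<Longrightarrow> q \<in> W \<Longrightarrow> g' p v \<bullet> h' q w = 0"
      using G.global_orthogonality[OF u0 v0 w0] by blast
    \<comment> \<open>the derivative of \<open>2 c r N = (c - 1) g + (c + 1) h\<close>\<close>
    have n'_gh: "(2 * c * r) *\<^sub>R n' u v = (c - 1) *\<^sub>R g' u v + (c + 1) *\<^sub>R h' u v" for u v
    proof -
      have "(c - 1) *\<^sub>R g' u v + (c + 1) *\<^sub>R h' u v
          = ((c - 1) * (1 + c) + (c + 1) * (1 - c)) *\<^sub>R D u v + ((c - 1) * r + (c + 1) * r) *\<^sub>R n' u v"
        unfolding app scaleR_add_left[of "(c - 1) * (1 + c)" "(c + 1) * (1 - c)"]
          scaleR_add_left[of "(c - 1) * r" "(c + 1) * r"]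
        by (simp only: scaleR_add_right scaleR_scaleR add.assoc add.commute add.left_commute)
      moreover have "(c - 1) * (1 + c) + (c + 1) * (1 - c) = 0" "(c - 1) * r + (c + 1) * r = 2 * c * r" by algebra+
      ultimately show ?thesis by simp
    qed
    have n'_zero: "n' u0 v \<bullet> a = 0" if "open W'" "u0 \<in> W'" "\<And>u. u \<in> W' \<Longrightarrow> N (X u) \<bullet> a = 0" for W' v a
    proof -
      have "((\<lambda>u. N (X u) \<bullet> a) has_derivative (\<lambda>v. n' u0 v \<bullet> a)) (at u0)"
        by (rule has_derivative_inner_left[OF n'[OF u0]])
      moreover have "((\<lambda>u. N (X u) \<bullet> a) has_derivative (\<lambda>v. 0)) (at u0)"
        by (rule has_derivative_transform_within_open[OF has_derivative_const that(1,2)]) (simp add: that(3))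
      ultimately have "(\<lambda>v. n' u0 v \<bullet> a) = (\<lambda>v. 0)" by (rule has_derivative_unique)
      then show ?thesis by meson
    qed
    \<comment> \<open>the lines spanned by the gradient of \<open>h\<close> are not all parallel\<close>
    have "\<exists>q\<in>W. \<exists>w. cross3 (h' u0 w0) (h' q w) \<noteq> 0"
    proof (rule ccontr)
      assume neg: "\<not> ?thesis"
      let ?b = "h' u0 w0"
      have "continuous_on B (\<lambda>u. h' u w0)" using G.cont_h' by (intro continuous_intros)
      then obtain W1 where W1: "open W1" "u0 \<in> W1" "W1 \<subseteq> B" "\<And>x. x \<in> W1 \<Longrightarrow> h' x w0 \<noteq> 0"
        using G.open_condition[of "\<lambda>u. h' u w0" u0 0] u0 w0 by blast
      have "N (X u) \<bullet> ?b = 0" if u: "u \<in> W \<inter> W1" for u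
      proof -
        have "cross3 ?b (h' u w0) = 0" using u neg by blast
        then have "collinear {0, ?b, h' u w0}" by (simp add: cross_eq_0)
        then obtain t where "h' u w0 = t *\<^sub>R ?b" "t \<noteq> 0"
          using w0 W1(4)[of u] u unfolding collinear_lemma by auto
        then show ?thesis using G.n_h'[of u w0] u W by auto
      qed
      then have "n' u0 w0 \<bullet> ?b = 0" using W W1 by (intro n'_zero[of "W \<inter> W1"]) auto
      then have "((c - 1) *\<^sub>R g' u0 w0 + (c + 1) *\<^sub>R ?b) \<bullet> ?b = 0" unfolding n'_gh[symmetric] by simp
      then have "(c + 1) * (?b \<bullet> ?b) = 0" using orth[OF u0] by (simp add: inner_add_left)
      then show False using c w0 by simp
    qed
    then obtain q w where q: "q \<in> W" and indep: "cross3 (h' u0 w0) (h' q w) \<noteq> 0" by blast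
    define w1 where "w1 = cross3 (h' u0 w0) (h' q w)"
    \<comment> \<open>all gradients of \<open>g\<close> are orthogonal to two independent vectors, hence multiples of \<open>w1\<close>\<close>
    have par: "\<exists>t. g' u v = t *\<^sub>R w1" if "u \<in> W" for u v
      using orthogonal_pair_imp_parallel_cross3[OF glob[OF that W(2)] glob[OF that q] indep]
      unfolding w1_def by blast
    have "continuous_on B (\<lambda>u. g' u v0)" using G.cont_g' by (intro continuous_intros)
    then obtain W1 where W1: "open W1" "u0 \<in> W1" "W1 \<subseteq> B" "\<And>x. x \<in> W1 \<Longrightarrow> g' x v0 \<noteq> 0"
      using G.open_condition[of "\<lambda>u. g' u v0" u0 0] u0 v0 by blast
    define W2 where "W2 = W \<inter> W1"
    have W2: "open W2" "u0 \<in> W2" "W2 \<subseteq> B" using W W1 by (auto simp: W2_def)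
    have Nw: "N (X u) \<bullet> w1 = 0" if u: "u \<in> W2" for u
    proof -
      obtain t where "g' u v0 = t *\<^sub>R w1" using par[of u v0] u by (auto simp: W2_def)
      then show ?thesis using G.n_g'[of u v0] W1(4)[of u] u W2 by (auto simp: W2_def)
    qed
    have w1: "w1 \<noteq> 0" using indep by (simp add: w1_def)
    have c1: "c = 1"
    proof -
      obtain t where t: "g' u0 v0 = t *\<^sub>R w1" using par[OF W(2)] by blast
      have "h' u0 v0 \<bullet> w1 = 0" using orth[OF u0, of v0 v0] v0 unfolding t by (simp add: inner_commute)
      moreover have "n' u0 v0 \<bullet> w1 = 0" using W2 Nw by (intro n'_zero[of W2])
      then have "((c - 1) *\<^sub>R g' u0 v0 + (c + 1) *\<^sub>R h' u0 v0) \<bullet> w1 = 0" unfolding n'_gh[symmetric] by simp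
      ultimately have "(c - 1) * t * (w1 \<bullet> w1) = 0" by (simp add: inner_add_left t)
      then show ?thesis using v0 t w1 by auto
    qed
    have "affine_normal_near S N r (\<lambda>x. 2 *\<^sub>R radial_part w1 x) (X u0)"
    proof (rule affine_normal_nearI[OF _ W2])
      show "bounded_linear (\<lambda>x. 2 *\<^sub>R radial_part w1 x)"
        using bounded_linear_compose[OF bounded_linear_scaleR_right bounded_linear_radial_part] .
      fix u v assume u: "u \<in> W2"
      obtain t where t: "g' u v = t *\<^sub>R w1" using par[of u v] u by (auto simp: W2_def)
      have rn: "r *\<^sub>R n' u v = t *\<^sub>R w1 - 2 *\<^sub>R D u v" using t unfolding app c1 by (simp add: algebra_simps)
      \<comment> \<open>the normal stays orthogonal to \<open>w1\<close> on all of \<open>W2\<close>, hence so does its derivative\<close>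
      have "((\<lambda>u. N (X u) \<bullet> w1) has_derivative (\<lambda>v. n' u v \<bullet> w1)) (at u)"
        using u W2 by (intro has_derivative_inner_left n') auto
      moreover have "((\<lambda>u. N (X u) \<bullet> w1) has_derivative (\<lambda>v. 0)) (at u)"
        by (rule has_derivative_transform_within_open[OF has_derivative_const W2(1) u]) (simp add: Nw)
      ultimately have "(\<lambda>v. n' u v \<bullet> w1) = (\<lambda>v. 0)" by (rule has_derivative_unique)
      then have "n' u v \<bullet> w1 = 0" by meson
      then have "(t *\<^sub>R w1 - 2 *\<^sub>R D u v) \<bullet> w1 = 0" unfolding rn[symmetric] by simp
      then have "t = 2 * ((D u v \<bullet> w1) / (w1 \<bullet> w1))" using w1 by (simp add: inner_diff_left field_simps)
      then show "2 *\<^sub>R radial_part w1 (D u v) + r *\<^sub>R n' u v = 0"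
        unfolding rn by (simp add: radial_part_def algebra_simps)
    qed (use w1 Nw in blast)
    then show ?thesis by (rule that)
  qed
qed

end

text \<open>For \<open>c = 0\<close> the offset \<open>X + r N\<close> is itself locally constant.\<close>

lemma constant_speed_imp_affine_normal_near:
  assumes S: "C2_surface S" and N: "unit_normal_field S N" and r: "r \<noteq> 0"
    and const: "constant_speed S N r" and p: "p \<in> S"
  obtains L where "affine_normal_near S N r L p"
proof -
  obtain c where conf: "\<And>B X D D2 n' u v. surface_patch S N B X D D2 n' \<Longrightarrow> u \<in> B \<Longrightarrow>
      norm (D u v + r *\<^sub>R n' u v) = c * norm (D u v)"
    using constant_speed_imp_conformal_offset[OF S N r const] by blast
  obtain B X D D2 n' u where patch: "surface_patch S N B X D D2 n'" and u: "u \<in> B" "X u = p"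
    using surface_patch_exists[OF S N p] .
  interpret surface_patch S N B X D D2 n' by (rule patch)
  note conf = conf[OF patch]
  have "D u (axis 1 1) \<noteq> 0" using D_inj[OF u(1)] by (metis axis_eq_0_iff zero_neq_one)
  then have "c \<ge> 0" using conf[OF u(1), of "axis 1 1"]
    by (metis norm_ge_zero zero_le_mult_iff norm_le_zero_iff)
  then consider "c > 0" | "c = 0" by linarith
  then show ?thesis
  proof cases
    case 1
    then show ?thesis using conformal_offset_alternatives[OF r 1 conf u(1)] u(2) that by blast
  next
    case 2
    then have "D x v + r *\<^sub>R n' x v = 0" if "x \<in> B" for x v using conf[OF that, of v] by simp
    then have "affine_normal_near S N r (\<lambda>x. 1 *\<^sub>R x) (X u)"
      using u open_B by (intro affine_normal_nearI[of _ B] disjI1 exI[of _ 1] bounded_linear_scaleR_right) auto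
    then show ?thesis using u(2) that by blast
  qed
qed

text \<open>Within the family of linear maps considered, \<open>L\<close> is determined by its restriction to the tangent plane: a
  multiple of the identity has one eigenvalue there, a radial part has the eigenvalue \<open>0\<close> exactly along its axis
  and another one across it.\<close>

lemma affine_normal_near_unique:
  assumes S: "C2_surface S" and N: "unit_normal_field S N" and p: "p \<in> S"
    and L: "affine_normal_near S N r L p" and L': "affine_normal_near S N r L' p"
  shows "L = L'"
proof -
  obtain W K where W: "openin (top_of_set S) W" "p \<in> W" and K: "\<And>x. x \<in> W \<Longrightarrow> L x + r *\<^sub>R N x = K"
    and alt: "(\<exists>k. L = (\<lambda>x. k *\<^sub>R x)) \<or> (\<exists>w. w \<noteq> 0 \<and> N p \<bullet> w = 0 \<and> L = (\<lambda>x. 2 *\<^sub>R radial_part w x))"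
    using L unfolding affine_normal_near_def by blast
  obtain W' K' where W': "openin (top_of_set S) W'" "p \<in> W'" and K': "\<And>x. x \<in> W' \<Longrightarrow> L' x + r *\<^sub>R N x = K'"
    and alt': "(\<exists>k. L' = (\<lambda>x. k *\<^sub>R x)) \<or> (\<exists>w. w \<noteq> 0 \<and> N p \<bullet> w = 0 \<and> L' = (\<lambda>x. 2 *\<^sub>R radial_part w x))"
    using L' unfolding affine_normal_near_def by blast
  obtain B X D D2 n' u where patch: "surface_patch S N B X D D2 n'" and u: "u \<in> B" "X u = p"
    using surface_patch_exists[OF S N p] .
  interpret surface_patch S N B X D D2 n' by (rule patch)
  have blr: "bounded_linear (\<lambda>x::real^3. 2 *\<^sub>R radial_part w x)" for w
    using bounded_linear_compose[OF bounded_linear_scaleR_right bounded_linear_radial_part] .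
  have bl: "bounded_linear L" "bounded_linear L'"
    using alt alt' blr bounded_linear_scaleR_right by auto
  have contX: "continuous_on B X" using X by (meson continuous_at_imp_continuous_on has_derivative_continuous)
  have "openin (top_of_set S) (W \<inter> W')" using W(1) W'(1) by (rule openin_Int)
  then have "openin (top_of_set B) (B \<inter> X -` (W \<inter> W'))"
    by (rule continuous_openin_preimage[OF contX, of S, rotated]) (use X_in in auto)
  then have T: "open (B \<inter> X -` (W \<inter> W'))" using open_B openin_open_eq by blast
  \<comment> \<open>\<open>L\<close> and \<open>L'\<close> differ by a constant along \<open>S\<close>, so they agree on tangent vectors\<close>
  have "L (D u v) = L' (D u v)" for v
  proof -
    have 1: "((\<lambda>x. L (X x) - L' (X x)) has_derivative (\<lambda>v. L (D u v) - L' (D u v))) (at u)"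
      by (intro has_derivative_diff bounded_linear.has_derivative[OF bl(1)] bounded_linear.has_derivative[OF bl(2)] X u)
    have 2: "((\<lambda>x. L (X x) - L' (X x)) has_derivative (\<lambda>v. 0)) (at u)"
    proof (rule has_derivative_transform_within_open[OF has_derivative_const T, of _ "K - K'"])
      show "K - K' = L (X x) - L' (X x)" if "x \<in> B \<inter> X -` (W \<inter> W')" for x
        using K[of "X x"] K'[of "X x"] that by auto
    qed (use u W W' in auto)
    show ?thesis using fun_cong[OF has_derivative_unique[OF 1 2], of v] by simp
  qed
  then have eq: "L x = L' x" if "N p \<bullet> x = 0" for x
    using range_D[OF u(1)] that unfolding u(2) by (metis (mono_tags, lifting) mem_Collect_eq rangeE)
  have Np: "norm (N p) = 1" using normal_unit[OF u(1)] u(2) by simp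
  \<comment> \<open>a multiple of the identity cannot agree with a radial part on the tangent plane\<close>
  have mixed: False if "w \<noteq> 0" "N p \<bullet> w = 0" and e: "\<And>x. N p \<bullet> x = 0 \<Longrightarrow> k *\<^sub>R x = 2 *\<^sub>R radial_part w x" for k w
  proof -
    let ?y = "cross3 (N p) w"
    have "?y \<noteq> 0" using norm_and_cross_eq_0[of "N p" w] that Np by auto
    moreover have "k *\<^sub>R w = 0" using e[OF that(2)] by simp
    moreover have "k *\<^sub>R ?y = 2 *\<^sub>R ?y" using e[of ?y] by (simp add: dot_cross_self radial_part_orthogonal)
    ultimately show False using that(1) by auto
  qed
  consider (ss) k k' where "L = (\<lambda>x. k *\<^sub>R x)" "L' = (\<lambda>x. k' *\<^sub>R x)"
    | (sr) k w where "L = (\<lambda>x. k *\<^sub>R x)" "w \<noteq> 0" "N p \<bullet> w = 0" "L' = (\<lambda>x. 2 *\<^sub>R radial_part w x)"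
    | (rs) k w where "L' = (\<lambda>x. k *\<^sub>R x)" "w \<noteq> 0" "N p \<bullet> w = 0" "L = (\<lambda>x. 2 *\<^sub>R radial_part w x)"
    | (rr) w w' where "w \<noteq> 0" "N p \<bullet> w = 0" "L = (\<lambda>x. 2 *\<^sub>R radial_part w x)"
        "w' \<noteq> 0" "N p \<bullet> w' = 0" "L' = (\<lambda>x. 2 *\<^sub>R radial_part w' x)"
    using alt alt' by metis
  then show ?thesis
  proof cases
    case ss
    have "D u (axis 1 1) \<noteq> 0" using D_inj[OF u(1)] by (metis axis_eq_0_iff zero_neq_one)
    moreover have "k *\<^sub>R D u (axis 1 1) = k' *\<^sub>R D u (axis 1 1)"
      using eq[of "D u (axis 1 1)"] normal_D[OF u(1)] u(2) ss by simp
    ultimately show ?thesis using ss by simp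
  next
    case sr
    then show ?thesis using mixed[of w k] eq by auto
  next
    case rs
    then show ?thesis using mixed[of w k] eq by auto
  next
    case rr
    have "radial_part w' w = 0" using eq[of w] rr by simp
    then have w: "w = ((w \<bullet> w') / (w' \<bullet> w')) *\<^sub>R w'" by (simp add: radial_part_def)
    then have "(w \<bullet> w') / (w' \<bullet> w') \<noteq> 0" using rr(1) by (metis scaleR_zero_left)
    then have "radial_part w = radial_part w'" by (subst w) (rule radial_part_scale)
    then show ?thesis using rr by simp
  qed
qed

text \<open>By uniqueness \<open>L\<close> is a locally constant function of the point, and then so is \<open>L X + r N\<close>; connectedness makes
  both of them constant.\<close>

lemma constant_speed_imp_affine_normal:
  assumes S: "C2_surface S" "S \<noteq> {}" "connected S" and N: "unit_normal_field S N" and r: "r \<noteq> 0"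
    and const: "constant_speed S N r"
  obtains L K where "\<And>x. x \<in> S \<Longrightarrow> L x + r *\<^sub>R N x = K"
    "(\<exists>k. L = (\<lambda>x. k *\<^sub>R x)) \<or> (\<exists>w. w \<noteq> 0 \<and> (\<forall>x\<in>S. N x \<bullet> w = 0) \<and> L = (\<lambda>x. 2 *\<^sub>R radial_part w x))"
proof -
  note ex = constant_speed_imp_affine_normal_near[OF S(1) N r const]
  define f where "f = (\<lambda>p. SOME L. affine_normal_near S N r L p)"
  have f: "affine_normal_near S N r (f p) p" if "p \<in> S" for p
    unfolding f_def using ex[OF that] by (metis someI)
  have "f constant_on S"
  proof (rule locally_constant_imp_constant[OF S(3)])
    fix a assume a: "a \<in> S"
    obtain W K where W: "openin (top_of_set S) W" "a \<in> W" and K: "\<forall>x\<in>W. f a x + r *\<^sub>R N x = K"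
      "(\<exists>k. f a = (\<lambda>x. k *\<^sub>R x)) \<or> (\<exists>w. w \<noteq> 0 \<and> (\<forall>x\<in>W. N x \<bullet> w = 0) \<and> f a = (\<lambda>x. 2 *\<^sub>R radial_part w x))"
      using f[OF a] unfolding affine_normal_near_def by blast
    have "f x = f a" if x: "x \<in> W" for x
    proof (rule affine_normal_near_unique[OF S(1) N])
      show xS: "x \<in> S" using x W openin_subset by fastforce
      show "affine_normal_near S N r (f x) x" by (rule f[OF xS])
      show "affine_normal_near S N r (f a) x" unfolding affine_normal_near_def using W(1) K x by blast
    qed
    then show "\<exists>T. openin (top_of_set S) T \<and> a \<in> T \<and> (\<forall>x\<in>T. f x = f a)" using W by blast
  qed
  then obtain L where "\<And>p. p \<in> S \<Longrightarrow> f p = L" unfolding constant_on_def by blast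
  then have L: "affine_normal_near S N r L p" if "p \<in> S" for p using f[OF that] that by simp
  have "(\<lambda>x. L x + r *\<^sub>R N x) constant_on S"
  proof (rule locally_constant_imp_constant[OF S(3)])
    fix a assume "a \<in> S"
    then obtain W K where "openin (top_of_set S) W" "a \<in> W" "\<forall>x\<in>W. L x + r *\<^sub>R N x = K"
      using L unfolding affine_normal_near_def by blast
    then show "\<exists>T. openin (top_of_set S) T \<and> a \<in> T \<and> (\<forall>x\<in>T. L x + r *\<^sub>R N x = L a + r *\<^sub>R N a)"
      by (intro exI[of _ W]) auto
  qed
  then obtain K where K: "\<And>x. x \<in> S \<Longrightarrow> L x + r *\<^sub>R N x = K" unfolding constant_on_def by blast
  obtain p where p: "p \<in> S" using S(2) by blast
  have "(\<exists>k. L = (\<lambda>x. k *\<^sub>R x)) \<or> (\<exists>w. w \<noteq> 0 \<and> N p \<bullet> w = 0 \<and> L = (\<lambda>x. 2 *\<^sub>R radial_part w x))"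
    using L[OF p] unfolding affine_normal_near_def by blast
  then have "(\<exists>k. L = (\<lambda>x. k *\<^sub>R x)) \<or> (\<exists>w. w \<noteq> 0 \<and> (\<forall>x\<in>S. N x \<bullet> w = 0) \<and> L = (\<lambda>x. 2 *\<^sub>R radial_part w x))"
  proof (elim disj_forward exE conjE)
    fix w assume w: "w \<noteq> 0" "N p \<bullet> w = 0" "L = (\<lambda>x. 2 *\<^sub>R radial_part w x)"
    have "r * (N x \<bullet> w) = K \<bullet> w" if "x \<in> S" for x
      using arg_cong[OF K[OF that], of "\<lambda>y. y \<bullet> w"] radial_part_inner[OF w(1)] by (simp add: w(3) inner_add_left)
    then have "N x \<bullet> w = 0" if "x \<in> S" for x using r w(2) p that by (metis mult_eq_0_iff)
    then show "\<exists>w. w \<noteq> 0 \<and> (\<forall>x\<in>S. N x \<bullet> w = 0) \<and> L = (\<lambda>x. 2 *\<^sub>R radial_part w x)" using w by blast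
  qed blast
  then show ?thesis by (rule that[rotated]) (rule K)
qed

section \<open>From affine normals to the model surfaces\<close>

text \<open>Pythagoras, with the foot of the perpendicular as the nearest point.\<close>

lemma infdist_axis_line:
  fixes x :: "real^3"
  assumes u: "u \<noteq> 0"
  shows "infdist x (axis_line a u) = norm (radial_part u (x - a))"
proof (rule antisym)
  let ?t = "((x - a) \<bullet> u) / (u \<bullet> u)"
  have "infdist x (axis_line a u) \<le> dist x (a + ?t *\<^sub>R u)"
    by (rule infdist_le) (auto simp: axis_line_def)
  then show "infdist x (axis_line a u) \<le> norm (radial_part u (x - a))"
    by (simp add: radial_part_def dist_norm algebra_simps)
  have "norm (radial_part u (x - a)) \<le> dist x y" if y_in: "y \<in> axis_line a u" for y
  proof -
    obtain s where y: "y = a + s *\<^sub>R u" using y_in by (auto simp: axis_line_def)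
    have eq: "x - y = radial_part u (x - a) + (?t - s) *\<^sub>R u" by (simp add: y radial_part_def algebra_simps)
    have "(norm (x - y))\<^sup>2 = (norm (radial_part u (x - a)))\<^sup>2 + (norm ((?t - s) *\<^sub>R u))\<^sup>2"
      unfolding eq by (rule norm_add_Pythagorean) (simp add: orthogonal_def radial_part_inner[OF u])
    then have "(norm (radial_part u (x - a)))\<^sup>2 \<le> (norm (x - y))\<^sup>2" by simp
    then show ?thesis by (simp add: dist_norm power_mono_iff)
  qed
  then show "norm (radial_part u (x - a)) \<le> infdist x (axis_line a u)"
    unfolding infdist_def by (auto simp: axis_line_def intro!: cINF_greatest)
qed

lemma mem_circular_cylinder:
  "u \<noteq> 0 \<Longrightarrow> x \<in> circular_cylinder a u R \<longleftrightarrow> norm (radial_part u (x - a)) = R"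
  by (simp add: circular_cylinder_def infdist_axis_line)

lemma constant_normal_imp_plane:
  assumes S: "C2_surface S" "S \<noteq> {}" "connected S" and N: "unit_normal_field S N"
    and const: "\<And>x. x \<in> S \<Longrightarrow> N x = n"
  obtains a where "n \<noteq> 0" "S \<subseteq> plane_through a n"
proof -
  have "(\<lambda>x. n \<bullet> x) constant_on S"
  proof (rule locally_constant_imp_constant[OF S(3)])
    fix p assume p: "p \<in> S"
    obtain B X D D2 n' u where patch: "surface_patch S N B X D D2 n'" and u: "u \<in> B" "X u = p"
      using surface_patch_exists[OF S(1) N p] .
    interpret surface_patch S N B X D D2 n' by (rule patch)
    have der: "((\<lambda>x. n \<bullet> X x) has_derivative (\<lambda>v. 0)) (at x within B)" if x: "x \<in> B" for x
    proof -
      have "((\<lambda>x. n \<bullet> X x) has_derivative (\<lambda>v. n \<bullet> D x v)) (at x)" by (rule has_derivative_inner_right[OF X[OF x]])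
      then show ?thesis using normal_D[OF x] const[OF X_in[OF x]] by (simp add: has_derivative_at_withinI)
    qed
    have "n \<bullet> X x = n \<bullet> X u" if "x \<in> B" for x
      by (rule has_derivative_zero_unique[OF convex_B der that u(1)])
    then show "\<exists>T. openin (top_of_set S) T \<and> p \<in> T \<and> (\<forall>x\<in>T. n \<bullet> x = n \<bullet> p)"
      using open_image[OF order_refl open_B] u by (intro exI[of _ "X ` B"]) auto
  qed
  then obtain k where k: "\<And>x. x \<in> S \<Longrightarrow> n \<bullet> x = k" unfolding constant_on_def by blast
  obtain a where a: "a \<in> S" using S(2) by blast
  have "norm n = 1" using N const[OF a] a unfolding unit_normal_field_def by force
  then have "n \<noteq> 0" by auto
  moreover have "S \<subseteq> plane_through a n" using k a by (auto simp: plane_through_def inner_diff_right)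
  ultimately show ?thesis by (rule that)
qed

text \<open>Reading \<open>L x + r N x = K\<close> as an equation for \<open>x\<close> and using \<open>|N| = 1\<close> gives the distance of \<open>x\<close> from the
  point \<open>K / k\<close>, or from the axis through \<open>K / 2\<close>; for \<open>L = 0\<close> the normal is constant.\<close>

lemma affine_normal_imp_model:
  assumes S: "C2_surface S" "S \<noteq> {}" "connected S" and N: "unit_normal_field S N" and r: "r \<noteq> 0"
    and K: "\<And>x. x \<in> S \<Longrightarrow> L x + r *\<^sub>R N x = K"
    and alt: "(\<exists>k. L = (\<lambda>x. k *\<^sub>R x)) \<or> (\<exists>w. w \<noteq> 0 \<and> (\<forall>x\<in>S. N x \<bullet> w = 0) \<and> L = (\<lambda>x. 2 *\<^sub>R radial_part w x))"
  shows "(\<exists>a n. n \<noteq> 0 \<and> S \<subseteq> plane_through a n) \<or>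
         (\<exists>a u R. u \<noteq> 0 \<and> R > 0 \<and> S \<subseteq> circular_cylinder a u R) \<or>
         (\<exists>a R. R > 0 \<and> S \<subseteq> sphere a R)"
proof -
  have unit: "norm (N x) = 1" if "x \<in> S" for x using N that unfolding unit_normal_field_def by blast
  consider (flat) "L = (\<lambda>x. 0)" | (scalar) k where "k \<noteq> 0" "L = (\<lambda>x. k *\<^sub>R x)"
    | (radial) w where "w \<noteq> 0" "\<And>x. x \<in> S \<Longrightarrow> N x \<bullet> w = 0" "L = (\<lambda>x. 2 *\<^sub>R radial_part w x)"
    using alt by (metis scaleR_zero_left)
  then show ?thesis
  proof cases
    case flat
    have "N x = inverse r *\<^sub>R K" if "x \<in> S" for x using K[OF that] r flat by auto
    from constant_normal_imp_plane[OF S N this] show ?thesis by metis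
  next
    case scalar
    have "dist (inverse k *\<^sub>R K) x = \<bar>r / k\<bar>" if x: "x \<in> S" for x
    proof -
      have "inverse k *\<^sub>R K - x = (r / k) *\<^sub>R N x"
        unfolding K[OF x, symmetric] using scalar by (simp add: scaleR_add_right field_simps)
      then show ?thesis using unit[OF x] by (simp add: dist_norm)
    qed
    moreover have "\<bar>r / k\<bar> > 0" using r scalar by simp
    ultimately show ?thesis by (metis mem_sphere subsetI)
  next
    case radial
    obtain p where p: "p \<in> S" using S(2) by blast
    have "K \<bullet> w = 0" using K[OF p] radial(2)[OF p] radial_part_inner[OF radial(1)]
      by (auto simp: radial(3) inner_add_left)
    have "x \<in> circular_cylinder ((1/2) *\<^sub>R K) w (\<bar>r\<bar> / 2)" if x: "x \<in> S" for x
    proof -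
      have "radial_part w (x - (1/2) *\<^sub>R K) = radial_part w x - (1/2) *\<^sub>R K"
        using \<open>K \<bullet> w = 0\<close> by (simp add: radial_part_def inner_diff_left)
      also have "\<dots> = (- r / 2) *\<^sub>R N x"
        unfolding K[OF x, symmetric] radial(3) by (simp add: scaleR_add_right)
      finally show ?thesis using unit[OF x] by (simp add: mem_circular_cylinder[OF radial(1)])
    qed
    moreover have "\<bar>r\<bar> / 2 > 0" using r by simp
    ultimately show ?thesis using radial(1) by blast
  qed
qed

section \<open>Existence of rollings\<close>

text \<open>Tangent vectors come from curves on open intervals, so the end points of \<open>\<gamma>\<close> are reached by continuity.\<close>

lemma unit_speed_curve_orthogonal_normal:
  assumes N: "unit_normal_field S N" and l: "l > 0" and \<gamma>: "unit_speed_curve S l \<gamma>"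
    and \<gamma>': "\<And>t. t \<in> {0..l} \<Longrightarrow> (\<gamma> has_vector_derivative \<gamma>' t) (at t within {0..l})"
    and t: "t \<in> {0..l}"
  shows "N (\<gamma> t) \<bullet> \<gamma>' t = 0"
proof -
  have C2: "C2_on {0..l} \<gamma>" and \<gamma>S: "\<gamma> ` {0..l} \<subseteq> S" using \<gamma> by (auto simp: unit_speed_curve_def)
  obtain d where d: "\<And>t. t \<in> {0..l} \<Longrightarrow> (\<gamma> has_vector_derivative d t) (at t within {0..l})" and C1d: "C1_on {0..l} d"
    using C2 unfolding C2_on_real_iff by blast
  obtain d2 where d2: "\<And>t. t \<in> {0..l} \<Longrightarrow> (d has_vector_derivative d2 t) (at t within {0..l})" "continuous_on {0..l} d2"
    using C1d unfolding C1_on_real_iff by blast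
  have \<gamma>'d: "\<gamma>' t = d t" if "t \<in> {0..l}" for t
    using vector_derivative_within_closed_interval[OF l that \<gamma>'[OF that]]
      vector_derivative_within_closed_interval[OF l that d[OF that]] by simp
  have cont\<gamma>: "continuous_on {0..l} \<gamma>"
    using d by (meson continuous_on_eq_continuous_within has_vector_derivative_continuous)
  have interior: "N (\<gamma> t) \<bullet> d t = 0" if t: "t \<in> {0<..<l}" for t
  proof -
    define e where "e = min t (l - t)"
    have e: "e > 0" "\<And>s. s \<in> {-e<..<e} \<Longrightarrow> t + s \<in> {0<..<l}" using t by (auto simp: e_def)
    have shift: "((\<lambda>s. f (t + s)) has_vector_derivative f') (at s)"
      if "s \<in> {-e<..<e}" and f: "(f has_vector_derivative f') (at (t + s) within {0..l})" for f :: "real \<Rightarrow> real^3" and f' s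
    proof -
      have "(f has_vector_derivative f') (at (t + s))"
        using f e(2)[OF that(1)] by (simp add: at_within_Icc_at)
      moreover have "((\<lambda>s. t + s) has_vector_derivative 1) (at s)" by (auto intro!: derivative_eq_intros)
      ultimately show ?thesis using has_vector_derivative_compose_real by fastforce
    qed
    have in_l: "t + s \<in> {0..l}" if "s \<in> {-e<..<e}" for s using e(2)[OF that] by simp
    have C2s: "C2_on {-e<..<e} (\<lambda>s. \<gamma> (t + s))"
      unfolding C2_on_real_iff C1_on_real_iff
    proof (intro exI conjI ballI)
      fix s assume s: "s \<in> {-e<..<e}"
      show "((\<lambda>s. \<gamma> (t + s)) has_vector_derivative d (t + s)) (at s within {-e<..<e})"
        by (rule has_vector_derivative_at_within[OF shift[OF s d[OF in_l[OF s]]]])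
      show "((\<lambda>s. d (t + s)) has_vector_derivative d2 (t + s)) (at s within {-e<..<e})"
        by (rule has_vector_derivative_at_within[OF shift[OF s d2(1)[OF in_l[OF s]]]])
    next
      show "continuous_on {-e<..<e} (\<lambda>s. d2 (t + s))"
        by (rule continuous_on_compose2[OF d2(2), of _ "\<lambda>s. t + s"])
          (use in_l in \<open>auto intro!: continuous_intros\<close>)
    qed
    have "d t \<in> tangent_plane S (\<gamma> t)" unfolding tangent_plane_def
    proof (intro CollectI exI[of _ e] exI[of _ "\<lambda>s. \<gamma> (t + s)"] conjI)
      show "(\<lambda>s. \<gamma> (t + s)) ` {-e<..<e} \<subseteq> S" using \<gamma>S in_l by blast
      show "((\<lambda>s. \<gamma> (t + s)) has_vector_derivative d t) (at 0)" using shift[of 0 \<gamma>] d[of t] e t by simp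
    qed (use e C2s in auto)
    moreover have "\<gamma> t \<in> S" using \<gamma>S t by auto
    ultimately show ?thesis using N unfolding unit_normal_field_def by blast
  qed
  have "continuous_on {0..l} (\<lambda>t. N (\<gamma> t))"
    using N unfolding unit_normal_field_def by (intro continuous_on_compose2[OF _ cont\<gamma> \<gamma>S]) blast
  then have "continuous_on (closure {0<..<l}) (\<lambda>t. N (\<gamma> t) \<bullet> d t)"
    using C1_on_imp_continuous_on[OF C1d] l by (simp add: continuous_intros)
  then have "N (\<gamma> t) \<bullet> d t = 0"
    by (rule continuous_constant_on_closure) (use interior t l in auto)
  then show ?thesis using \<gamma>'d[OF t] by simp
qed

definition cross_matrix :: "real^3 \<Rightarrow> real^3^3" where
  "cross_matrix w = matrix (cross3 w)"

lemma cross_matrix_apply: "cross_matrix w *v x = cross3 w x"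
proof -
  have "linear (cross3 w)" using bilinear_cross unfolding bilinear_def by blast
  then show ?thesis by (simp add: cross_matrix_def)
qed

lemma cross3_eq_zero_all:
  assumes "\<And>x. cross3 w x = 0" shows "w = 0"
  using assms[of "axis 1 1"] assms[of "axis 2 1"]
  unfolding vec_eq_iff forall_3 cross3_def vec_lambda_beta vector_3 axis_def by simp

lemma bounded_bilinear_cross_matrix_mult: "bounded_bilinear (\<lambda>w (M::real^3^3). cross_matrix w ** M)"
  unfolding bilinear_conv_bounded_bilinear[symmetric] bilinear_def
proof (intro conjI allI linearI)
  have add: "cross_matrix (v + w) = cross_matrix v + cross_matrix w" for v w
    by (simp add: cross_matrix_def matrix_def cross_add_left vec_eq_iff)
  have scale: "cross_matrix (c *\<^sub>R w) = c *\<^sub>R cross_matrix w" for c w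
    by (simp add: cross_matrix_def matrix_def cross_mult_left vec_eq_iff)
  show "cross_matrix (v + w) ** M = cross_matrix v ** M + cross_matrix w ** M" for v w and M :: "real^3^3"
    by (simp add: add matrix_matrix_mult_def vec_eq_iff distrib_right sum.distrib)
  show "cross_matrix (c *\<^sub>R w) ** M = c *\<^sub>R (cross_matrix w ** M)" for c w and M :: "real^3^3"
    by (simp add: scale matrix_matrix_mult_def vec_eq_iff sum_distrib_left mult_ac)
  show "cross_matrix w ** (M + M') = cross_matrix w ** M + cross_matrix w ** M'" for w and M M' :: "real^3^3"
    by (simp add: matrix_matrix_mult_def vec_eq_iff algebra_simps sum.distrib)
  show "cross_matrix w ** (c *\<^sub>R M) = c *\<^sub>R (cross_matrix w ** M)" for c w and M :: "real^3^3"
    by (simp add: matrix_matrix_mult_def vec_eq_iff sum_distrib_left mult_ac)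
qed

text \<open>The solution of \<open>A' = [\<omega>] A\<close> preserves lengths because \<open>\<omega> \<times> y\<close> is orthogonal to \<open>y\<close>, and its determinant is a
  continuous function with values \<open>1\<close> and \<open>-1\<close>.\<close>

lemma rotation_with_angular_velocity:
  assumes l: "l > 0" and cont: "continuous_on {0..l} \<omega>"
  obtains e A where "0 < e" "e \<le> l" "A 0 = mat 1"
    "\<And>t. t \<in> {0..e} \<Longrightarrow> (A has_vector_derivative cross_matrix (\<omega> t) ** A t) (at t within {0..e})"
    "\<And>t. t \<in> {0..e} \<Longrightarrow> rotation_matrix (A t)"
proof -
  interpret cm: bounded_bilinear "\<lambda>w (M::real^3^3). cross_matrix w ** M"
    by (rule bounded_bilinear_cross_matrix_mult)
  define L where "L = (\<lambda>t. Blinfun (\<lambda>M::real^3^3. cross_matrix (\<omega> t) ** M))"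
  have L: "L t M = cross_matrix (\<omega> t) ** M" for t M
    by (simp add: L_def bounded_linear_Blinfun_apply cm.bounded_linear_right)
  have "continuous_on {0..l} L"
    by (rule continuous_on_blinfun_componentwise) (simp add: L cm.continuous_on[OF cont] continuous_intros)
  then obtain e A where e: "0 < e" "e \<le> l" and A0: "A 0 = mat 1"
    and A: "\<And>t. t \<in> {0..e} \<Longrightarrow> (A has_vector_derivative L t (A t)) (at t within {0..e})"
    using linear_ode_local_solution[OF _ l] by blast
  have A: "(A has_vector_derivative cross_matrix (\<omega> t) ** A t) (at t within {0..e})" if "t \<in> {0..e}" for t
    using A[OF that] by (simp add: L)
  have contA: "continuous_on {0..e} A"
    using A by (meson continuous_on_eq_continuous_within has_vector_derivative_continuous)
  have Ax: "((\<lambda>s. A s *v x) has_vector_derivative cross3 (\<omega> t) (A t *v x)) (at t within {0..e})" if "t \<in> {0..e}" for t x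
    using bounded_linear.has_vector_derivative[OF bounded_bilinear.bounded_linear_left[OF bounded_bilinear_matrix_vector_mult] A[OF that], of x]
    by (simp add: cross_matrix_apply flip: matrix_vector_mul_assoc)
  have norm: "norm (A t *v x) = norm x" if t: "t \<in> {0..e}" for t x
  proof -
    have "((\<lambda>s. (A s *v x) \<bullet> (A s *v x)) has_vector_derivative 0) (at s within {0..e})" if "s \<in> {0..e}" for s
      using bounded_bilinear.has_vector_derivative[OF bounded_bilinear_inner Ax[OF that] Ax[OF that], of x x]
      by (simp add: dot_cross_self)
    then obtain k where k: "\<And>s. s \<in> {0..e} \<Longrightarrow> (A s *v x) \<bullet> (A s *v x) = k"
      by (rule has_vector_derivative_zero_constant[OF convex_real_interval(5)]; blast)
    have "(A t *v x) \<bullet> (A t *v x) = x \<bullet> x" using k[OF t] k[of 0] e by (simp add: A0)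
    then show ?thesis by (simp add: norm_eq)
  qed
  have orth: "orthogonal_matrix (A t)" if "t \<in> {0..e}" for t
  proof -
    have "orthogonal_transformation ((*v) (A t))" using norm[OF that] by (simp add: orthogonal_transformation)
    then show ?thesis by (simp add: orthogonal_transformation_matrix)
  qed
  have "(\<lambda>t. det (A t)) constant_on {0..e}"
  proof (rule continuous_finite_range_constant)
    show "continuous_on {0..e} (\<lambda>t. det (A t))" unfolding det_3 using contA by (intro continuous_intros)
    have "(\<lambda>t. det (A t)) ` {0..e} \<subseteq> {1, -1}" using det_orthogonal_matrix[OF orth] by blast
    then show "finite ((\<lambda>t. det (A t)) ` {0..e})" by (rule finite_subset) simp
  qed auto
  then have "det (A t) = 1" if "t \<in> {0..e}" for t
    using that e A0 unfolding constant_on_def by (metis atLeastAtMost_iff det_I less_eq_real_def order_refl)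
  then show ?thesis using that[of e A] e A0 A orth by (auto simp: rotation_matrix_def)
qed

text \<open>The centre has to follow \<open>T \<circ> \<gamma> + K\<close>. A rotation about the contact point with tangential angular velocity \<open>\<omega>\<close>
  moves the centre with velocity \<open>\<omega> \<times> r N\<close>, so \<open>\<omega> = N \<times> (T \<circ> \<gamma>)' / r\<close>. Integrating \<open>\<omega>\<close> gives the rotations, and
  the translations are then fixed by the path of the centre. The speed is \<open>|T \<gamma>'| = c\<close>.\<close>

lemma affine_normal_imp_constant_speed:
  assumes S: "C2_surface S" and N: "unit_normal_field S N" and r: "r \<noteq> 0"
    and T: "linear T" and c: "c > 0" and norm: "\<And>x. norm (T x) = c * norm x"
    and K: "\<And>x. x \<in> S \<Longrightarrow> x + r *\<^sub>R N x = T x + K"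
  shows "constant_speed S N r"
  unfolding constant_speed_def
proof (rule exI[of _ c], intro ballI allI impI)
  fix p l \<gamma> assume l: "(0::real) < l" and "unit_speed_curve S l \<gamma> \<and> \<gamma> 0 = p"
  then have \<gamma>: "unit_speed_curve S l \<gamma>" and p: "\<gamma> 0 = p" by auto
  have C2: "C2_on {0..l} \<gamma>" and \<gamma>S: "\<And>t. t \<in> {0..l} \<Longrightarrow> \<gamma> t \<in> S" using \<gamma> by (auto simp: unit_speed_curve_def)
  obtain d where d: "\<And>t. t \<in> {0..l} \<Longrightarrow> (\<gamma> has_vector_derivative d t) (at t within {0..l})" and C1d: "C1_on {0..l} d"
    using C2 unfolding C2_on_real_iff by blast
  have blT: "bounded_linear T" using T by (simp add: linear_conv_bounded_linear)
  have contd: "continuous_on {0..l} d" by (rule C1_on_imp_continuous_on[OF C1d])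
  have cont\<gamma>: "continuous_on {0..l} \<gamma>"
    using d by (meson continuous_on_eq_continuous_within has_vector_derivative_continuous)
  have nd: "norm (d t) = 1" if "t \<in> {0..l}" for t
    using \<gamma> that vector_derivative_within_closed_interval[OF l that d[OF that]]
    unfolding unit_speed_curve_def by metis
  have NN: "N (\<gamma> t) \<bullet> N (\<gamma> t) = 1" if "t \<in> {0..l}" for t
    using N \<gamma>S[OF that] unfolding unit_normal_field_def by (simp add: norm_eq_1)
  have N\<gamma>: "r *\<^sub>R N (\<gamma> t) = T (\<gamma> t) + K - \<gamma> t" if "t \<in> {0..l}" for t
    using K[OF \<gamma>S[OF that]] by (simp add: algebra_simps)
  have Nd: "N (\<gamma> t) \<bullet> d t = 0" if "t \<in> {0..l}" for t
    by (rule unit_speed_curve_orthogonal_normal[OF N l \<gamma> d that])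
  \<comment> \<open>the centre \<open>T \<circ> \<gamma> + K\<close> moves tangentially\<close>
  have NTd: "N (\<gamma> t) \<bullet> T (d t) = 0" if t: "t \<in> {0..l}" for t
  proof -
    let ?w = "\<lambda>t. T (\<gamma> t) + K - \<gamma> t"
    have "(?w has_vector_derivative T (d t) + 0 - d t) (at t within {0..l})"
      by (intro has_vector_derivative_diff has_vector_derivative_add has_vector_derivative_const
          bounded_linear.has_vector_derivative[OF blT] d t)
    then have w: "(?w has_vector_derivative T (d t) - d t) (at t within {0..l})" by simp
    have 1: "((\<lambda>t. ?w t \<bullet> ?w t) has_vector_derivative ?w t \<bullet> (T (d t) - d t) + (T (d t) - d t) \<bullet> ?w t) (at t within {0..l})"
      by (rule bounded_bilinear.has_vector_derivative[OF bounded_bilinear_inner w w])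
    have 2: "((\<lambda>t. ?w t \<bullet> ?w t) has_vector_derivative 0) (at t within {0..l})"
      by (rule has_vector_derivative_transform[OF t _ has_vector_derivative_const[of "r\<^sup>2"]])
        (use NN N\<gamma> in \<open>simp add: power2_eq_square flip: N\<gamma>\<close>)
    have "?w t \<bullet> (T (d t) - d t) + (T (d t) - d t) \<bullet> ?w t = 0"
      using vector_derivative_within_closed_interval[OF l t 1]
        vector_derivative_within_closed_interval[OF l t 2] by (rule trans[OF sym])
    then have "?w t \<bullet> (T (d t) - d t) = 0" by (simp add: inner_commute)
    then have "r *\<^sub>R N (\<gamma> t) \<bullet> (T (d t) - d t) = 0" using N\<gamma>[OF t] by simp
    then show ?thesis using r Nd[OF t] by (simp add: inner_diff_right)
  qed
  have contN: "continuous_on {0..l} (\<lambda>t. N (\<gamma> t))"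
    using N \<gamma>S unfolding unit_normal_field_def by (intro continuous_on_compose2[OF _ cont\<gamma>]) auto
  define \<omega> where "\<omega> = (\<lambda>t. inverse r *\<^sub>R cross3 (N (\<gamma> t)) (T (d t)))"
  have "continuous_on {0..l} \<omega>" unfolding \<omega>_def
    by (intro continuous_intros continuous_on_cross contN bounded_linear.continuous_on[OF blT] contd)
  then obtain e A where e: "0 < e" "e \<le> l" and A0: "A 0 = mat 1"
    and A: "\<And>t. t \<in> {0..e} \<Longrightarrow> (A has_vector_derivative cross_matrix (\<omega> t) ** A t) (at t within {0..e})"
    and rot: "\<And>t. t \<in> {0..e} \<Longrightarrow> rotation_matrix (A t)"
    using rotation_with_angular_velocity[OF l] by metis
  have sub: "t \<in> {0..l}" if "t \<in> {0..e}" for t using that e by auto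
  let ?p = "ball_center N r p"
  define q where "q = (\<lambda>t. T (\<gamma> t) + K)"
  define b where "b = (\<lambda>t. q t - A t *v ?p)"
  have q_eq: "q t = \<gamma> t + r *\<^sub>R N (\<gamma> t)" if "t \<in> {0..e}" for t
    using K[OF \<gamma>S[OF sub[OF that]]] by (simp add: q_def)
  have q0: "q 0 = ?p" using q_eq[of 0] e by (simp add: ball_center_def p)
  have q': "(q has_vector_derivative T (d t)) (at t within {0..e})" if t: "t \<in> {0..e}" for t
  proof -
    have "(\<gamma> has_vector_derivative d t) (at t within {0..e})"
      by (rule has_vector_derivative_within_subset[OF d[OF sub[OF t]]]) (use e in auto)
    from has_vector_derivative_add[OF bounded_linear.has_vector_derivative[OF blT this] has_vector_derivative_const[of K]]
    show ?thesis by (simp add: q_def)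
  qed
  have b': "(b has_vector_derivative T (d t) - cross3 (\<omega> t) (A t *v ?p)) (at t within {0..e})" if t: "t \<in> {0..e}" for t
    unfolding b_def
    using has_vector_derivative_diff[OF q'[OF t] bounded_linear.has_vector_derivative[OF
          bounded_bilinear.bounded_linear_left[OF bounded_bilinear_matrix_vector_mult] A[OF t], of ?p]]
    by (simp add: cross_matrix_apply flip: matrix_vector_mul_assoc)
  have cont: "continuous_on {0..e} A" "continuous_on {0..e} d" "continuous_on {0..e} \<omega>"
    using A \<open>continuous_on {0..l} \<omega>\<close> contd e
    by (meson continuous_on_eq_continuous_within has_vector_derivative_continuous, auto intro: continuous_on_subset)
  have center: "affine_family A b t ?p = q t" for t by (simp add: affine_family_def b_def)
  have tan: "tangent_plane S (\<gamma> t) = {v. N (\<gamma> t) \<bullet> v = 0}" if "t \<in> {0..e}" for t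
    by (rule tangent_plane_eq_normal_hyperplane[OF S N \<gamma>S[OF sub[OF that]]])
  have spin: "spin_matrix e A t = cross_matrix (\<omega> t)" if t: "t \<in> {0..e}" for t
    unfolding spin_matrix_def vector_derivative_within_closed_interval[OF e(1) t A[OF t]]
    using rot[OF t] by (simp add: rotation_matrix_def orthogonal_matrix_def flip: matrix_mul_assoc)
  have \<omega>N: "cross3 (\<omega> t) (r *\<^sub>R N (\<gamma> t)) = T (d t)" if t: "t \<in> {0..e}" for t
  proof -
    have "cross3 (\<omega> t) (r *\<^sub>R N (\<gamma> t)) = cross3 (cross3 (N (\<gamma> t)) (T (d t))) (N (\<gamma> t))"
      using r by (simp add: \<omega>_def cross_mult_left cross_mult_right)
    also have "\<dots> = - cross3 (N (\<gamma> t)) (cross3 (N (\<gamma> t)) (T (d t)))" by (rule cross_skew)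
    also have "\<dots> = T (d t)" unfolding Lagrange using NTd[OF sub[OF t]] NN[OF sub[OF t]] by simp
    finally show ?thesis .
  qed
  have Td: "norm (T (d t)) = c" if "t \<in> {0..e}" for t using norm[of "d t"] nd[OF sub[OF that]] by simp
  have "rolling S N r e \<gamma> A b" unfolding rolling_def p
  proof (intro conjI ballI)
    show "motion_on (sphere ?p \<bar>r\<bar>) S e \<gamma> A b" unfolding motion_on_def
    proof (intro conjI ballI)
      show "C1_on {0..e} A" unfolding C1_on_real_iff using A
        by (intro exI[of _ "\<lambda>t. cross_matrix (\<omega> t) ** A t"] conjI ballI
            bounded_bilinear.continuous_on[OF bounded_bilinear_cross_matrix_mult] cont)
      show "C1_on {0..e} b" unfolding C1_on_real_iff using b'
        by (intro exI[of _ "\<lambda>t. T (d t) - cross3 (\<omega> t) (A t *v ?p)"] conjI ballI continuous_intros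
            bounded_linear.continuous_on[OF blT] continuous_on_cross cont
            bounded_bilinear.continuous_on[OF bounded_bilinear_matrix_vector_mult])
      show "affine_family A b 0 = id" by (rule ext) (simp add: affine_family_def b_def A0 q0)
      fix t assume t: "t \<in> {0..e}"
      show "rotation_matrix (A t)" by (rule rot[OF t])
      have diff: "\<gamma> t - q t = - r *\<^sub>R N (\<gamma> t)" using q_eq[OF t] by simp
      then have nr: "norm (\<gamma> t - q t) = \<bar>r\<bar>" using NN[OF sub[OF t]] by (simp add: norm_eq_sqrt_inner)
      show "tangent_at (affine_family A b t ` sphere ?p \<bar>r\<bar>) S (\<gamma> t)"
        unfolding image_sphere_affine_family[where A=A and t=t, OF rot[OF t]] center tangent_at_def
      proof (intro conjI)
        show "\<gamma> t \<in> sphere (q t) \<bar>r\<bar>" using nr by (simp add: dist_norm norm_minus_commute)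
        show "\<gamma> t \<in> S" by (rule \<gamma>S[OF sub[OF t]])
        have "\<bar>r\<bar> > 0" using r by simp
        then show "tangent_plane (sphere (q t) \<bar>r\<bar>) (\<gamma> t) = tangent_plane S (\<gamma> t)"
          unfolding tan[OF t] tangent_plane_sphere[OF nr \<open>\<bar>r\<bar> > 0\<close>] diff using r by simp
      qed
    qed
    show "rotational e \<gamma> A b" unfolding rotational_def
    proof (intro ballI conjI)
      fix t assume t: "t \<in> {0..e}"
      show "spin_matrix e A t \<noteq> 0"
      proof
        assume "spin_matrix e A t = 0"
        then have "cross3 (\<omega> t) (r *\<^sub>R N (\<gamma> t)) = 0" by (simp add: spin[OF t] flip: cross_matrix_apply)
        then show False using \<omega>N[OF t] Td[OF t] c by simp
      qed
      have "instantaneous_motion e A b t (\<gamma> t) = cross3 (\<omega> t) (\<gamma> t)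
          + (T (d t) - cross3 (\<omega> t) (A t *v ?p) - cross3 (\<omega> t) (b t))"
        unfolding instantaneous_motion_def spin[OF t] cross_matrix_apply
          vector_derivative_within_closed_interval[OF e(1) t b'[OF t]] by simp
      also have "\<dots> = T (d t) - cross3 (\<omega> t) (q t - \<gamma> t)"
        by (simp add: b_def Cross3.right_diff_distrib)
      also have "q t - \<gamma> t = r *\<^sub>R N (\<gamma> t)" using q_eq[OF t] by simp
      also have "T (d t) - cross3 (\<omega> t) (r *\<^sub>R N (\<gamma> t)) = 0" using \<omega>N[OF t] by simp
      finally show "instantaneous_motion e A b t (\<gamma> t) = 0" .
    qed
    fix t assume t: "t \<in> {0..e}"
    have "angular_velocity e A t = \<omega> t" unfolding angular_velocity_def
    proof (rule the_equality)
      show "\<forall>x. spin_matrix e A t *v x = cross3 (\<omega> t) x" by (simp add: spin[OF t] cross_matrix_apply)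
      fix w assume "\<forall>x. spin_matrix e A t *v x = cross3 w x"
      then have "cross3 (\<omega> t - w) x = 0" for x
        by (simp add: spin[OF t] cross_matrix_apply Cross3.left_diff_distrib)
      from cross3_eq_zero_all[OF this] show "w = \<omega> t" by simp
    qed
    then show "angular_velocity e A t \<in> tangent_plane S (\<gamma> t)"
      unfolding tan[OF t] by (simp add: \<omega>_def dot_cross_self)
  qed
  moreover have "rolling_speed e A b ?p t = c" if t: "t \<in> {0..e}" for t
    unfolding rolling_speed_def center vector_derivative_within_closed_interval[OF e(1) t q'[OF t]]
    by (rule Td[OF t])
  ultimately show "\<exists>\<epsilon>. 0 < \<epsilon> \<and> \<epsilon> \<le> l \<and> (\<exists>A b. rolling S N r \<epsilon> \<gamma> A b \<and>
      (\<forall>t\<in>{0..\<epsilon>}. rolling_speed \<epsilon> A b (ball_center N r p) t = c))" using e by blast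
qed

section \<open>Normals and speeds on planes, spheres and cylinders\<close>

text \<open>A continuous unit field orthogonal to \<open>S\<close> agrees with \<open>N\<close> up to a sign, which is constant by
  connectedness. This identifies the normal of each model surface.\<close>

lemma normal_eq_up_to_sign:
  assumes S: "C2_surface S" and conn: "connected S" and N: "unit_normal_field S N"
    and cont: "continuous_on S m" and m1: "\<And>x. x \<in> S \<Longrightarrow> norm (m x) = 1"
    and orth: "\<And>x v. x \<in> S \<Longrightarrow> v \<in> tangent_plane S x \<Longrightarrow> m x \<bullet> v = 0"
  obtains \<sigma> where "\<bar>\<sigma>\<bar> = 1" "\<And>x. x \<in> S \<Longrightarrow> N x = \<sigma> *\<^sub>R m x"
proof (cases "S = {}")
  case False
  have N1: "norm (N x) = 1" if "x \<in> S" for x using N that unfolding unit_normal_field_def by blast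
  have par: "m x = (m x \<bullet> N x) *\<^sub>R N x" if x: "x \<in> S" for x
    using orth[OF x] tangent_plane_eq_normal_hyperplane[OF S N x]
    by (intro parallel_of_equal_hyperplanes[OF N1[OF x]]) auto
  then have abs: "\<bar>m x \<bullet> N x\<bar> = 1" if "x \<in> S" for x
    using m1[OF that] N1[OF that] that by (metis mult.right_neutral norm_scaleR)
  have "(\<lambda>x. m x \<bullet> N x) constant_on S"
  proof (rule continuous_finite_range_constant[OF conn])
    show "continuous_on S (\<lambda>x. m x \<bullet> N x)"
      using cont N unfolding unit_normal_field_def by (intro continuous_intros) auto
    have "(\<lambda>x. m x \<bullet> N x) ` S \<subseteq> {1, -1}" using abs by (force simp: abs_eq_iff')
    then show "finite ((\<lambda>x. m x \<bullet> N x) ` S)" by (rule finite_subset) simp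
  qed
  then obtain \<sigma> where \<sigma>: "\<And>x. x \<in> S \<Longrightarrow> m x \<bullet> N x = \<sigma>" unfolding constant_on_def by blast
  then have abs\<sigma>: "\<bar>\<sigma>\<bar> = 1" using abs False by blast
  have "N x = \<sigma> *\<^sub>R m x" if x: "x \<in> S" for x
  proof -
    have "\<sigma> *\<^sub>R m x = (\<sigma> * \<sigma>) *\<^sub>R N x" using par[OF x] \<sigma>[OF x] by (metis scaleR_scaleR)
    moreover have "\<sigma> * \<sigma> = 1" using abs\<sigma> by (metis abs_mult_self_eq mult.right_neutral)
    ultimately show ?thesis by simp
  qed
  then show ?thesis using abs\<sigma> that by blast
qed (use that[of 1] in auto)

text \<open>The centre moves parallel to the contact point.\<close>

lemma plane_constant_speed:
  assumes S: "C2_surface S" and conn: "connected S" and N: "unit_normal_field S N"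
    and n: "n \<noteq> 0" and sub: "S \<subseteq> plane_through a n"
  shows "constant_speed S N 1"
proof -
  have orth: "(inverse (norm n) *\<^sub>R n) \<bullet> v = 0" if "v \<in> tangent_plane S x" for x v
  proof -
    have "((\<lambda>y. n \<bullet> (y - a)) has_derivative (\<lambda>h. n \<bullet> h)) (at x)" by (auto intro!: derivative_eq_intros)
    then have "n \<bullet> v = 0" by (rule tangent_plane_derivative_zero[OF that]) (use sub in \<open>auto simp: plane_through_def\<close>)
    then show ?thesis by simp
  qed
  have "continuous_on S (\<lambda>_. inverse (norm n) *\<^sub>R n)" "norm (inverse (norm n) *\<^sub>R n) = 1" using n by auto
  then obtain \<sigma> where \<sigma>: "\<And>x. x \<in> S \<Longrightarrow> N x = \<sigma> *\<^sub>R (inverse (norm n) *\<^sub>R n)"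
    using normal_eq_up_to_sign[OF S conn N, of "\<lambda>_. inverse (norm n) *\<^sub>R n"] orth by blast
  show ?thesis
    by (rule affine_normal_imp_constant_speed[OF S N, of 1 "\<lambda>x. x" 1 "\<sigma> *\<^sub>R (inverse (norm n) *\<^sub>R n)"])
      (auto simp: \<sigma> linear_id[unfolded id_def])
qed

text \<open>A ball of radius \<open>R\<close> is placed on the outer side, so its centre describes a sphere of radius \<open>2 R\<close> and has
  speed \<open>2\<close>; on the inner side its centre would stay fixed.\<close>

lemma sphere_constant_speed:
  assumes S: "C2_surface S" and conn: "connected S" and N: "unit_normal_field S N"
    and R: "R > 0" and sub: "S \<subseteq> sphere a R"
  obtains r where "r \<noteq> 0" "constant_speed S N r"
proof -
  have orth: "(inverse R *\<^sub>R (x - a)) \<bullet> v = 0" if v: "v \<in> tangent_plane S x" for x v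
  proof -
    have "((\<lambda>y. (y - a) \<bullet> (y - a)) has_derivative (\<lambda>h. (x - a) \<bullet> h + h \<bullet> (x - a))) (at x)"
      by (auto intro!: derivative_eq_intros)
    moreover have "(y - a) \<bullet> (y - a) = R\<^sup>2" if "y \<in> S" for y
      using that sub by (auto simp: dist_norm norm_minus_commute[of a] simp flip: power2_norm_eq_inner)
    ultimately have "(x - a) \<bullet> v + v \<bullet> (x - a) = 0" by (rule tangent_plane_derivative_zero[OF v])
    then show ?thesis by (simp add: inner_commute)
  qed
  have "norm (inverse R *\<^sub>R (x - a)) = 1" if "x \<in> S" for x
    using that sub R by (auto simp: dist_norm norm_minus_commute[of a])
  moreover have "continuous_on S (\<lambda>x. inverse R *\<^sub>R (x - a))" by (intro continuous_intros)
  ultimately obtain \<sigma> where \<sigma>: "\<bar>\<sigma>\<bar> = 1" "\<And>x. x \<in> S \<Longrightarrow> N x = \<sigma> *\<^sub>R (inverse R *\<^sub>R (x - a))"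
    using normal_eq_up_to_sign[OF S conn N, of "\<lambda>x. inverse R *\<^sub>R (x - a)"] orth by blast
  have \<sigma>2: "\<sigma> * \<sigma> = 1" using \<sigma>(1) by (metis abs_mult_self_eq mult.right_neutral)
  have "constant_speed S N (\<sigma> * R)"
  proof (rule affine_normal_imp_constant_speed[OF S N, of "\<sigma> * R" "\<lambda>x. 2 *\<^sub>R x" 2 "- a"])
    show "linear (\<lambda>x::real^3. 2 *\<^sub>R x)" by (rule linearI) (simp_all add: scaleR_add_right)
    show "x + (\<sigma> * R) *\<^sub>R N x = 2 *\<^sub>R x + - a" if "x \<in> S" for x
    proof -
      have "(\<sigma> * R) *\<^sub>R N x = ((\<sigma> * \<sigma>) * (R * inverse R)) *\<^sub>R (x - a)" by (simp add: \<sigma>(2)[OF that] mult_ac)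
      also have "\<dots> = x - a" using R \<sigma>2 by simp
      finally show ?thesis by (simp add: scaleR_2)
    qed
  qed (use R \<sigma> in auto)
  then show ?thesis using that[of "\<sigma> * R"] R \<sigma>(1) by auto
qed

lemma cylinder_normal:
  assumes S: "C2_surface S" and conn: "connected S" and N: "unit_normal_field S N"
    and u: "u \<noteq> 0" and R: "R > 0" and sub: "S \<subseteq> circular_cylinder a u R"
  obtains \<sigma> where "\<bar>\<sigma>\<bar> = 1" "\<And>x. x \<in> S \<Longrightarrow> N x = \<sigma> *\<^sub>R (inverse R *\<^sub>R radial_part u (x - a))"
proof -
  have nR: "norm (radial_part u (x - a)) = R" if "x \<in> S" for x
    using that sub mem_circular_cylinder[OF u] by blast
  have self: "radial_part u y \<bullet> radial_part u v = radial_part u y \<bullet> v" for y v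
  proof -
    have "radial_part u y \<bullet> (v - radial_part u v) = 0" using radial_part_inner[OF u, of y] by (simp add: radial_part_def[of u v])
    then show ?thesis by (simp add: inner_diff_right)
  qed
  have orth: "(inverse R *\<^sub>R radial_part u (x - a)) \<bullet> v = 0" if v: "v \<in> tangent_plane S x" for x v
  proof -
    have "((\<lambda>y. y - a) has_derivative (\<lambda>h. h)) (at x)" by (auto intro!: derivative_eq_intros)
    from bounded_linear.has_derivative[OF bounded_linear_radial_part this]
    have "((\<lambda>y. radial_part u (y - a) \<bullet> radial_part u (y - a)) has_derivative
      (\<lambda>h. radial_part u (x - a) \<bullet> radial_part u h + radial_part u h \<bullet> radial_part u (x - a))) (at x)"
      by (intro has_derivative_inner)
    moreover have "radial_part u (y - a) \<bullet> radial_part u (y - a) = R\<^sup>2" if "y \<in> S" for y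
      using nR[OF that] by (simp flip: power2_norm_eq_inner)
    ultimately have "radial_part u (x - a) \<bullet> radial_part u v + radial_part u v \<bullet> radial_part u (x - a) = 0"
      by (rule tangent_plane_derivative_zero[OF v])
    then show ?thesis using self[of "x - a" v] by (simp add: inner_commute)
  qed
  have "norm (inverse R *\<^sub>R radial_part u (x - a)) = 1" if "x \<in> S" for x using nR[OF that] R by simp
  moreover have "continuous_on S (\<lambda>x. inverse R *\<^sub>R radial_part u (x - a))"
    by (intro continuous_intros bounded_linear.continuous_on[OF bounded_linear_radial_part])
  ultimately show ?thesis
    using normal_eq_up_to_sign[OF S conn N, of "\<lambda>x. inverse R *\<^sub>R radial_part u (x - a)"] orth that by blast
qed

lemma norm_reflection:
  assumes "u \<noteq> 0" shows "norm (x - 2 *\<^sub>R radial_part u x) = norm x"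
proof -
  let ?y = "((x \<bullet> u) / (u \<bullet> u)) *\<^sub>R u" and ?z = "radial_part u x"
  have o: "orthogonal ?y ?z" "orthogonal ?y (- ?z)"
    using radial_part_inner[OF assms, of x] by (simp_all add: orthogonal_def inner_commute)
  have x: "x = ?y + ?z" by (simp add: radial_part_def)
  have "x - 2 *\<^sub>R ?z = (x - ?z) + - ?z" by (simp add: scaleR_2)
  also have "x - ?z = ?y" by (simp add: radial_part_def)
  finally have "x - 2 *\<^sub>R ?z = ?y + - ?z" .
  with x have "(norm (x - 2 *\<^sub>R ?z))\<^sup>2 = (norm x)\<^sup>2"
    using norm_add_Pythagorean[OF o(1)] norm_add_Pythagorean[OF o(2)] by (metis norm_minus_cancel)
  then show ?thesis by simp
qed

text \<open>For this \<open>r\<close> the centre lies on the same cylinder, diametrically across the axis, and \<open>T\<close> is the half-turn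
  about the axis, an isometry.\<close>

lemma cylinder_constant_speed:
  assumes S: "C2_surface S" and N: "unit_normal_field S N" and u: "u \<noteq> 0" and R: "R > 0"
    and \<sigma>: "\<bar>\<sigma>\<bar> = 1" "\<And>x. x \<in> S \<Longrightarrow> N x = \<sigma> *\<^sub>R (inverse R *\<^sub>R radial_part u (x - a))"
  shows "constant_speed S N (- 2 * \<sigma> * R)"
proof (rule affine_normal_imp_constant_speed[OF S N, of _ "\<lambda>x. x - 2 *\<^sub>R radial_part u x" 1 "2 *\<^sub>R radial_part u a"])
  show "linear (\<lambda>x. x - 2 *\<^sub>R radial_part u x)"
    by (rule linearI)
      (simp_all add: linear_add[OF linear_radial_part] linear_scale[OF linear_radial_part] algebra_simps)
  show "x + (- 2 * \<sigma> * R) *\<^sub>R N x = x - 2 *\<^sub>R radial_part u x + 2 *\<^sub>R radial_part u a" if x: "x \<in> S" for x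
  proof -
    have \<sigma>2: "\<sigma> * \<sigma> = 1" using \<sigma>(1) by (metis abs_mult_self_eq mult.right_neutral)
    have "(- 2 * \<sigma> * R) *\<^sub>R N x = (- 2 * (\<sigma> * \<sigma>) * (R * inverse R)) *\<^sub>R radial_part u (x - a)"
      by (simp add: \<sigma>(2)[OF x] mult_ac)
    also have "\<dots> = - 2 *\<^sub>R radial_part u (x - a)" using R \<sigma>2 by simp
    finally show ?thesis by (simp add: linear_diff[OF linear_radial_part] scaleR_diff_right)
  qed
  show "- 2 * \<sigma> * R \<noteq> 0" using R \<sigma>(1) by auto
qed (use norm_reflection[OF u] in auto)

text \<open>The speed in the axial direction is \<open>1\<close> whatever \<open>r\<close> is, and in the circular direction it is \<open>|1 - r / R|\<close>.\<close>

lemma inward_cylinder_radius: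
  assumes S: "C2_surface S" "S \<noteq> {}" and N: "unit_normal_field S N" and u: "u \<noteq> 0" and R: "R > 0"
    and inward: "\<And>x. x \<in> S \<Longrightarrow> N x = (- 1) *\<^sub>R (inverse R *\<^sub>R radial_part u (x - a))"
    and r: "r \<noteq> 0" and const: "constant_speed S N r"
  shows "r = 2 * R"
proof -
  obtain c where conf: "\<And>B X D D2 n' u v. surface_patch S N B X D D2 n' \<Longrightarrow> u \<in> B \<Longrightarrow>
      norm (D u v + r *\<^sub>R n' u v) = c * norm (D u v)"
    using constant_speed_imp_conformal_offset[OF S(1) N r const] by blast
  obtain p where p: "p \<in> S" using S(2) by blast
  obtain B X D D2 n' x where patch: "surface_patch S N B X D D2 n'" and x: "x \<in> B" "X x = p"
    using surface_patch_exists[OF S(1) N p] .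
  interpret surface_patch S N B X D D2 n' by (rule patch)
  have n'_eq: "n' x v = (- inverse R) *\<^sub>R radial_part u (D x v)" for v
  proof -
    have "((\<lambda>y. X y - a) has_derivative (\<lambda>v. D x v)) (at x)" using X[OF x(1)] by (auto intro!: derivative_eq_intros)
    from has_derivative_scaleR_right[OF bounded_linear.has_derivative[OF bounded_linear_radial_part this], of "- inverse R"]
    have "((\<lambda>y. N (X y)) has_derivative (\<lambda>v. (- inverse R) *\<^sub>R radial_part u (D x v))) (at x)"
      by (rule has_derivative_transform_within_open[OF _ open_B x(1)]) (use X_in inward in simp)
    from fun_cong[OF has_derivative_unique[OF n'[OF x(1)] this], of v] show ?thesis .
  qed
  have Nu: "N p \<bullet> u = 0" using inward[OF p] radial_part_inner[OF u] by simp
  have Np: "norm (N p) = 1" using normal_unit[OF x(1)] x(2) by simp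
  obtain v where v: "D x v = u" using range_D[OF x(1)] x(2) Nu by (metis (mono_tags, lifting) mem_Collect_eq rangeE)
  let ?y = "cross3 (N p) u"
  have "N p \<bullet> ?y = 0" by (simp add: dot_cross_self)
  then obtain w where w: "D x w = ?y" using range_D[OF x(1)] x(2) by (metis (mono_tags, lifting) mem_Collect_eq rangeE)
  have y: "?y \<noteq> 0" using norm_and_cross_eq_0[of "N p" u] Nu Np u by auto
  \<comment> \<open>the axial direction forces the speed to be one\<close>
  have "c = 1" using conf[OF patch x(1), of v] u by (simp add: n'_eq v)
  moreover have "radial_part u ?y = ?y" by (rule radial_part_orthogonal) (simp add: dot_cross_self)
  ultimately have "norm (?y + r *\<^sub>R (- inverse R) *\<^sub>R ?y) = norm ?y"
    using conf[OF patch x(1), of w] by (simp add: n'_eq w)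
  also have "?y + r *\<^sub>R (- inverse R) *\<^sub>R ?y = (1 - r / R) *\<^sub>R ?y"
    by (simp add: scaleR_diff_left divide_inverse)
  finally have "\<bar>1 - r / R\<bar> = 1" using y by simp
  then have "r / R = 2" using r R by (auto simp: abs_if split: if_splits)
  then show ?thesis using R by (simp add: field_simps)
qed

theorem corollary1p7:
  fixes S :: "(real^3) set" and N :: "real^3 \<Rightarrow> real^3"
  assumes "C2_surface S" and "S \<noteq> {}" and "connected S" and "unit_normal_field S N"
  shows "((\<exists>r. r \<noteq> 0 \<and> constant_speed S N r) \<longleftrightarrow>
            (\<exists>a n. n \<noteq> 0 \<and> S \<subseteq> plane_through a n) \<or>
            (\<exists>a u R. u \<noteq> 0 \<and> R > 0 \<and> S \<subseteq> circular_cylinder a u R) \<or>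
            (\<exists>a R. R > 0 \<and> S \<subseteq> sphere a R)) \<and>
         (\<forall>a u R. u \<noteq> 0 \<and> R > 0 \<and> S \<subseteq> circular_cylinder a u R \<and>
            (\<forall>p\<in>S. \<exists>s>0. p + s *\<^sub>R N p \<in> axis_line a u) \<longrightarrow>
            (\<forall>r. r \<noteq> 0 \<longrightarrow> (constant_speed S N r \<longleftrightarrow> r = 2 * R)))"
    (is "(?rolls \<longleftrightarrow> ?plane \<or> ?cylinder \<or> ?sphere) \<and> _")
proof (intro conjI allI impI)
  note S = assms(1-3) and N = assms(4)
  show "?rolls \<longleftrightarrow> ?plane \<or> ?cylinder \<or> ?sphere"
  proof
    assume ?rolls
    then obtain r where r: "r \<noteq> 0" "constant_speed S N r" by blast
    obtain L K where K: "\<And>x. x \<in> S \<Longrightarrow> L x + r *\<^sub>R N x = K"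
      and alt: "(\<exists>k. L = (\<lambda>x. k *\<^sub>R x)) \<or> (\<exists>w. w \<noteq> 0 \<and> (\<forall>x\<in>S. N x \<bullet> w = 0) \<and> L = (\<lambda>x. 2 *\<^sub>R radial_part w x))"
      using constant_speed_imp_affine_normal[OF S N r] by blast
    show "?plane \<or> ?cylinder \<or> ?sphere" by (rule affine_normal_imp_model[OF S N r(1) K alt])
  next
    assume "?plane \<or> ?cylinder \<or> ?sphere"
    then show ?rolls
    proof (elim disjE exE conjE)
      fix a n :: "real^3" assume "n \<noteq> 0" "S \<subseteq> plane_through a n"
      then have "constant_speed S N 1" by (rule plane_constant_speed[OF S(1,3) N])
      then show ?rolls by (intro exI[of _ 1]) simp
    next
      fix a u :: "real^3" and R :: real
      assume u: "u \<noteq> 0" and R: "R > 0" and sub: "S \<subseteq> circular_cylinder a u R"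
      obtain \<sigma> where \<sigma>: "\<bar>\<sigma>\<bar> = 1" "\<And>x. x \<in> S \<Longrightarrow> N x = \<sigma> *\<^sub>R (inverse R *\<^sub>R radial_part u (x - a))"
        using cylinder_normal[OF S(1,3) N u R sub] by blast
      have "constant_speed S N (- 2 * \<sigma> * R)" by (rule cylinder_constant_speed[OF S(1) N u R \<sigma>])
      moreover have "- 2 * \<sigma> * R \<noteq> 0" using R \<sigma>(1) by auto
      ultimately show ?rolls by blast
    next
      fix a :: "real^3" and R :: real assume "R > 0" "S \<subseteq> sphere a R"
      then show ?rolls using sphere_constant_speed[OF S(1,3) N] by metis
    qed
  qed
  fix a u :: "real^3" and R r :: real
  assume cyl: "u \<noteq> 0 \<and> R > 0 \<and> S \<subseteq> circular_cylinder a u R \<and>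
      (\<forall>p\<in>S. \<exists>s>0. p + s *\<^sub>R N p \<in> axis_line a u)" and r: "r \<noteq> 0"
  then have u: "u \<noteq> 0" and R: "R > 0" by auto
  obtain \<sigma> where \<sigma>: "\<bar>\<sigma>\<bar> = 1" "\<And>x. x \<in> S \<Longrightarrow> N x = \<sigma> *\<^sub>R (inverse R *\<^sub>R radial_part u (x - a))"
    using cylinder_normal[OF S(1,3) N u R] cyl by blast
  \<comment> \<open>the axis lies on the side to which the normal points\<close>
  have "\<sigma> = - 1"
  proof -
    obtain p where p: "p \<in> S" using S(2) by blast
    obtain s t where s: "s > 0" and t: "p + s *\<^sub>R N p = a + t *\<^sub>R u"
      using cyl p unfolding axis_line_def by blast
    define y where "y = radial_part u (p - a)"
    have "norm y = R" using cyl p mem_circular_cylinder[OF u] unfolding y_def by blast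
    then have y0: "y \<bullet> y > 0" using R by auto
    have "p - a = t *\<^sub>R u - s *\<^sub>R N p" using t by (simp add: algebra_simps)
    then have "y \<bullet> (p - a) = y \<bullet> (t *\<^sub>R u - s *\<^sub>R N p)" by simp
    moreover have yu: "y \<bullet> u = 0" unfolding y_def by (rule radial_part_inner[OF u])
    moreover have "y \<bullet> (p - a) = y \<bullet> y"
      using yu by (simp add: y_def[unfolded radial_part_def] inner_diff_right)
    ultimately have "y \<bullet> y = - (s * \<sigma> * inverse R) * (y \<bullet> y)"
      by (simp add: inner_diff_right \<sigma>(2)[OF p] flip: y_def)
    then have "(1 + s * \<sigma> * inverse R) * (y \<bullet> y) = 0" by (simp add: algebra_simps)
    then have "- (s * \<sigma> * inverse R) = 1" using y0 by auto
    then have "\<sigma> \<noteq> 1" using s R by (auto simp: field_simps)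
    then show ?thesis using \<sigma>(1) by auto
  qed
  then have in1: "N x = (- 1) *\<^sub>R (inverse R *\<^sub>R radial_part u (x - a))" if "x \<in> S" for x using \<sigma>(2)[OF that] by simp
  show "constant_speed S N r \<longleftrightarrow> r = 2 * R"
  proof
    assume "constant_speed S N r"
    then show "r = 2 * R" using inward_cylinder_radius[OF S(1,2) N u R in1 r] by blast
  next
    assume "r = 2 * R"
    then show "constant_speed S N r" using cylinder_constant_speed[OF S(1) N u R \<sigma>] \<open>\<sigma> = - 1\<close> by simp
  qed
qed

end
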